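(* Suppose $F\subset\mathrm{Sym}^2(\mathbb R^n)$ is a convex ST-invariant cone subequation and $U$ is an $F$-subharmonic function on the annulus $A=\{x\in\mathbb R^n: a<|x|<b\}$. If the spherical average $x\mapsto S(U,|x|)$, where $S(U,t)=\frac1{|S|}\int_S U(t\sigma)\,d\sigma$, is $F$-harmonic on $A$ and $S(U,t)$ is increasing (non-decreasing) in $t\in(a,b)$, then $U$ is $F$-maximal on $A$.
   Context: Fix $n\ge 2$ and $0\le a<b\le\infty$; $S$ is the unit sphere in $\mathbb R^n$. $\mathrm{Sym}^2(\mathbb R^n)$ is the space of real symmetric $n\times n$ matrices and $\mathcal P=\{A: A\ge 0\}$. A subequation is a nonempty proper closed subset $F\subset \mathrm{Sym}^2(\mathbb R^n)$ with $F+\mathcal P\subset F$. It is a cone if $tF\subset F$ for all $t\ge 0$. It is ST-invariant if there is a subgroup $G\subset O(n)$ acting transitively on $S^{n-1}$ such that $F$ is invariant under $A\mapsto gAg^t$ for all $g\in G$. An upper semi-continuous $u:X\to[-\infty,\infty)$ on an open set $X$, not identically $-\infty$ on any connected component of $X$, is $F$-subharmonic if whenever $\varphi$ is $C^2$ near $x_0\in X$ with $u\le\varphi$ near $x_0$ and equality at $x_0$, one has $D^2\varphi(x_0)\in F$. The dual subequation is $\widetilde F=\{A:-A\notin\mathrm{Int}\,F\}$; $u$ is $F$-harmonic on $X$ if $u$ is $F$-subharmonic and $-u$ is $\widetilde F$-subharmonic on $X$. An $F$-subharmonic function $u$ on $X$ is $F$-maximal on $X$ if for each $F$-subharmonic $v$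 on $X$ and each compact $K\subset X$: $v\le u$ on $X\setminus K$ implies $v\le u$ on $X$. *)

theory Defs
  imports "HOL-Analysis.Analysis" "HOL-Algebra.Group"
begin

section \<open>Subequations\<close>

definition Sym2 :: "(real^'n^'n) set" where
  "Sym2 = {A. transpose A = A}"

definition Psd :: "(real^'n^'n) set" where
  "Psd = {A \<in> Sym2. \<forall>x. 0 \<le> x \<bullet> (A *v x)}"

definition subequation :: "(real^'n^'n) set \<Rightarrow> bool" where
  "subequation F \<longleftrightarrow>
     closedin (top_of_set Sym2) F \<and> F \<noteq> {} \<and> F \<noteq> Sym2 \<and>
     (\<forall>A\<in>F. \<forall>P\<in>Psd. A + P \<in> F)"

definition cone_subequation :: "(real^'n^'n) set \<Rightarrow> bool" where
  "cone_subequation F \<longleftrightarrow> subequation F \<and> (\<forall>t\<ge>0. \<forall>A\<in>F. t *\<^sub>R A \<in> F)"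

definition orthogonal_group :: "(real^'n^'n) monoid" where
  "orthogonal_group = \<lparr>carrier = {g. orthogonal_matrix g}, mult = (**), one = mat 1\<rparr>"

lemma group_orthogonal_group: "group (orthogonal_group :: (real^'n^'n) monoid)"
proof (rule groupI)
  fix g :: "real^'n^'n" assume "g \<in> carrier orthogonal_group"
  then show "\<exists>h\<in>carrier orthogonal_group. h \<otimes>\<^bsub>orthogonal_group\<^esub> g = \<one>\<^bsub>orthogonal_group\<^esub>"
    by (intro bexI[of _ "transpose g"])
      (auto simp: orthogonal_group_def orthogonal_matrix_def transpose_transpose)
qed (auto simp: orthogonal_group_def orthogonal_matrix_mul orthogonal_matrix_id matrix_mul_assoc)

definition ST_invariant :: "(real^'n^'n) set \<Rightarrow> bool" where
  "ST_invariant F \<longleftrightarrow>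
     (\<exists>G. subgroup G orthogonal_group \<and>
          (\<forall>x\<in>sphere 0 1. \<forall>y\<in>sphere 0 1. \<exists>g\<in>G. g *v x = y) \<and>
          (\<forall>g\<in>G. \<forall>A\<in>F. g ** A ** transpose g \<in> F))"

text \<open>The interior in the dual is taken inside \<^const>\<open>Sym2\<close>; the interior of a set of symmetric
  matrices in the space of all matrices is usually empty.\<close>

definition dual_subequation :: "(real^'n^'n) set \<Rightarrow> (real^'n^'n) set" where
  "dual_subequation F = {A \<in> Sym2. - A \<notin> (top_of_set Sym2) interior_of F}"

section \<open>Subharmonic, harmonic and maximal functions\<close>

definition usc_on :: "'a::topological_space set \<Rightarrow> ('a \<Rightarrow> ereal) \<Rightarrow> bool" where
  "usc_on X u \<longleftrightarrow> (\<forall>x\<in>X. \<forall>c. u x < c \<longrightarrow> (\<forall>\<^sub>F y in at x within X. u y < c))"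

text \<open>\<open>C2_near \<phi> x0 H\<close>: the function \<open>\<phi>\<close> is of class \<open>C\<^sup>2\<close> on a neighbourhood of \<open>x0\<close>, and its
  Hessian matrix at \<open>x0\<close> is \<open>H\<close>. Here \<open>g\<close> is the gradient and \<open>D\<close> the Hessian.\<close>

definition C2_near :: "(real^'n \<Rightarrow> real) \<Rightarrow> real^'n \<Rightarrow> real^'n^'n \<Rightarrow> bool" where
  "C2_near \<phi> x0 H \<longleftrightarrow>
     (\<exists>V g D. open V \<and> x0 \<in> V \<and>
        (\<forall>x\<in>V. (\<phi> has_derivative (\<lambda>h. g x \<bullet> h)) (at x)) \<and>
        (\<forall>x\<in>V. (g has_derivative (\<lambda>h. D x *v h)) (at x)) \<and>
        continuous_on V D \<and> D x0 = H)"

definition F_subharmonic :: "(real^'n^'n) set \<Rightarrow> (real^'n) set \<Rightarrow> (real^'n \<Rightarrow> ereal) \<Rightarrow> bool" where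
  "F_subharmonic F X u \<longleftrightarrow>
     open X \<and> usc_on X u \<and> (\<forall>x\<in>X. u x < \<infinity>) \<and>
     (\<forall>C\<in>components X. \<exists>x\<in>C. u x \<noteq> -\<infinity>) \<and>
     (\<forall>x0\<in>X. \<forall>\<phi> H. C2_near \<phi> x0 H \<longrightarrow>
        (\<forall>\<^sub>F x in nhds x0. u x \<le> ereal (\<phi> x)) \<longrightarrow> u x0 = ereal (\<phi> x0) \<longrightarrow> H \<in> F)"

definition F_harmonic :: "(real^'n^'n) set \<Rightarrow> (real^'n) set \<Rightarrow> (real^'n \<Rightarrow> ereal) \<Rightarrow> bool" where
  "F_harmonic F X u \<longleftrightarrow>
     F_subharmonic F X u \<and> F_subharmonic (dual_subequation F) X (\<lambda>x. - u x)"

definition F_maximal :: "(real^'n^'n) set \<Rightarrow> (real^'n) set \<Rightarrow> (real^'n \<Rightarrow> ereal) \<Rightarrow> bool" where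
  "F_maximal F X u \<longleftrightarrow>
     F_subharmonic F X u \<and>
     (\<forall>v K. F_subharmonic F X v \<longrightarrow> compact K \<longrightarrow> K \<subseteq> X \<longrightarrow>
        (\<forall>x\<in>X - K. v x \<le> u x) \<longrightarrow> (\<forall>x\<in>X. v x \<le> u x))"

section \<open>Spherical averages\<close>

definition annulus :: "real \<Rightarrow> ereal \<Rightarrow> (real^'n) set" where
  "annulus a b = {x. a < norm x \<and> ereal (norm x) < b}"

text \<open>Surface measure of the unit sphere in polar coordinates: \<open>\<sigma>(E)\<close> is \<open>n\<close> times the Lebesgue
  measure of the part of the unit ball lying over \<open>E\<close>. The origin is removed since \<open>sgn 0 = 0\<close>
  is not on the sphere.\<close>

definition sphere_measure :: "(real^'n) measure" where
  "sphere_measure =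
     scale_measure (of_nat CARD('n))
       (distr (restrict_space lborel (cball 0 1 - {0})) (restrict_space borel (sphere 0 1)) sgn)"

lemma sgn_measurable_sphere:
  "sgn \<in> measurable (restrict_space lborel (cball 0 1 - {0 :: real^'n}))
           (restrict_space borel (sphere 0 1))"
proof (rule measurable_restrict_space2)
  show "sgn \<in> space (restrict_space lborel (cball 0 1 - {0 :: real^'n})) \<rightarrow> sphere 0 1"
    by (auto simp: space_restrict_space norm_sgn)
  have "(\<lambda>x :: real^'n. x /\<^sub>R norm x) \<in> borel_measurable borel"
    by measurable
  then show "sgn \<in> borel_measurable (restrict_space lborel (cball 0 1 - {0 :: real^'n}))"
    by (auto simp: sgn_div_norm[abs_def] intro: measurable_restrict_space1)
qed

lemma emeasure_sphere_measure:
  fixes E :: "(real^'n) set"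
  assumes "E \<in> sets borel" "E \<subseteq> sphere 0 1"
  shows "emeasure sphere_measure E =
           of_nat CARD('n) * emeasure lborel {x \<in> cball 0 1 - {0}. sgn x \<in> E}"
proof -
  have E: "E \<in> sets (restrict_space borel (sphere 0 1))"
    using assms by (auto simp: sets_restrict_space_iff)
  have "sgn -` E \<inter> space (restrict_space lborel (cball 0 1 - {0})) =
          {x \<in> cball 0 1 - {0}. sgn x \<in> E}"
    by (auto simp: space_restrict_space)
  then show ?thesis
    unfolding sphere_measure_def
    by (simp add: emeasure_distr[OF sgn_measurable_sphere E] emeasure_restrict_space
        Collect_mono_iff subset_iff)
qed

lemma measure_sphere_measure:
  "measure (sphere_measure :: (real^'n) measure) (sphere 0 1) =
     real CARD('n) * unit_ball_vol (real CARD('n))"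
proof -
  have "{x \<in> cball 0 1 - {0}. sgn x \<in> sphere 0 1} = cball 0 1 - {0 :: real^'n}"
    by (auto simp: norm_sgn)
  then have "emeasure (sphere_measure :: (real^'n) measure) (sphere 0 1) =
      of_nat CARD('n) * emeasure lborel (cball 0 1 - {0 :: real^'n})"
    by (simp add: emeasure_sphere_measure)
  also have "emeasure lborel (cball 0 1 - {0 :: real^'n}) = emeasure lborel (cball 0 1 :: (real^'n) set)"
    by (rule emeasure_Diff_null_set) auto
  also have "\<dots> = ennreal (unit_ball_vol (real CARD('n)))"
    using emeasure_cball[of 1 "0 :: real^'n"] by simp
  finally show ?thesis
    by (simp add: measure_def enn2real_mult)
qed

text \<open>Integral of an extended real valued function, as the difference of the integrals of its
  positive and negative parts. (\<^const>\<open>e2ennreal\<close> sends negative arguments to \<open>0\<close>.) A \<open>u\<close> that is upper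
  semicontinuous with values below \<open>\<infinity>\<close> is bounded above on each sphere, so for such \<open>u\<close> the first
  term is finite and the value is in \<open>[-\<infinity>, \<infinity>)\<close>.\<close>

definition ereal_integral :: "'a measure \<Rightarrow> ('a \<Rightarrow> ereal) \<Rightarrow> ereal" where
  "ereal_integral M f =
     enn2ereal (\<integral>\<^sup>+ x. e2ennreal (f x) \<partial>M) - enn2ereal (\<integral>\<^sup>+ x. e2ennreal (- f x) \<partial>M)"

definition spherical_average :: "(real^'n \<Rightarrow> ereal) \<Rightarrow> real \<Rightarrow> ereal" where
  "spherical_average u t =
     ereal (1 / measure (sphere_measure :: (real^'n) measure) (sphere 0 1)) *
     ereal_integral sphere_measure (\<lambda>\<sigma>. u (t *\<^sub>R \<sigma>))"

end

theory Submission
  imports Defs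
begin

text \<open>Let \<open>\<psi> t\<close> be the mean of \<open>U\<close> over the sphere of radius \<open>t\<close>. Let \<open>v\<close> be a competitor, so that
  \<open>v \<le> U\<close> outside a compact set, and let \<open>w = max v U\<close>. The heart of the matter is that the spherical means
  of \<open>w\<close> do not exceed \<open>\<psi>\<close> (\<open>spherical_mean_le\<close>). Since \<open>U \<le> w\<close>, it follows that the two functions agree
  almost everywhere on each sphere about the origin, hence almost everywhere, and hence everywhere, because \<open>w\<close>
  satisfies the classical mean value inequality while \<open>U\<close> is upper semicontinuous.

  The spherical mean of \<open>w\<close> is an average of rotates of \<open>w\<close>, but the viscosity definition of subharmonicity
  is not linear. It is linearised as follows. The closed convex cone \<open>F\<close> is an intersection of half spaces
  \<open>B \<bullet> A \<ge> 0\<close>. Averaging over the transitive group shows that traces on \<open>F\<close> are nonnegative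
  (\<open>trace_nonneg\<close>), so that the matrices \<open>B = T T\<^sup>t\<close> may be taken positive definite (\<open>separating_gram\<close>).
  For such \<open>B\<close>, a viscosity subsolution lies below its means over the ellipsoids \<open>x0 + T S\<close>, \<open>S\<close> a small sphere about \<open>0\<close>,
  (\<open>viscosity_sub_le_sphere_mean\<close>), and this inequality is linear. It is proved by comparison with harmonic
  polynomials, whose boundary values are dense on the sphere (\<open>harmonic_approx_on_sphere\<close>).

  In place of integrals over the group, only finite averages are used. By transitivity, suitable finite
  averages of a continuous function are bounded above by its spherical mean up to a small error (\<open>group_average_le_sphere_mean\<close>). So one may
  bound, instead of the mean of \<open>w\<close>, a finite average \<open>W\<close> of rotates of \<open>w\<close> which is at most slightly larger than \<open>\<psi>\<close> on two
  spheres near the boundary of the annulus. For unit vectors \<open>e\<close>, the matrix \<open>mat 1 - \<tau> *\<^sub>R outer e\<close> lies in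
  \<open>F\<close> exactly if \<open>\<tau> \<le> p\<close>, where \<open>p\<close> is the Riesz characteristic. So whether an increasing radial function
  is a sub- or supersolution depends only on \<open>p\<close>, and there is an explicit increasing radial profile \<open>k\<close> of
  characteristic \<open>p\<close> with the values of \<open>\<psi>\<close> on these two spheres; here the monotonicity of \<open>\<psi>\<close> enters.
  Between the two spheres \<open>k \<le> \<psi>\<close>, since \<open>\<psi>\<close> is a viscosity supersolution (\<open>radial_barrier_below\<close>), and
  \<open>W\<close> is at most slightly larger than \<open>k\<close>, by the maximum principle that follows from the linear mean value
  inequalities (\<open>radial_barrier_above\<close>).

  Functions with the value \<open>-\<infinity>\<close> are handled by truncation from below, which preserves all
  inequalities used.\<close>

section \<open>Means over the unit sphere\<close>

lemma space_sphere_measure [simp]: "space (sphere_measure :: (real^'n) measure) = sphere 0 1"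
  by (simp add: sphere_measure_def space_scale_measure space_restrict_space)

lemma sets_sphere_measure [measurable_cong]:
  "sets (sphere_measure :: (real^'n) measure) = sets (restrict_space borel (sphere 0 1))"
  by (simp add: sphere_measure_def)

lemma emeasure_sphere_measure_sphere:
  "emeasure (sphere_measure :: (real^'n) measure) (sphere 0 1) = ennreal (real CARD('n) * unit_ball_vol (real CARD('n)))"
proof -
  have "{x \<in> cball 0 1 - {0}. sgn x \<in> sphere 0 1} = cball 0 1 - {0 :: real^'n}"
    by (auto simp: norm_sgn)
  then have "emeasure (sphere_measure :: (real^'n) measure) (sphere 0 1) =
      of_nat CARD('n) * emeasure lborel (cball 0 1 - {0 :: real^'n})"
    by (simp add: emeasure_sphere_measure)
  also have "emeasure lborel (cball 0 1 - {0 :: real^'n}) = emeasure lborel (cball 0 1 :: (real^'n) set)"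
    by (rule emeasure_Diff_null_set) auto
  also have "\<dots> = ennreal (unit_ball_vol (real CARD('n)))"
    using emeasure_cball[of 1 "0 :: real^'n"] by simp
  finally show ?thesis
    by (simp add: ennreal_mult' ennreal_of_nat_eq_real_of_nat)
qed

lemma sphere_area_pos: "0 < measure (sphere_measure :: (real^'n) measure) (sphere 0 1)"
  by (simp add: measure_sphere_measure)

interpretation sphere_measure: finite_measure "sphere_measure :: (real^'n) measure"
  by (rule finite_measureI) (simp add: emeasure_sphere_measure_sphere)

text \<open>A linear isometry preserves the volume of balls, hence by Vitali covering that of open
  sets, and by outer regularity it does not increase the volume of Borel sets.\<close>

lemma emeasure_lborel_orthogonal_image_le:
  fixes f :: "real^'n \<Rightarrow> real^'n"
  assumes f: "orthogonal_transformation f" and A: "A \<in> sets borel" and fA: "f ` A \<in> sets borel"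
  shows "emeasure lborel (f ` A) \<le> emeasure lborel A"
proof (rule ennreal_le_epsilon)
  fix e :: real assume "0 < e"
  obtain U where U: "open U" "A \<subseteq> U" "U - A \<in> lmeasurable" "emeasure lebesgue (U - A) < ennreal e"
    using sets_lebesgue_outer_open[of A e] A \<open>0 < e\<close> by (auto simp: sets_completionI_sets)
  define K where "K = {i. 0 < snd i \<and> ball (fst i) (snd i) \<subseteq> U}"
  have cov: "\<exists>i. i \<in> K \<and> x \<in> ball (fst i) (snd i) \<and> snd i < d" if "x \<in> U" "0 < d" for x d
  proof -
    obtain r where "0 < r" "ball x r \<subseteq> U"
      using U(1) \<open>x \<in> U\<close> by (meson open_contains_ball)
    then show ?thesis
      using \<open>0 < d\<close> by (intro exI[of _ "(x, min r (d/2))"]) (auto simp: K_def)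
  qed
  \<comment> \<open>Isometries map balls to balls of the same radius, so it is enough to exhaust \<open>U\<close> by disjoint balls.\<close>
  obtain C where C: "countable C" "C \<subseteq> K"
     "pairwise (\<lambda>i j. disjnt (ball (fst i) (snd i)) (ball (fst j) (snd j))) C"
     "negligible (U - (\<Union>i \<in> C. ball (fst i) (snd i)))"
    by (rule Vitali_covering_theorem_balls[where S=U and K=K and a=fst and r=snd, OF cov])
  define N where "N = U - (\<Union>i \<in> C. ball (fst i) (snd i))"
  have lip: "norm (f y - f x) \<le> 1 * norm (y - x)" for x y
    using orthogonal_transformation_norm[OF f, of "y - x"]
    by (simp add: linear_diff[OF orthogonal_transformation_linear[OF f]])
  have "negligible (f ` N)"
  proof (rule negligible_locally_Lipschitz_image[OF _ C(4)[folded N_def]])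
    show "\<exists>T B. open T \<and> x \<in> T \<and> (\<forall>y\<in>N \<inter> T. norm (f y - f x) \<le> B * norm (y - x))" for x
      using lip by (intro exI[of _ UNIV] exI[of _ 1]) auto
  qed simp
  then have N: "f ` N \<in> null_sets lebesgue"
    by (simp add: negligible_iff_null_sets)
  have fball: "f ` ball x r = ball (f x) r" for x r
    using f by (rule image_orthogonal_transformation_ball)
  have sub: "f ` A \<subseteq> (\<Union>i\<in>C. ball (f (fst i)) (snd i)) \<union> f ` N"
  proof -
    have "A \<subseteq> (\<Union>i\<in>C. ball (fst i) (snd i)) \<union> N"
      using U(2) by (auto simp: N_def)
    then have "f ` A \<subseteq> (\<Union>i\<in>C. f ` ball (fst i) (snd i)) \<union> f ` N"
      by blast
    then show ?thesis
      by (simp add: fball)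
  qed
  have op: "(\<Union>i\<in>C. ball (f (fst i)) (snd i)) \<in> sets lebesgue"
    by (intro sets_completionI_sets) (simp add: borel_open open_UN)
  have "emeasure lborel (f ` A) = emeasure lebesgue (f ` A)"
    using fA by simp
  also have "\<dots> \<le> emeasure lebesgue ((\<Union>i\<in>C. ball (f (fst i)) (snd i)) \<union> f ` N)"
    by (rule emeasure_mono[OF sub]) (use N op in auto)
  also have "\<dots> = emeasure lebesgue (\<Union>i\<in>C. ball (f (fst i)) (snd i))"
    by (rule emeasure_Un_null_set[OF _ N]) (use op in auto)
  also have "\<dots> = (\<integral>\<^sup>+i. emeasure lebesgue (ball (f (fst i)) (snd i)) \<partial>count_space C)"
  proof (rule emeasure_UN_countable)
    have "f ` ball (fst i) (snd i) \<inter> f ` ball (fst j) (snd j) = {}" if "i \<in> C" "j \<in> C" "i \<noteq> j" for i j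
      using C(3) that orthogonal_transformation_inj[OF f]
      by (simp add: image_Int[symmetric] pairwise_def disjnt_def)
    then show "disjoint_family_on (\<lambda>i. ball (f (fst i)) (snd i)) C"
      by (auto simp: disjoint_family_on_def fball)
  qed (use C(1) in auto)
  also have "\<dots> = (\<integral>\<^sup>+i. emeasure lebesgue (ball (fst i) (snd i)) \<partial>count_space C)"
  proof (rule nn_integral_cong)
    fix i assume "i \<in> space (count_space C)"
    then have "0 \<le> snd i"
      using C(2) by (auto simp: K_def)
    then show "emeasure lebesgue (ball (f (fst i)) (snd i)) = emeasure lebesgue (ball (fst i) (snd i))"
      by (simp add: emeasure_ball)
  qed
  also have "\<dots> = emeasure lebesgue (\<Union>i\<in>C. ball (fst i) (snd i))"
    by (rule emeasure_UN_countable[symmetric])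
      (use C(1,3) in \<open>auto simp: disjoint_family_on_def pairwise_def disjnt_def\<close>)
  also have "\<dots> \<le> emeasure lebesgue U"
  proof (rule emeasure_mono)
    have "ball (fst i) (snd i) \<subseteq> U" if "i \<in> C" for i
      using C(2) that by (force simp: K_def)
    then show "(\<Union>i\<in>C. ball (fst i) (snd i)) \<subseteq> U"
      by blast
  qed (use U(1) in auto)
  also have "\<dots> = emeasure lebesgue (A \<union> (U - A))"
    using U(2) by (simp add: Un_absorb1)
  also have "\<dots> \<le> emeasure lebesgue A + emeasure lebesgue (U - A)"
    by (rule emeasure_subadditive) (use A U(1) in auto)
  also have "\<dots> \<le> emeasure lebesgue A + e"
    using U(4) by (intro add_left_mono) simp
  finally show "emeasure lborel (f ` A) \<le> emeasure lborel A + e"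
    using A by simp
qed

lemma emeasure_lborel_orthogonal_image:
  fixes f :: "real^'n \<Rightarrow> real^'n"
  assumes f: "orthogonal_transformation f" and A: "A \<in> sets borel" and fA: "f ` A \<in> sets borel"
  shows "emeasure lborel (f ` A) = emeasure lborel A"
proof (rule antisym)
  have "inv_into UNIV f ` f ` A = A"
    using orthogonal_transformation_inj[OF f] by (simp add: image_comp)
  then show "emeasure lborel A \<le> emeasure lborel (f ` A)"
    using emeasure_lborel_orthogonal_image_le[OF orthogonal_transformation_inv[OF f] fA] A by simp
qed (rule emeasure_lborel_orthogonal_image_le[OF assms])

lemma sgn_linear_isometry:
  fixes f :: "real^'n \<Rightarrow> real^'n"
  assumes "orthogonal_transformation f"
  shows "sgn (f x) = f (sgn x)"
  using assms
  by (simp add: sgn_div_norm orthogonal_transformation_norm linear_scale orthogonal_transformation_linear)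

lemma orthogonal_transformation_continuous_on:
  "orthogonal_transformation (f :: real^'n \<Rightarrow> real^'n) \<Longrightarrow> continuous_on S f"
  using linear_continuous_on linear_conv_bounded_linear orthogonal_transformation_linear by blast

lemma orthogonal_transformation_measurable_sphere:
  fixes f :: "real^'n \<Rightarrow> real^'n"
  assumes f: "orthogonal_transformation f"
  shows "f \<in> sphere_measure \<rightarrow>\<^sub>M sphere_measure"
proof -
  have "f \<in> borel_measurable borel"
    using orthogonal_transformation_continuous_on[OF f] by (rule borel_measurable_continuous_onI)
  then have "f \<in> restrict_space borel (sphere 0 1) \<rightarrow>\<^sub>M restrict_space borel (sphere 0 1)"
    by (intro measurable_restrict_space3) (auto simp: orthogonal_transformation_norm[OF f])
  then show ?thesis
    by (simp cong: measurable_cong_sets add: sets_sphere_measure)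
qed

lemma sgn_borel_measurable: "(sgn :: real^'n \<Rightarrow> real^'n) \<in> borel_measurable borel"
proof -
  have "(\<lambda>x :: real^'n. x /\<^sub>R norm x) \<in> borel_measurable borel"
    by measurable
  then show ?thesis
    by (simp add: sgn_div_norm[abs_def])
qed

text \<open>The radial projection commutes with linear isometries, so the invariance of Lebesgue
  measure passes to the sphere.\<close>

lemma sphere_measure_orthogonal_invariant:
  fixes f :: "real^'n \<Rightarrow> real^'n"
  assumes f: "orthogonal_transformation f"
  shows "distr sphere_measure sphere_measure f = sphere_measure"
proof (rule measure_eqI)
  fix E assume "E \<in> sets (distr sphere_measure sphere_measure f)"
  then have E: "E \<in> sets sphere_measure" by simp
  then have E': "E \<in> sets borel" "E \<subseteq> sphere 0 1"
    by (auto simp: sets_sphere_measure sets_restrict_space_iff)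
  let ?C = "\<lambda>E. {x \<in> cball 0 1 - {0 :: real^'n}. sgn x \<in> E}"
  have meas: "?C D \<in> sets borel" if "D \<in> sets borel" for D
  proof -
    have "?C D = (cball 0 1 - {0}) \<inter> (sgn -` D \<inter> space borel)"
      by auto
    also have "\<dots> \<in> sets borel"
      by (intro sets.Int measurable_sets[OF sgn_borel_measurable that]) auto
    finally show ?thesis .
  qed
  have fb: "f -` E \<inter> space sphere_measure \<in> sets sphere_measure"
    by (rule measurable_sets[OF orthogonal_transformation_measurable_sphere[OF f] E])
  then have fb': "f -` E \<inter> sphere 0 1 \<in> sets borel"
    by (auto simp: sets_sphere_measure sets_restrict_space_iff)
  have im: "f ` ?C (f -` E \<inter> sphere 0 1) = ?C E"
  proof
    show "f ` ?C (f -` E \<inter> sphere 0 1) \<subseteq> ?C E"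
      using f by (auto simp: sgn_linear_isometry orthogonal_transformation_norm)
         (metis norm_eq_zero orthogonal_transformation_norm)
    show "?C E \<subseteq> f ` ?C (f -` E \<inter> sphere 0 1)"
    proof
      fix y assume y: "y \<in> ?C E"
      obtain x where x: "y = f x"
        using orthogonal_transformation_surj[OF f] by (meson surjD)
      have "x \<in> ?C (f -` E \<inter> sphere 0 1)"
        using y x f linear_0[OF orthogonal_transformation_linear[OF f]]
        by (cases "x = 0") (auto simp: sgn_linear_isometry orthogonal_transformation_norm norm_sgn)
      then show "y \<in> f ` ?C (f -` E \<inter> sphere 0 1)"
        using x by blast
    qed
  qed
  have "emeasure (distr sphere_measure sphere_measure f) E = emeasure sphere_measure (f -` E \<inter> sphere 0 1)"
    by (simp add: emeasure_distr[OF orthogonal_transformation_measurable_sphere[OF f] E])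
  also have "\<dots> = of_nat CARD('n) * emeasure lborel (?C (f -` E \<inter> sphere 0 1))"
    by (rule emeasure_sphere_measure) (use fb' in auto)
  also have "emeasure lborel (?C (f -` E \<inter> sphere 0 1)) = emeasure lborel (?C E)"
    by (subst im[symmetric], rule emeasure_lborel_orthogonal_image[OF f, symmetric])
      (simp_all only: im meas[OF fb'] meas[OF E'(1)])
  also have "of_nat CARD('n) * \<dots> = emeasure sphere_measure E"
    by (rule emeasure_sphere_measure[symmetric]) (use E' in auto)
  finally show "emeasure (distr sphere_measure sphere_measure f) E = emeasure sphere_measure E" .
qed simp

definition sphere_mean :: "(real^'n \<Rightarrow> real) \<Rightarrow> real" where
  "sphere_mean f = (LINT \<sigma>|sphere_measure. f \<sigma>) / measure (sphere_measure :: (real^'n) measure) (sphere 0 1)"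

text \<open>The integrands that occur are bounded Borel functions; only their values on the unit
  sphere matter.\<close>

definition sphere_bounded :: "(real^'n \<Rightarrow> real) \<Rightarrow> bool" where
  "sphere_bounded f \<longleftrightarrow> f \<in> borel_measurable sphere_measure \<and> (\<exists>C. \<forall>\<sigma>\<in>sphere 0 1. \<bar>f \<sigma>\<bar> \<le> C)"

lemma sphere_bounded_integrable: "sphere_bounded f \<Longrightarrow> integrable sphere_measure f"
  unfolding sphere_bounded_def
  by (auto intro!: sphere_measure.integrable_const_bound AE_I2)

lemma continuous_on_imp_sphere_bounded:
  assumes "continuous_on (sphere 0 1 :: (real^'n) set) f"
  shows "sphere_bounded f"
proof -
  have "f \<in> borel_measurable (restrict_space borel (sphere 0 1))"
    using assms by (rule borel_measurable_continuous_on_restrict)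
  moreover have "bounded (f ` sphere 0 1)"
    using compact_continuous_image[OF assms] by (simp add: compact_imp_bounded)
  ultimately show ?thesis
    unfolding sphere_bounded_def bounded_iff
    by (auto cong: measurable_cong_sets simp: sets_sphere_measure)
qed

lemma sphere_bounded_const [simp]: "sphere_bounded (\<lambda>_. c)"
  by (rule continuous_on_imp_sphere_bounded) simp

lemma sphere_bounded_add [intro]: "sphere_bounded f \<Longrightarrow> sphere_bounded g \<Longrightarrow> sphere_bounded (\<lambda>x. f x + g x)"
  unfolding sphere_bounded_def
  by (auto intro!: borel_measurable_add) (meson abs_triangle_ineq add_mono order_trans)

lemma sphere_bounded_cmult [intro]:
  assumes "sphere_bounded f" shows "sphere_bounded (\<lambda>x. c * f x)"
proof -
  obtain C where "\<forall>\<sigma>\<in>sphere 0 1. \<bar>f \<sigma>\<bar> \<le> C" "f \<in> borel_measurable sphere_measure"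
    using assms by (auto simp: sphere_bounded_def)
  then show ?thesis
    unfolding sphere_bounded_def
    by (intro conjI exI[of _ "\<bar>c\<bar> * C"]) (auto simp: abs_mult mult_left_mono)
qed

lemma sphere_bounded_compose:
  fixes f :: "real^'n \<Rightarrow> real" and g :: "real^'n \<Rightarrow> real^'n"
  assumes f: "sphere_bounded f" and g: "orthogonal_transformation g"
  shows "sphere_bounded (\<lambda>x. f (g x))"
proof -
  have "(\<lambda>x. f (g x)) \<in> borel_measurable sphere_measure"
    using f measurable_compose[OF orthogonal_transformation_measurable_sphere[OF g]]
    by (auto simp: sphere_bounded_def)
  moreover have "g x \<in> sphere 0 1" if "x \<in> sphere 0 1" for x
    using that g by (simp add: orthogonal_transformation_norm)
  ultimately show ?thesis
    using f unfolding sphere_bounded_def by meson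
qed

lemma sphere_mean_const [simp]: "sphere_mean (\<lambda>_ :: real^'n. c) = c"
  using sphere_area_pos[where 'n='n] by (simp add: sphere_mean_def)

lemma sphere_mean_add: "sphere_bounded f \<Longrightarrow> sphere_bounded g \<Longrightarrow> sphere_mean (\<lambda>x. f x + g x) = sphere_mean f + sphere_mean g"
  by (simp add: sphere_mean_def sphere_bounded_integrable add_divide_distrib)

lemma sphere_mean_cmult: "sphere_mean (\<lambda>x. c * f x) = c * sphere_mean f"
  by (simp add: sphere_mean_def)

lemma sphere_mean_uminus: "sphere_mean (\<lambda>x. - f x) = - sphere_mean f"
  using sphere_mean_cmult[of "-1" f] by simp

lemma sphere_mean_mono:
  fixes f :: "real^'n \<Rightarrow> real"
  assumes "sphere_bounded f" "sphere_bounded g" "\<And>x. x \<in> sphere 0 1 \<Longrightarrow> f x \<le> g x"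
  shows "sphere_mean f \<le> sphere_mean g"
  unfolding sphere_mean_def using assms sphere_area_pos
  by (intro divide_right_mono integral_mono) (auto simp: sphere_bounded_integrable)

lemma sphere_mean_cong: "(\<And>x. x \<in> sphere 0 1 \<Longrightarrow> f x = g x) \<Longrightarrow> sphere_mean f = sphere_mean g"
  unfolding sphere_mean_def by (auto intro!: arg_cong2[where f="(/)"] Bochner_Integration.integral_cong)

lemma sphere_mean_orthogonal_invariant:
  fixes f :: "real^'n \<Rightarrow> real" and g :: "real^'n \<Rightarrow> real^'n"
  assumes f: "sphere_bounded f" and g: "orthogonal_transformation g"
  shows "sphere_mean (\<lambda>x. f (g x)) = sphere_mean f"
proof -
  have "(LINT \<sigma>|sphere_measure. f \<sigma>) = (LINT \<sigma>|distr sphere_measure sphere_measure g. f \<sigma>)"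
    by (simp add: sphere_measure_orthogonal_invariant[OF g])
  also have "\<dots> = (LINT \<sigma>|sphere_measure. f (g \<sigma>))"
    using f by (intro integral_distr orthogonal_transformation_measurable_sphere g)
      (simp add: sphere_bounded_def)
  finally show ?thesis
    by (simp add: sphere_mean_def)
qed

section \<open>Averaging over a transitive group\<close>

locale transitive_isometries =
  fixes G :: "(real^'n^'n) set"
  assumes orthogonal: "g \<in> G \<Longrightarrow> orthogonal_matrix g"
    and one_closed: "mat 1 \<in> G"
    and mult_closed: "g \<in> G \<Longrightarrow> h \<in> G \<Longrightarrow> g ** h \<in> G"
    and transpose_closed: "g \<in> G \<Longrightarrow> transpose g \<in> G"
    and transitive: "x \<in> sphere 0 1 \<Longrightarrow> y \<in> sphere 0 1 \<Longrightarrow> \<exists>g\<in>G. g *v x = y"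

text \<open>Averages are taken over finite lists with repetitions. Uniform weights suffice, and
  lists make this class of operators closed under composition.\<close>

definition group_average :: "(real^'n^'n) list \<Rightarrow> (real^'n \<Rightarrow> real) \<Rightarrow> real^'n \<Rightarrow> real" where
  "group_average L h x = (\<Sum>g\<leftarrow>L. h (g *v x)) / real (length L)"

definition list_product :: "(real^'n^'n) list \<Rightarrow> (real^'n^'n) list \<Rightarrow> (real^'n^'n) list" where
  "list_product L L' = concat (map (\<lambda>g'. map (\<lambda>g. g ** g') L) L')"

lemma length_list_product: "length (list_product L L') = length L * length L'"
  by (induction L') (auto simp: list_product_def)

lemma group_average_list_product: "group_average (list_product L L') h x = group_average L' (group_average L h) x"
proof -
  have "(\<Sum>g\<leftarrow>list_product L L'. h (g *v x)) = (\<Sum>g'\<leftarrow>L'. \<Sum>g\<leftarrow>L. h (g *v (g' *v x)))"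
    by (induction L') (auto simp: list_product_def o_def matrix_vector_mul_assoc)
  also have "\<dots> / real (length L) = (\<Sum>g'\<leftarrow>L'. (\<Sum>g\<leftarrow>L. h (g *v (g' *v x))) / real (length L))"
    by (induction L') (auto simp: add_divide_distrib)
  finally have "(\<Sum>g\<leftarrow>list_product L L'. h (g *v x)) / real (length L) = (\<Sum>g'\<leftarrow>L'. group_average L h (g' *v x))"
    unfolding group_average_def .
  then show ?thesis
    by (simp add: group_average_def[of "list_product L L'"] group_average_def[of L'] length_list_product flip: divide_divide_eq_left)
qed

lemma group_average_le:
  assumes "L \<noteq> []" "\<And>g. g \<in> set L \<Longrightarrow> h (g *v x) \<le> c"
  shows "group_average L h x \<le> c"
proof -
  have "(\<Sum>g\<leftarrow>L. h (g *v x)) \<le> (\<Sum>g\<leftarrow>L. c)"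
    using assms(2) by (intro sum_list_mono) auto
  also have "\<dots> = c * real (length L)"
    by (simp add: sum_list_triv)
  finally show ?thesis
    using assms(1) by (simp add: group_average_def divide_le_eq)
qed

lemma orthogonal_matrix_norm: "orthogonal_matrix g \<Longrightarrow> norm (g *v (x :: real^'n)) = norm x"
  by (metis matrix_of_matrix_vector_mul matrix_vector_mul_linear orthogonal_transformation_matrix orthogonal_transformation_norm)

lemma orthogonal_matrix_transformation: "orthogonal_matrix g \<Longrightarrow> orthogonal_transformation ((*v) (g :: real^'n^'n))"
  by (simp add: orthogonal_transformation_matrix)

context transitive_isometries
begin

lemma norm_G [simp]: "g \<in> G \<Longrightarrow> norm (g *v x) = norm x"
  by (simp add: orthogonal orthogonal_matrix_norm)

lemma list_product_closed: "set L \<subseteq> G \<Longrightarrow> set L' \<subseteq> G \<Longrightarrow> set (list_product L L') \<subseteq> G"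
  by (auto simp: list_product_def mult_closed subset_iff)

lemma group_average_sphere_bounded:
  assumes "sphere_bounded h" "set L \<subseteq> G"
  shows "sphere_bounded (group_average L h)"
proof -
  have "sphere_bounded (\<lambda>x. \<Sum>g\<leftarrow>L. h (g *v x))"
    using assms(2)
  proof (induction L)
    case (Cons g L)
    then show ?case
      using sphere_bounded_compose[OF assms(1) orthogonal_matrix_transformation[OF orthogonal, of g]]
      by (simp add: sphere_bounded_add)
  qed simp
  from sphere_bounded_cmult[OF this, of "1 / real (length L)"] show ?thesis
    by (simp add: group_average_def[abs_def])
qed

lemma sphere_mean_group_average:
  assumes "sphere_bounded h" "set L \<subseteq> G" "L \<noteq> []"
  shows "sphere_mean (group_average L h) = sphere_mean h"
proof -
  have "sphere_bounded (\<lambda>x. \<Sum>g\<leftarrow>L. h (g *v x)) \<and> sphere_mean (\<lambda>x. \<Sum>g\<leftarrow>L. h (g *v x)) = real (length L) * sphere_mean h"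
    using assms(2)
  proof (induction L)
    case (Cons g L)
    then show ?case
      using sphere_bounded_compose[OF assms(1) orthogonal_matrix_transformation[OF orthogonal, of g]]
        sphere_mean_orthogonal_invariant[OF assms(1) orthogonal_matrix_transformation[OF orthogonal, of g]]
      by (simp add: sphere_bounded_add sphere_mean_add algebra_simps)
  qed simp
  then show ?thesis
    using assms(3) sphere_mean_cmult[of "1 / real (length L)" "\<lambda>x. \<Sum>g\<leftarrow>L. h (g *v x)"]
    by (simp add: group_average_def[abs_def])
qed

lemma continuous_on_group_average:
  assumes "continuous_on (sphere 0 1) h" "set L \<subseteq> G"
  shows "continuous_on (sphere 0 1) (group_average L h)"
proof -
  have "continuous_on (sphere 0 1) (\<lambda>x. \<Sum>g\<leftarrow>L. h (g *v x))"
    using assms(2)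
  proof (induction L)
    case (Cons g L)
    have "continuous_on (sphere 0 1) (\<lambda>x. h (g *v x))"
      by (rule continuous_on_compose2[OF assms(1)])
        (use Cons.prems in \<open>auto intro: matrix_vector_mult_linear_continuous_on\<close>)
    then show ?case
      using Cons by (simp add: continuous_on_add)
  qed simp
  then show ?thesis
    by (cases "L = []") (auto simp: group_average_def[abs_def] intro!: continuous_on_divide)
qed

text \<open>A finite substitute for integration over \<open>G\<close> with respect to Haar measure:
  by transitivity, some finite average of the rotates of a continuous function is uniformly bounded
  above by its mean, up to an arbitrarily small error.\<close>

lemma group_average_le_sphere_mean:
  assumes h: "continuous_on (sphere 0 1) h" and "0 < d"
  shows "\<exists>L. L \<noteq> [] \<and> set L \<subseteq> G \<and> (\<forall>x\<in>sphere 0 1. group_average L h x \<le> sphere_mean h + d)"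
proof (rule ccontr)
  assume contra: "\<not> ?thesis"
  note hb = continuous_on_imp_sphere_bounded[OF h]
  \<comment> \<open>The upper bounds attained by averages of \<open>h\<close>; the claim is that their infimum is the mean.\<close>
  define C where "C = {c. \<exists>L. L \<noteq> [] \<and> set L \<subseteq> G \<and> (\<forall>x\<in>sphere 0 1. group_average L h x \<le> c)}"
  have C_ge: "sphere_mean h + d \<le> c" if "c \<in> C" for c
  proof (rule ccontr)
    assume "\<not> sphere_mean h + d \<le> c"
    then have "\<And>y. y \<le> c \<Longrightarrow> y \<le> sphere_mean h + d" by simp
    then show False
      using contra that unfolding C_def by blast
  qed
  have "uniformly_continuous_on (sphere 0 1) h"
    using h by (simp add: compact_uniformly_continuous)
  then obtain r where "0 < r" and r: "\<And>x y. x \<in> sphere 0 1 \<Longrightarrow> y \<in> sphere 0 1 \<Longrightarrow> dist x y < r \<Longrightarrow> \<bar>h x - h y\<bar> < d / 2"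
    using \<open>0 < d\<close> unfolding uniformly_continuous_on_def dist_real_def
    by (metis half_gt_zero dist_commute)
  \<comment> \<open>All averages of \<open>h\<close> share the modulus of continuity of \<open>h\<close>.\<close>
  have r_avg: "group_average L h x \<le> group_average L h y + d / 2"
    if L: "L \<noteq> []" "set L \<subseteq> G" and xy: "x \<in> sphere 0 1" "y \<in> sphere 0 1" "dist x y < r" for L x y
  proof -
    have "(\<Sum>g\<leftarrow>L. h (g *v x)) \<le> (\<Sum>g\<leftarrow>L. h (g *v y) + d / 2)"
    proof (rule sum_list_mono)
      fix g assume "g \<in> set L"
      then have g: "g \<in> G" using L by auto
      have "dist (g *v x) (g *v y) = dist x y"
        using g by (simp add: dist_norm flip: matrix_vector_mult_diff_distrib)
      then show "h (g *v x) \<le> h (g *v y) + d / 2"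
        using r[of "g *v x" "g *v y"] g xy unfolding abs_less_iff by simp
    qed
    also have "\<dots> = (\<Sum>g\<leftarrow>L. h (g *v y)) + real (length L) * (d / 2)"
      by (simp add: sum_list_addf sum_list_triv)
    finally show ?thesis
      using L(1) by (simp add: group_average_def field_simps)
  qed
  have cover: "sphere 0 1 \<subseteq> (\<Union>y\<in>sphere 0 1. ball (y :: real^'n) r)"
    using \<open>0 < r\<close> by auto
  obtain Y :: "(real^'n) set" where Y: "Y \<subseteq> sphere 0 1" "finite Y" "sphere 0 1 \<subseteq> (\<Union>y\<in>Y. ball y r)"
    by (rule compactE_image[OF compact_sphere _ cover]) (rule open_ball)
  have ne: "sphere 0 1 \<noteq> ({} :: (real^'n) set)"
    using vector_choose_size[of 1] by auto
  then have "Y \<noteq> {}"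
    using Y(3) by auto
  define m where "m = real (card Y)"
  have "1 \<le> m"
    using \<open>Y \<noteq> {}\<close> Y(2) by (simp add: m_def card_gt_0_iff Suc_le_eq)
  obtain M where M: "\<forall>x\<in>sphere 0 1. h x \<le> M"
    using hb by (auto simp: sphere_bounded_def abs_le_iff)
  then have "M \<in> C"
    unfolding C_def using one_closed by (auto simp: group_average_def intro!: exI[of _ "[mat 1]"])
  then have "C \<noteq> {}" by auto
  have bdd: "bdd_below C"
    using C_ge by (rule bdd_belowI)
  have "\<exists>c\<in>C. c < Inf C + d / (4 * m)"
    using \<open>C \<noteq> {}\<close> \<open>0 < d\<close> \<open>1 \<le> m\<close> bdd cInf_less_iff[of C "Inf C + d / (4 * m)"] by simp
  then obtain c L where c: "c < Inf C + d / (4 * m)" "c \<in> C"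
    and L: "L \<noteq> []" "set L \<subseteq> G" "\<And>x. x \<in> sphere 0 1 \<Longrightarrow> group_average L h x \<le> c"
    unfolding C_def by blast
  have "\<exists>x0\<in>sphere 0 1. group_average L h x0 < sphere_mean h + d / 4"
  proof (rule ccontr)
    assume "\<not> ?thesis"
    then have "sphere_mean (\<lambda>_ :: real^'n. sphere_mean h + d / 4) \<le> sphere_mean (group_average L h)"
      by (intro sphere_mean_mono group_average_sphere_bounded hb L) (auto simp: not_less)
    then show False
      using \<open>0 < d\<close> sphere_mean_group_average[OF hb L(2,1)] by simp
  qed
  then obtain x0 where x0: "x0 \<in> sphere 0 1" "group_average L h x0 < sphere_mean h + d / 4"
    by blast
  have "\<forall>y\<in>Y. \<exists>g. g \<in> G \<and> g *v y = x0"
    using transitive[OF _ x0(1)] Y(1) by blast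
  from bchoice[OF this] obtain \<gamma> where \<gamma>: "\<And>y. y \<in> Y \<Longrightarrow> \<gamma> y \<in> G \<and> \<gamma> y *v y = x0"
    by blast
  obtain ys where ys: "set ys = Y" "distinct ys"
    using Y(2) finite_distinct_list by blast
  have len: "real (length ys) = m"
    using distinct_card[OF ys(2)] ys(1) by (simp add: m_def)
  have "ys \<noteq> []" using ys \<open>Y \<noteq> {}\<close> by auto
  \<comment> \<open>The near-optimal average is below the mean plus \<open>d / 4\<close> at \<open>x0\<close>, hence well below \<open>c\<close> on a ball
    about \<open>x0\<close>. Averaging it over \<open>m\<close> elements of \<open>G\<close> that carry a finite cover of the sphere to that ball makes
    every point profit, which lowers the bound by \<open>d / (4 * m)\<close>. The number \<open>m\<close> depends only on the modulus of
    continuity, so this beats the infimum.\<close>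
  define L' where "L' = list_product L (map \<gamma> ys)"
  have "group_average L' h x \<le> c - d / (4 * m)" if x: "x \<in> sphere 0 1" for x
  proof -
    obtain y where y: "y \<in> Y" "dist y x < r"
      using Y(3) x by auto
    have yc: "group_average L h (\<gamma> y *v x) \<le> c - d / 4"
    proof -
      have "dist (\<gamma> y *v x) x0 = dist x y"
        using \<gamma>[OF y(1)] norm_G[of "\<gamma> y" "x - y"] by (simp add: dist_norm matrix_vector_mult_diff_distrib)
      then have "group_average L h (\<gamma> y *v x) \<le> group_average L h x0 + d / 2"
        using \<gamma>[OF y(1)] x x0(1) y(2) by (intro r_avg L) (auto simp: dist_commute)
      then show ?thesis
        using x0(2) C_ge[OF c(2)] by simp
    qed
    have "(\<Sum>z\<in>Y. group_average L h (\<gamma> z *v x)) = group_average L h (\<gamma> y *v x) + (\<Sum>z\<in>Y - {y}. group_average L h (\<gamma> z *v x))"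
      using Y(2) y(1) by (rule sum.remove)
    also have "\<dots> \<le> (c - d / 4) + (\<Sum>z\<in>Y - {y}. c)"
      using \<gamma> x by (intro add_mono yc sum_mono L) auto
    also have "\<dots> = m * c - d / 4"
      using y(1) Y(2) \<open>1 \<le> m\<close> by (simp add: m_def card_Diff_singleton algebra_simps of_nat_diff card_gt_0_iff Suc_le_eq)
    finally have "(\<Sum>z\<in>Y. group_average L h (\<gamma> z *v x)) \<le> m * c - d / 4" .
    moreover have "group_average L' h x = (\<Sum>z\<in>Y. group_average L h (\<gamma> z *v x)) / m"
      using ys len by (simp add: L'_def group_average_list_product group_average_def[of "map \<gamma> ys"] o_def sum_list_distinct_conv_sum_set)
    ultimately show ?thesis
      using \<open>1 \<le> m\<close> by (simp add: field_simps)
  qed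
  moreover have "L' \<noteq> []" "set L' \<subseteq> G"
    using L(1,2) \<gamma> ys \<open>ys \<noteq> []\<close> list_product_closed[of L "map \<gamma> ys"]
    by (auto simp: L'_def length_list_product simp flip: length_greater_0_conv)
  ultimately have "c - d / (4 * m) \<in> C"
    unfolding C_def by blast
  then have "Inf C \<le> c - d / (4 * m)"
    using bdd by (rule cInf_lower)
  then show False
    using c(1) by simp
qed

text \<open>Averaging once more does not raise a bound already obtained, so two functions can be
  treated one after the other. This is needed for the two boundary spheres of a shell.\<close>

lemma group_average_le_sphere_mean2:
  assumes h: "continuous_on (sphere 0 1) h1" "continuous_on (sphere 0 1) h2" and "0 < d"
  shows "\<exists>L. L \<noteq> [] \<and> set L \<subseteq> G \<and>
    (\<forall>x\<in>sphere 0 1. group_average L h1 x \<le> sphere_mean h1 + d \<and> group_average L h2 x \<le> sphere_mean h2 + d)"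
proof -
  obtain L1 where L1: "L1 \<noteq> []" "set L1 \<subseteq> G" "\<forall>x\<in>sphere 0 1. group_average L1 h1 x \<le> sphere_mean h1 + d"
    using group_average_le_sphere_mean[OF h(1) \<open>0 < d\<close>] by blast
  obtain L2 where L2: "L2 \<noteq> []" "set L2 \<subseteq> G" "\<forall>x\<in>sphere 0 1. group_average L2 (group_average L1 h2) x \<le> sphere_mean (group_average L1 h2) + d"
    using group_average_le_sphere_mean[OF continuous_on_group_average[OF h(2) L1(2)] \<open>0 < d\<close>] by blast
  have "group_average (list_product L1 L2) h1 x \<le> sphere_mean h1 + d" if "x \<in> sphere 0 1" for x
    unfolding group_average_list_product using that L1(3) L2(2)
    by (intro group_average_le[where h = "group_average L1 h1"] L2(1)) auto
  moreover have "group_average (list_product L1 L2) h2 x \<le> sphere_mean h2 + d" if "x \<in> sphere 0 1" for x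
    unfolding group_average_list_product using that L2(3) sphere_mean_group_average[OF continuous_on_imp_sphere_bounded[OF h(2)] L1(2,1)] by simp
  moreover have "list_product L1 L2 \<noteq> []"
    using L1(1) L2(1) by (simp add: length_list_product flip: length_greater_0_conv)
  ultimately show ?thesis
    using list_product_closed[OF L1(2) L2(2)] by blast
qed

end

lemma transitive_isometries_orthogonal:
  "transitive_isometries {g :: real^'n^'n. orthogonal_matrix g}"
proof
  fix x y :: "real^'n" assume "x \<in> sphere 0 1" "y \<in> sphere 0 1"
  then obtain f where "orthogonal_transformation f" "f x = y"
    using orthogonal_transformation_exists_1[of x y] by auto
  then show "\<exists>g\<in>{g. orthogonal_matrix g}. g *v x = y"
    by (intro bexI[of _ "matrix f"]) (auto simp: orthogonal_transformation_matrix matrix_works)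
qed (auto simp: orthogonal_matrix_id orthogonal_matrix_mul)

section \<open>Upper semicontinuous functions\<close>

definition real_usc :: "'a::topological_space set \<Rightarrow> ('a \<Rightarrow> real) \<Rightarrow> bool" where
  "real_usc X f \<longleftrightarrow> (\<forall>c. openin (top_of_set X) {x\<in>X. f x < c})"

lemma real_usc_continuous:
  assumes "continuous_on X f"
  shows "real_usc X f"
  unfolding real_usc_def
proof
  fix c :: real
  have "{x\<in>X. f x < c} = X \<inter> f -` {..<c}" by auto
  then show "openin (top_of_set X) {x\<in>X. f x < c}"
    using continuous_openin_preimage_gen[OF assms, of "{..<c}"] by simp
qed

lemma real_usc_subset: "real_usc X f \<Longrightarrow> Y \<subseteq> X \<Longrightarrow> real_usc Y f"
  unfolding real_usc_def openin_open
proof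
  fix c assume a: "\<forall>c. \<exists>T. open T \<and> {x \<in> X. f x < c} = X \<inter> T" "Y \<subseteq> X"
  then obtain T where "open T" "{x \<in> X. f x < c} = X \<inter> T" by blast
  then show "\<exists>T. open T \<and> {x \<in> Y. f x < c} = Y \<inter> T"
    using a(2) by (intro exI[of _ T]) auto
qed

lemma real_usc_compose:
  assumes "real_usc X f" "continuous_on Y g" "g ` Y \<subseteq> X"
  shows "real_usc Y (\<lambda>y. f (g y))"
  unfolding real_usc_def
proof
  fix c
  have "openin (top_of_set Y) (Y \<inter> g -` {x\<in>X. f x < c})"
    using assms(1)
    by (intro continuous_openin_preimage[OF assms(2), where T = X]) (use assms(3) in \<open>auto simp: real_usc_def\<close>)
  moreover have "Y \<inter> g -` {x\<in>X. f x < c} = {y\<in>Y. f (g y) < c}"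
    using assms(3) by auto
  ultimately show "openin (top_of_set Y) {y\<in>Y. f (g y) < c}" by simp
qed

lemma real_usc_add:
  assumes "real_usc X f" "real_usc X g"
  shows "real_usc X (\<lambda>x. f x + g x)"
  unfolding real_usc_def
proof
  fix c
  have "{x\<in>X. f x + g x < c} = (\<Union>a. {x\<in>X. f x < a} \<inter> {x\<in>X. g x < c - a})"
  proof (intro equalityI subsetI)
    fix x assume x: "x \<in> {x\<in>X. f x + g x < c}"
    then have "f x < (f x + c - g x) / 2 \<and> g x < c - (f x + c - g x) / 2"
      by (simp add: field_simps)
    then show "x \<in> (\<Union>a. {x\<in>X. f x < a} \<inter> {x\<in>X. g x < c - a})"
      using x by blast
  next
    fix x assume "x \<in> (\<Union>a. {x\<in>X. f x < a} \<inter> {x\<in>X. g x < c - a})"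
    then obtain a where "x \<in> X" "f x < a" "g x < c - a" by blast
    then show "x \<in> {x\<in>X. f x + g x < c}" by simp
  qed
  also have "openin (top_of_set X) \<dots>"
    using assms by (intro openin_Union openin_Int) (auto simp: real_usc_def)
  finally show "openin (top_of_set X) {x\<in>X. f x + g x < c}" .
qed

lemma real_usc_cmult:
  assumes "real_usc X f" "0 < a"
  shows "real_usc X (\<lambda>x. a * f x)"
proof -
  have "{x\<in>X. a * f x < c} = {x\<in>X. f x < c / a}" for c
    using assms(2) by (auto simp: field_simps)
  then show ?thesis using assms by (simp add: real_usc_def)
qed

lemma real_usc_diff_continuous:
  fixes f :: "_ \<Rightarrow> real"
  shows "real_usc X f \<Longrightarrow> continuous_on X g \<Longrightarrow> real_usc X (\<lambda>x. f x - g x)"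
  using real_usc_add[of X f "\<lambda>x. - g x"] real_usc_continuous[of X "\<lambda>x. - g x"] by (simp add: continuous_on_minus)

text \<open>The strict sublevel sets at values of \<open>f\<close> would form an open cover of
  \<open>C\<close> without finite subcover.\<close>

lemma real_usc_attains_sup:
  assumes "real_usc C f" "compact C" "C \<noteq> {}"
  obtains x where "x \<in> C" "\<And>y. y \<in> C \<Longrightarrow> f y \<le> f x"
proof (rule ccontr)
  assume "\<not> thesis"
  then have ex: "\<And>x. x \<in> C \<Longrightarrow> \<exists>y\<in>C. f x < f y"
    using that by (meson not_le)
  have "\<forall>y. \<exists>T. open T \<and> {x\<in>C. f x < f y} = C \<inter> T"
    using assms(1) by (auto simp: real_usc_def openin_open)
  from choice[OF this] obtain T where T: "\<And>y. open (T y)" "\<And>y. {x\<in>C. f x < f y} = C \<inter> T y"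
    by blast
  have cover: "C \<subseteq> (\<Union>y\<in>C. T y)"
  proof
    fix x assume "x \<in> C"
    with ex obtain y where "y \<in> C" "f x < f y" by blast
    then show "x \<in> (\<Union>y\<in>C. T y)"
      using T(2)[of y] \<open>x \<in> C\<close> by blast
  qed
  obtain Y where Y: "Y \<subseteq> C" "finite Y" "C \<subseteq> (\<Union>y\<in>Y. T y)"
    by (rule compactE_image[OF assms(2) T(1) cover])
  then have "Y \<noteq> {}" using assms(3) by auto
  then obtain y where y: "y \<in> Y" "f y = Max (f ` Y)"
    using Max_in[of "f ` Y"] Y(2) by (metis (no_types, lifting) finite_imageI image_iff image_is_empty)
  obtain z where "z \<in> Y" "y \<in> T z"
    using Y y(1) by blast
  then have "f y < f z"
    using T(2)[of z] y(1) Y(1) by blast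
  moreover have "f z \<le> f y"
    using y(2) \<open>z \<in> Y\<close> Y(2) by simp
  ultimately show False by simp
qed

lemma real_usc_borel_measurable:
  assumes "real_usc X f" "X \<in> sets borel"
  shows "f \<in> borel_measurable (restrict_space borel X)"
proof (rule borel_measurableI_less)
  fix c
  obtain T where "open T" "{x\<in>X. f x < c} = X \<inter> T"
    using assms(1) by (auto simp: real_usc_def openin_open)
  then show "{x \<in> space (restrict_space borel X). f x < c} \<in> sets (restrict_space borel X)"
    using assms(2) by (auto simp: space_restrict_space sets_restrict_space_iff)
qed

lemma real_usc_sphere_bounded:
  assumes "real_usc (sphere 0 1) f" "\<And>x. x \<in> sphere 0 1 \<Longrightarrow> m \<le> f x"
  shows "sphere_bounded (f :: real^'n \<Rightarrow> real)"
proof -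
  have "sphere 0 1 \<noteq> ({} :: (real^'n) set)"
    using vector_choose_size[of 1] by auto
  then obtain x where x: "\<And>y. y \<in> sphere 0 1 \<Longrightarrow> f y \<le> f x"
    using real_usc_attains_sup[OF assms(1)] by auto
  have "\<bar>f y\<bar> \<le> \<bar>m\<bar> + \<bar>f x\<bar>" if "y \<in> sphere 0 1" for y
    using assms(2)[OF that] x[OF that] by linarith
  moreover have "f \<in> borel_measurable sphere_measure"
    using real_usc_borel_measurable[OF assms(1)] by (simp cong: measurable_cong_sets add: sets_sphere_measure)
  ultimately show ?thesis
    unfolding sphere_bounded_def by blast
qed

text \<open>Upper semicontinuous functions are decreasing limits of continuous ones, so their means
  are infima of means of continuous majorants.\<close>

lemma real_usc_continuous_approx:
  fixes f :: "real^'n \<Rightarrow> real"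
  assumes f: "real_usc (sphere 0 1) f" and m: "\<And>x. x \<in> sphere 0 1 \<Longrightarrow> m \<le> f x" and "0 < d"
  shows "\<exists>h. continuous_on (sphere 0 1) h \<and> (\<forall>x\<in>sphere 0 1. f x \<le> h x) \<and> sphere_mean h \<le> sphere_mean f + d"
proof -
  let ?S = "sphere 0 1 :: (real^'n) set"
  have fb: "sphere_bounded f" by (rule real_usc_sphere_bounded[OF f m])
  then obtain C where C: "\<And>x. x \<in> ?S \<Longrightarrow> \<bar>f x\<bar> \<le> C"
    unfolding sphere_bounded_def by blast
  have ne: "?S \<noteq> {}"
    using vector_choose_size[of 1] by auto
  have nonneg: "0 \<le> real k * dist x y" for k and x y :: "real^'n"
    by simp
  \<comment> \<open>The sup-convolution of \<open>f\<close> with the cone \<open>k * dist\<close>: it is \<open>k\<close>-Lipschitz and decreases to \<open>f\<close>.\<close>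
  define h where "h k x = (SUP y\<in>?S. f y - real k * dist x y)" for k :: nat and x
  have bdd: "bdd_above ((\<lambda>y. f y - real k * dist x y) ` ?S)" for k x
  proof (intro bdd_aboveI2)
    fix y assume "y \<in> ?S"
    then show "f y - real k * dist x y \<le> C"
      using C[of y] nonneg[of k x y] by linarith
  qed
  have h_ge: "f x \<le> h k x" if "x \<in> ?S" for k x
    unfolding h_def using cSUP_upper[OF that bdd, of k x] by simp
  have h_le: "h k x \<le> C" for k x
    unfolding h_def
  proof (rule cSUP_least[OF ne])
    fix y assume "y \<in> ?S"
    then show "f y - real k * dist x y \<le> C"
      using C[of y] nonneg[of k x y] by linarith
  qed
  have h_lip: "h k x \<le> h k x' + real k * dist x x'" for k x x'
    unfolding h_def[of k x]
  proof (rule cSUP_least[OF ne])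
    fix y assume y: "y \<in> ?S"
    have "f y - real k * dist x' y \<le> h k x'"
      unfolding h_def by (rule cSUP_upper[OF y bdd])
    moreover have "real k * dist x' y \<le> real k * (dist x x' + dist x y)"
      by (intro mult_left_mono) (metis dist_commute dist_triangle2 add.commute, simp)
    ultimately show "f y - real k * dist x y \<le> h k x' + real k * dist x x'"
      by (simp add: algebra_simps)
  qed
  have h_cont: "continuous_on ?S (h k)" for k
  proof -
    have "dist (h k x) (h k y) \<le> real k * dist x y" for x y
      using h_lip[of k x y] h_lip[of k y x] by (simp add: dist_real_def dist_commute abs_le_iff)
    then have "(real k)-lipschitz_on ?S (h k)"
      by (intro lipschitz_onI) auto
    then show ?thesis by (rule lipschitz_on_continuous_on)
  qed
  have h_lim: "(\<lambda>k. h k x) \<longlonglongrightarrow> f x" if x: "x \<in> ?S" for x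
  proof (rule LIMSEQ_I)
    fix e :: real assume "0 < e"
    have "openin (top_of_set ?S) {y\<in>?S. f y < f x + e / 2}"
      using f by (auto simp: real_usc_def)
    then obtain r where "0 < r" and r: "\<And>y. y \<in> ?S \<Longrightarrow> dist y x < r \<Longrightarrow> f y < f x + e / 2"
      using x \<open>0 < e\<close> unfolding openin_euclidean_subtopology_iff by fastforce
    obtain K :: nat where K: "2 * C / r < real K"
      using reals_Archimedean2 by blast
    have "norm (h k x - f x) < e" if "K \<le> k" for k
    proof -
      have "h k x \<le> f x + e / 2"
        unfolding h_def
      proof (rule cSUP_least[OF ne])
        fix y assume y: "y \<in> ?S"
        show "f y - real k * dist x y \<le> f x + e / 2"
        proof (cases "dist y x < r")
          case True
          then show ?thesis
            using r[OF y] nonneg[of k x y] by linarith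
        next
          case False
          have "2 * C < real K * r" using K \<open>0 < r\<close> by (simp add: field_simps)
          also have "\<dots> \<le> real k * dist x y"
            using False that \<open>0 < r\<close> by (intro mult_mono) (auto simp: dist_commute)
          finally show ?thesis
            using C[OF x] C[OF y] \<open>0 < e\<close> by linarith
        qed
      qed
      then show ?thesis
        using h_ge[OF x, of k] \<open>0 < e\<close> by simp
    qed
    then show "\<exists>no. \<forall>n\<ge>no. norm (h n x - f x) < e" by blast
  qed
  have "(\<lambda>k. LINT x|sphere_measure. h k x) \<longlonglongrightarrow> (LINT x|sphere_measure. f x)"
  proof (rule integral_dominated_convergence[where w="\<lambda>_. C"])
    show "AE x in sphere_measure. norm (h k x) \<le> C" for k
    proof (rule AE_I2)
      fix x assume "x \<in> space (sphere_measure :: (real^'n) measure)"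
      then have "x \<in> ?S" by simp
      then show "norm (h k x) \<le> C"
        using h_ge[of x k] h_le[of k x] C[of x] by simp
    qed
    show "h k \<in> borel_measurable sphere_measure" for k
      using continuous_on_imp_sphere_bounded[OF h_cont] by (simp add: sphere_bounded_def)
  qed (use fb h_lim in \<open>auto simp: sphere_bounded_def intro!: AE_I2\<close>)
  then have "(\<lambda>k. sphere_mean (h k)) \<longlonglongrightarrow> sphere_mean f"
    unfolding sphere_mean_def using sphere_area_pos[where 'n='n] by (intro tendsto_divide) auto
  then have "\<forall>\<^sub>F k in sequentially. sphere_mean (h k) < sphere_mean f + d"
    by (rule order_tendstoD) (use \<open>0 < d\<close> in simp)
  then obtain k where "sphere_mean (h k) < sphere_mean f + d"
    by (metis eventually_happens trivial_limit_sequentially)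
  then show ?thesis
    using h_cont[of k] h_ge by (intro exI[of _ "h k"]) auto
qed

section \<open>Functions of class \<open>C\<^sup>2\<close> and their Hessians\<close>

lemma C2_near_add:
  assumes "C2_near f x A" "C2_near h x B"
  shows "C2_near (\<lambda>x. f x + h x) x (A + B)"
proof -
  obtain V g D where 1: "open V" "x \<in> V" "\<forall>x\<in>V. (f has_derivative (\<lambda>h. g x \<bullet> h)) (at x)"
     "\<forall>x\<in>V. (g has_derivative (\<lambda>h. D x *v h)) (at x)" "continuous_on V D" "D x = A"
    using assms(1) unfolding C2_near_def by blast
  obtain V' g' D' where 2: "open V'" "x \<in> V'" "\<forall>x\<in>V'. (h has_derivative (\<lambda>h. g' x \<bullet> h)) (at x)"
     "\<forall>x\<in>V'. (g' has_derivative (\<lambda>h. D' x *v h)) (at x)" "continuous_on V' D'" "D' x = B"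
    using assms(2) unfolding C2_near_def by blast
  show ?thesis
    unfolding C2_near_def
  proof (intro exI conjI ballI)
    show "open (V \<inter> V')" "x \<in> V \<inter> V'" using 1 2 by auto
    show "((\<lambda>x. f x + h x) has_derivative (\<lambda>v. (g y + g' y) \<bullet> v)) (at y)" if "y \<in> V \<inter> V'" for y
      using 1(3) 2(3) that by (auto simp: inner_add_left intro!: has_derivative_add)
    show "((\<lambda>y. g y + g' y) has_derivative (\<lambda>v. (D y + D' y) *v v)) (at y)" if "y \<in> V \<inter> V'" for y
      using 1(4) 2(4) that by (auto simp: matrix_vector_mult_add_rdistrib intro!: has_derivative_add)
    show "continuous_on (V \<inter> V') (\<lambda>y. D y + D' y)"
      using 1(5) 2(5) by (intro continuous_on_add) (auto elim: continuous_on_subset)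
  qed (use 1 2 in auto)
qed

lemma C2_near_cmult:
  assumes "C2_near f x A"
  shows "C2_near (\<lambda>x. c * f x) x (c *\<^sub>R A)"
proof -
  obtain V g D where 1: "open V" "x \<in> V" "\<forall>x\<in>V. (f has_derivative (\<lambda>h. g x \<bullet> h)) (at x)"
     "\<forall>x\<in>V. (g has_derivative (\<lambda>h. D x *v h)) (at x)" "continuous_on V D" "D x = A"
    using assms(1) unfolding C2_near_def by blast
  show ?thesis
    unfolding C2_near_def
  proof (intro exI conjI ballI)
    show "((\<lambda>x. c * f x) has_derivative (\<lambda>v. (c *\<^sub>R g y) \<bullet> v)) (at y)" if "y \<in> V" for y
      using 1(3) that by (auto intro!: has_derivative_mult_right)
    show "((\<lambda>y. c *\<^sub>R g y) has_derivative (\<lambda>v. (c *\<^sub>R D y) *v v)) (at y)" if "y \<in> V" for y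
      using 1(4) that has_derivative_scaleR_right[of g "\<lambda>v. D y *v v" "at y" c]
      by (auto simp: scaleR_matrix_vector_assoc)
    show "continuous_on V (\<lambda>y. c *\<^sub>R D y)"
      using 1(5) by (intro continuous_intros)
  qed (use 1 in auto)
qed

lemma C2_near_uminus: "C2_near f x A \<Longrightarrow> C2_near (\<lambda>x. - f x) x (- A)"
  using C2_near_cmult[of f x A "-1"] by simp

lemma C2_near_diff: "C2_near f x A \<Longrightarrow> C2_near h x B \<Longrightarrow> C2_near (\<lambda>x. f x - h x) x (A - B)"
  using C2_near_add[of f x A "\<lambda>x. - h x" "- B"] C2_near_uminus[of h x B] by simp

lemma C2_near_const: "C2_near (\<lambda>_. c) x 0"
  unfolding C2_near_def
  by (intro exI[of _ UNIV] exI[of _ "\<lambda>_. 0"]) (auto simp: inner_zero_left[abs_def] matrix_vector_mult_0[abs_def])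

lemma C2_near_compose_affine:
  fixes S :: "real^'n^'n"
  assumes "C2_near f (S *v x + c) A"
  shows "C2_near (\<lambda>y. f (S *v y + c)) x (transpose S ** A ** S)"
proof -
  obtain V g D where 1: "open V" "S *v x + c \<in> V" "\<forall>x\<in>V. (f has_derivative (\<lambda>h. g x \<bullet> h)) (at x)"
     "\<forall>x\<in>V. (g has_derivative (\<lambda>h. D x *v h)) (at x)" "continuous_on V D" "D (S *v x + c) = A"
    using assms(1) unfolding C2_near_def by blast
  have lin: "((\<lambda>y. S *v y + c) has_derivative (\<lambda>v. S *v v)) (at y)" for y
    by (rule has_derivative_add_const) (simp add: bounded_linear_imp_has_derivative)
  have cont: "continuous_on UNIV (\<lambda>y. S *v y + c)"
    by (intro continuous_intros matrix_vector_mult_linear_continuous_on)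
  let ?W = "(\<lambda>y. S *v y + c) -` V"
  show ?thesis
    unfolding C2_near_def
  proof (intro exI conjI ballI)
    show "open ?W" using continuous_open_vimage[OF 1(1), of "\<lambda>y. S *v y + c"] cont
      by (simp add: continuous_on_eq_continuous_at)
    show "((\<lambda>y. f (S *v y + c)) has_derivative (\<lambda>v. (transpose S *v g (S *v y + c)) \<bullet> v)) (at y)" if "y \<in> ?W" for y
      using has_derivative_compose[OF lin, of f "\<lambda>h. g (S *v y + c) \<bullet> h"] 1(3) that
      by (simp add: dot_lmul_matrix transpose_matrix_vector)
    show "((\<lambda>y. transpose S *v g (S *v y + c)) has_derivative (\<lambda>v. (transpose S ** D (S *v y + c) ** S) *v v)) (at y)"
      if "y \<in> ?W" for y
    proof -
      have "((\<lambda>y. g (S *v y + c)) has_derivative (\<lambda>v. D (S *v y + c) *v (S *v v))) (at y)"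
        using has_derivative_compose[OF lin, of g "\<lambda>h. D (S *v y + c) *v h"] 1(4) that by simp
      from bounded_linear.has_derivative[OF matrix_vector_mul_bounded_linear this, of "transpose S"]
      show ?thesis by (simp add: matrix_vector_mul_assoc matrix_mul_assoc)
    qed
    have "continuous_on ?W (\<lambda>y. D (S *v y + c))"
      by (rule continuous_on_compose2[OF 1(5)]) (use cont in \<open>auto intro: continuous_on_subset\<close>)
    then show "continuous_on ?W (\<lambda>y. transpose S ** D (S *v y + c) ** S)"
      unfolding matrix_matrix_mult_def
      by (intro continuous_intros)
  qed (use 1 in auto)
qed

lemma C2_near_quadratic: "C2_near (\<lambda>y. (norm (y - c))\<^sup>2) x (2 *\<^sub>R mat 1)"
  unfolding C2_near_def
proof (intro exI[of _ UNIV] exI[of _ "\<lambda>y. 2 *\<^sub>R (y - c)"] exI[of _ "\<lambda>y. 2 *\<^sub>R mat 1"] conjI ballI)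
  fix y :: "real^'a"
  show "((\<lambda>y. (norm (y - c))\<^sup>2) has_derivative (\<lambda>v. (2 *\<^sub>R (y - c)) \<bullet> v)) (at y)"
    unfolding power2_norm_eq_inner
    by (auto intro!: derivative_eq_intros simp: inner_commute)
  show "((\<lambda>y. 2 *\<^sub>R (y - c)) has_derivative (\<lambda>v. 2 *\<^sub>R mat 1 *v v)) (at y)"
    by (auto intro!: derivative_eq_intros simp: scaleR_matrix_vector_assoc[symmetric])
qed auto

text \<open>The second order necessary condition, by reduction to the line through \<open>x\<close>
  in direction \<open>v\<close>.\<close>

lemma C2_near_local_min:
  assumes "C2_near f x A" and min: "\<forall>\<^sub>F y in nhds x. f x \<le> f y"
  shows "0 \<le> v \<bullet> (A *v v)"
proof (rule ccontr)
  assume neg: "\<not> ?thesis"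
  obtain V g D where 1: "open V" "x \<in> V" "\<forall>x\<in>V. (f has_derivative (\<lambda>h. g x \<bullet> h)) (at x)"
     "\<forall>x\<in>V. (g has_derivative (\<lambda>h. D x *v h)) (at x)" "D x = A"
    using assms(1) unfolding C2_near_def by blast
  obtain W where W: "open W" "x \<in> W" "\<And>y. y \<in> W \<Longrightarrow> f x \<le> f y"
    using min unfolding eventually_nhds by blast
  define p where "p t = x + t *\<^sub>R v" for t :: real
  have "continuous_on UNIV p"
    unfolding p_def by (intro continuous_intros)
  then have "open (p -` (V \<inter> W))"
    using 1(1) W(1) by (intro continuous_open_vimage) (auto simp: continuous_on_eq_continuous_at)
  moreover have "0 \<in> p -` (V \<inter> W)"
    using 1 W by (simp add: p_def)
  ultimately obtain e where "0 < e" and e: "ball 0 e \<subseteq> p -` (V \<inter> W)"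
    using open_contains_ball by blast
  have pVW: "p t \<in> V" "p t \<in> W" if "\<bar>t\<bar> < e" for t
    using e that by (auto simp: subset_iff dist_real_def)
  have dp: "(p has_derivative (\<lambda>s. s *\<^sub>R v)) (at t)" for t
    unfolding p_def by (auto intro!: derivative_eq_intros)
  have df: "((\<lambda>t. f (p t)) has_real_derivative g (p t) \<bullet> v) (at t)" if "\<bar>t\<bar> < e" for t
  proof -
    have "((\<lambda>t. f (p t)) has_derivative (\<lambda>s. g (p t) \<bullet> (s *\<^sub>R v))) (at t)"
      using has_derivative_compose[OF dp, of f "\<lambda>h. g (p t) \<bullet> h" t] 1(3) pVW(1)[OF that] by simp
    then show ?thesis
      unfolding has_field_derivative_def
      by (rule has_derivative_eq_rhs) (auto simp: fun_eq_iff)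
  qed
  have "((\<lambda>t. g (p t)) has_derivative (\<lambda>s. s *\<^sub>R (A *v v))) (at 0)"
    using has_derivative_compose[OF dp, of g "\<lambda>h. D (p 0) *v h" 0] bspec[OF 1(4) 1(2)] 1(5)
    by (simp add: p_def matrix_vector_mult_scaleR)
  from has_derivative_inner_left[OF this, of v]
  have ddf: "((\<lambda>t. g (p t) \<bullet> v) has_real_derivative v \<bullet> (A *v v)) (at 0)"
    unfolding has_field_derivative_def
    by (rule has_derivative_eq_rhs) (auto simp: fun_eq_iff inner_commute)
  have f0: "g (p 0) \<bullet> v = 0"
  proof (rule DERIV_local_min[OF df \<open>0 < e\<close>])
    show "\<forall>y. \<bar>0 - y\<bar> < e \<longrightarrow> f (p 0) \<le> f (p y)"
      using W(3)[OF pVW(2)] by (simp add: p_def)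
  qed (use \<open>0 < e\<close> in simp)
  obtain d where "0 < d" and d: "\<And>h. 0 < h \<Longrightarrow> h < d \<Longrightarrow> g (p h) \<bullet> v < 0"
    using DERIV_neg_dec_right[OF ddf] neg f0 by auto
  define t where "t = min (e/2) (d/2)"
  have t: "0 < t" "t < e" "t < d" using \<open>0 < e\<close> \<open>0 < d\<close> by (auto simp: t_def)
  obtain z where z: "0 < z" "z < t" "f (p t) - f (p 0) = (t - 0) * (g (p z) \<bullet> v)"
    using MVT2[of 0 t "\<lambda>t. f (p t)" "\<lambda>t. g (p t) \<bullet> v"] t df by auto
  have "f (p t) - f (p 0) < 0"
    using z t d[of z] by (simp add: mult_pos_neg)
  moreover have "f (p 0) \<le> f (p t)"
    using W(3)[OF pVW(2)[of t]] t by (simp add: p_def)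
  ultimately show False by simp
qed

section \<open>Harmonic polynomials\<close>

definition partial :: "'n \<Rightarrow> (real^'n \<Rightarrow> real) \<Rightarrow> real^'n \<Rightarrow> real" where
  "partial i f x = frechet_derivative f (at x) (axis i 1)"

text \<open>Homogeneous polynomials of a given degree, generated by multiplication with coordinates.
  The zero polynomial has every degree.\<close>

inductive homogeneous_poly :: "nat \<Rightarrow> (real^'n \<Rightarrow> real) \<Rightarrow> bool" where
  const: "homogeneous_poly 0 (\<lambda>_. c)"
| add: "homogeneous_poly k f \<Longrightarrow> homogeneous_poly k g \<Longrightarrow> homogeneous_poly k (\<lambda>x. f x + g x)"
| coord: "homogeneous_poly k f \<Longrightarrow> homogeneous_poly (Suc k) (\<lambda>x. x $ i * f x)"

lemma partial_eqI: "(f has_derivative f') (at x) \<Longrightarrow> partial i f x = f' (axis i 1)"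
  by (simp add: partial_def frechet_derivative_at[symmetric])

lemma homogeneous_poly_cmult: "homogeneous_poly k f \<Longrightarrow> homogeneous_poly k (\<lambda>x. c * f x)"
proof (induction rule: homogeneous_poly.induct)
  case (add k f g)
  then show ?case using homogeneous_poly.add by (simp add: distrib_left)
next
  case (coord k f i)
  then show ?case using homogeneous_poly.coord[of k "\<lambda>x. c * f x" i] by (simp add: mult.left_commute)
qed (rule homogeneous_poly.const)

lemma homogeneous_poly_zero: "homogeneous_poly k (\<lambda>_. 0)"
proof (induction k)
  case (Suc k)
  then show ?case using homogeneous_poly.coord[of k "\<lambda>_. 0"] by simp
qed (rule homogeneous_poly.const)

lemma homogeneous_poly_sum: "(\<And>i. i \<in> I \<Longrightarrow> homogeneous_poly k (f i)) \<Longrightarrow> homogeneous_poly k (\<lambda>x. \<Sum>i\<in>I. f i x)"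
  by (induction I rule: infinite_finite_induct) (simp_all add: homogeneous_poly_zero homogeneous_poly.add)

lemma homogeneous_poly_differentiable: "homogeneous_poly k f \<Longrightarrow> f differentiable (at x)"
proof (induction rule: homogeneous_poly.induct)
  case (coord k f i)
  have "(\<lambda>x :: real^'a. x $ i) differentiable (at x)"
    by (rule bounded_linear_imp_differentiable) (rule bounded_linear_vec_nth)
  then show ?case using coord.IH by (rule differentiable_mult)
qed auto

lemma homogeneous_poly_has_derivative:
  assumes "homogeneous_poly k f"
  shows "(f has_derivative (\<lambda>v. (\<chi> i. partial i f x) \<bullet> v)) (at x)"
proof -
  let ?f' = "frechet_derivative f (at x)"
  have d: "(f has_derivative ?f') (at x)"
    using homogeneous_poly_differentiable[OF assms] by (simp add: frechet_derivative_works)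
  then have lin: "linear ?f'"
    by (rule has_derivative_linear)
  have "?f' v = (\<chi> i. partial i f x) \<bullet> v" for v
  proof -
    have "?f' v = ?f' (\<Sum>i\<in>UNIV. v $ i *\<^sub>R axis i 1)"
      using basis_expansion[of v] by (simp add: scalar_mult_eq_scaleR)
    also have "\<dots> = (\<Sum>i\<in>UNIV. v $ i * partial i f x)"
      by (simp add: linear_sum[OF lin] linear_scale[OF lin] partial_def)
    finally show ?thesis
      by (simp add: inner_vec_def mult.commute)
  qed
  then have "?f' = (\<lambda>v. (\<chi> i. partial i f x) \<bullet> v)" by auto
  with d show ?thesis by simp
qed

lemma partial_const [simp]: "partial i (\<lambda>_. c) = (\<lambda>_. 0)"
  by (rule ext) (simp add: partial_eqI[OF has_derivative_const])

lemma partial_add: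
  assumes "homogeneous_poly k f" "homogeneous_poly l g"
  shows "partial i (\<lambda>x. f x + g x) = (\<lambda>x. partial i f x + partial i g x)"
proof
  fix x
  show "partial i (\<lambda>x. f x + g x) x = partial i f x + partial i g x"
    using partial_eqI[OF has_derivative_add[OF homogeneous_poly_has_derivative[OF assms(1)] homogeneous_poly_has_derivative[OF assms(2)]], of i x]
    by (simp add: inner_axis)
qed

lemma partial_cmult:
  assumes "homogeneous_poly k f"
  shows "partial i (\<lambda>x. c * f x) = (\<lambda>x. c * partial i f x)"
proof
  fix x
  show "partial i (\<lambda>x. c * f x) x = c * partial i f x"
    using partial_eqI[OF has_derivative_mult_right[OF homogeneous_poly_has_derivative[OF assms], where x = c], of i x]
    by (simp add: inner_axis)
qed

lemma partial_coord:
  assumes "homogeneous_poly k f"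
  shows "partial i (\<lambda>x. x $ l * f x) = (\<lambda>x. (if i = l then f x else 0) + x $ l * partial i f x)"
proof
  fix x :: "real^'a"
  have "((\<lambda>x. x $ l) has_derivative (\<lambda>v. v $ l)) (at x)"
    by (rule bounded_linear_imp_has_derivative) (rule bounded_linear_vec_nth)
  note partial_eqI[OF has_derivative_mult[OF this homogeneous_poly_has_derivative[OF assms]], of i]
  moreover have "axis i 1 $ l = (if i = l then 1 else (0::real))"
    by (simp add: axis_def)
  ultimately show "partial i (\<lambda>x. x $ l * f x) x = (if i = l then f x else 0) + x $ l * partial i f x"
    by (simp add: inner_axis)
qed

text \<open>The subtraction is truncated at degree \<open>0\<close>, where the derivative is zero
  and therefore still homogeneous of degree \<open>0\<close>.\<close>

lemma homogeneous_poly_partial: "homogeneous_poly k f \<Longrightarrow> homogeneous_poly (k - 1) (partial i f)"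
proof (induction rule: homogeneous_poly.induct)
  case (const c)
  then show ?case by (simp add: homogeneous_poly_zero)
next
  case (add k f g)
  then show ?case by (simp add: partial_add[of k f k g] homogeneous_poly.add)
next
  case (coord k f l)
  have "homogeneous_poly k (\<lambda>x. x $ l * partial i f x)"
  proof (cases k)
    case 0
    have "partial i f = (\<lambda>_. 0)" if "homogeneous_poly 0 f" for f :: "real^'a \<Rightarrow> real"
      using that
    proof (induction "0 :: nat" f rule: homogeneous_poly.induct)
      case (add f g)
      then show ?case by (simp add: partial_add[of 0 f 0 g])
    qed simp
    then show ?thesis using coord.hyps 0 by (simp add: homogeneous_poly.const)
  next
    case (Suc k')
    then show ?thesis using homogeneous_poly.coord[OF coord.IH, of l] by simp
  qed
  moreover have "homogeneous_poly k (\<lambda>x. if i = l then f x else 0)"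
    using coord.hyps by (cases "i = l") (simp_all add: homogeneous_poly_zero)
  ultimately show ?case
    by (simp add: partial_coord[OF coord.hyps] homogeneous_poly.add)
qed

lemma partial_commute: "homogeneous_poly k f \<Longrightarrow> partial i (partial j f) = partial j (partial i f)"
proof (induction rule: homogeneous_poly.induct)
  case (add k f g)
  then show ?case
    by (simp add: partial_add[of k f k g] partial_add[OF homogeneous_poly_partial homogeneous_poly_partial, of k f k g])
next
  case (coord k f l)
  have *: "homogeneous_poly k (\<lambda>x. if j = l then f x else 0)" for j
    using coord.hyps by (cases "j = l") (simp_all add: homogeneous_poly_zero)
  have **: "partial i (\<lambda>x. if j = l then f x else 0) = (\<lambda>x. if j = l then partial i f x else 0)" for i j
    by (cases "j = l") simp_all
  have "partial i (partial j (\<lambda>x. x $ l * f x)) = (\<lambda>x. (if j = l then partial i f x else 0) + ((if i = l then partial j f x else 0) + x $ l * partial i (partial j f) x))" for i j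
    using partial_add[OF *[of j] homogeneous_poly.coord[OF homogeneous_poly_partial[OF coord.hyps, of j], of l], of i]
    by (simp add: partial_coord[OF coord.hyps] partial_coord[OF homogeneous_poly_partial[OF coord.hyps]] **)
  then show ?case
    using coord.IH by (simp add: fun_eq_iff)
qed simp

lemma homogeneous_poly_Euler: "homogeneous_poly k f \<Longrightarrow> (\<Sum>i\<in>UNIV. x $ i * partial i f x) = real k * f x"
proof (induction rule: homogeneous_poly.induct)
  case (add k f g)
  then show ?case
    by (simp add: partial_add[of k f k g] distrib_left sum.distrib)
next
  case (coord k f l)
  have "(\<Sum>i\<in>UNIV. x $ i * partial i (\<lambda>x. x $ l * f x) x)
      = (\<Sum>i\<in>UNIV. (if i = l then x $ i * f x else 0) + x $ l * (x $ i * partial i f x))"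
    by (rule sum.cong) (auto simp: partial_coord[OF coord.hyps] distrib_left)
  also have "\<dots> = x $ l * f x + x $ l * (\<Sum>i\<in>UNIV. x $ i * partial i f x)"
    by (simp add: sum.distrib sum_distrib_left)
  finally show ?case
    by (simp add: coord.IH algebra_simps)
qed simp

definition laplacian :: "(real^'n \<Rightarrow> real) \<Rightarrow> real^'n \<Rightarrow> real" where
  "laplacian f x = (\<Sum>i\<in>UNIV. partial i (partial i f) x)"

lemma laplacian_add:
  assumes "homogeneous_poly k f" "homogeneous_poly l g"
  shows "laplacian (\<lambda>x. f x + g x) x = laplacian f x + laplacian g x"
  by (simp add: laplacian_def partial_add[OF assms] partial_add[OF homogeneous_poly_partial[OF assms(1)] homogeneous_poly_partial[OF assms(2)]] sum.distrib)

lemma laplacian_cmult: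
  assumes "homogeneous_poly k f"
  shows "laplacian (\<lambda>x. c * f x) x = c * laplacian f x"
  by (simp add: laplacian_def partial_cmult[OF assms] partial_cmult[OF homogeneous_poly_partial[OF assms]] sum_distrib_left)

lemma laplacian_coord:
  assumes f: "homogeneous_poly k f"
  shows "laplacian (\<lambda>x. x $ l * f x) x = 2 * partial l f x + x $ l * laplacian f x"
proof -
  have *: "homogeneous_poly k (\<lambda>x. if i = l then f x else 0)" for i
    using f by (cases "i = l") (simp_all add: homogeneous_poly_zero)
  have **: "partial i (\<lambda>x. if i = l then f x else 0) = (\<lambda>x. if i = l then partial i f x else 0)" for i
    by (cases "i = l") simp_all
  have "partial i (partial i (\<lambda>x. x $ l * f x)) x = (if i = l then 2 * partial l f x else 0) + x $ l * partial i (partial i f) x" for i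
    using partial_add[OF *[of i] homogeneous_poly.coord[OF homogeneous_poly_partial[OF f, of i], of l], of i]
    by (simp add: partial_coord[OF f] partial_coord[OF homogeneous_poly_partial[OF f]] **)
  then show ?thesis
    by (simp add: laplacian_def sum.distrib sum_distrib_left)
qed

lemma laplacian_partial:
  assumes f: "homogeneous_poly k f" and "\<And>x. laplacian f x = 0"
  shows "laplacian (partial l f) x = 0"
proof -
  have sum_partial: "partial l (\<lambda>x. \<Sum>i\<in>I. partial i (partial i f) x) = (\<lambda>x. \<Sum>i\<in>I. partial l (partial i (partial i f)) x)" for I :: "'a set"
  proof (induction I rule: infinite_finite_induct)
    case (insert i I)
    have "homogeneous_poly (k - 1 - 1) (\<lambda>x. \<Sum>i\<in>I. partial i (partial i f) x)"
      by (intro homogeneous_poly_sum homogeneous_poly_partial f)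
    then show ?case
      using insert partial_add[OF homogeneous_poly_partial[OF homogeneous_poly_partial[OF f]], of "k - 1 - 1" "\<lambda>x. \<Sum>i\<in>I. partial i (partial i f) x" l i i]
      by simp
  qed simp_all
  have "partial i (partial i (partial l f)) = partial l (partial i (partial i f))" for i
    using partial_commute[OF f, of i l] partial_commute[OF homogeneous_poly_partial[OF f], of i l i] by simp
  then have "laplacian (partial l f) x = partial l (\<lambda>x. laplacian f x) x"
    unfolding laplacian_def by (simp add: sum_partial)
  also have "(\<lambda>x. laplacian f x) = (\<lambda>x. 0)"
    using assms(2) by auto
  finally show ?thesis by simp
qed

text \<open>The product \<open>|x|\<^sup>2 f\<close>, written so that it visibly arises from
  \<open>f\<close> by multiplication with coordinates.\<close>

definition normsq_mult :: "(real^'n \<Rightarrow> real) \<Rightarrow> real^'n \<Rightarrow> real" where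
  "normsq_mult f x = (\<Sum>l\<in>UNIV. x $ l * (x $ l * f x))"

lemma normsq_mult_sphere: "x \<in> sphere 0 1 \<Longrightarrow> normsq_mult f x = f x"
proof -
  assume "x \<in> sphere 0 1"
  then have "x \<bullet> x = 1" by (simp add: norm_eq_1)
  moreover have "normsq_mult f x = (x \<bullet> x) * f x"
    by (simp add: normsq_mult_def inner_vec_def sum_distrib_right mult.assoc)
  ultimately show ?thesis by simp
qed

lemma homogeneous_poly_normsq_mult: "homogeneous_poly k f \<Longrightarrow> homogeneous_poly (Suc (Suc k)) (normsq_mult f)"
  unfolding normsq_mult_def[abs_def] by (intro homogeneous_poly_sum homogeneous_poly.coord)

lemma laplacian_normsq_mult:
  fixes f :: "real^'n \<Rightarrow> real"
  assumes f: "homogeneous_poly k f" and h: "\<And>x. laplacian f x = 0"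
  shows "laplacian (normsq_mult f) x = (2 * real CARD('n) + 4 * real k) * f x"
proof -
  have laplacian_sum: "laplacian (\<lambda>x. \<Sum>l\<in>I. x $ l * (x $ l * f x)) x = (\<Sum>l\<in>I. laplacian (\<lambda>x. x $ l * (x $ l * f x)) x)" for I :: "'n set"
  proof (induction I rule: infinite_finite_induct)
    case (insert i I)
    have "homogeneous_poly (Suc (Suc k)) (\<lambda>x. \<Sum>l\<in>I. x $ l * (x $ l * f x))"
      by (intro homogeneous_poly_sum homogeneous_poly.coord f)
    then show ?case
      using insert laplacian_add[OF homogeneous_poly.coord[OF homogeneous_poly.coord[OF f]], of "Suc (Suc k)" "\<lambda>x. \<Sum>l\<in>I. x $ l * (x $ l * f x)" i i x]
      by simp
  qed (simp_all add: laplacian_def)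
  have "laplacian (\<lambda>x. x $ l * (x $ l * f x)) x = 2 * f x + 4 * (x $ l * partial l f x)" for l
    using laplacian_coord[OF homogeneous_poly.coord[OF f, of l], of l x] laplacian_coord[OF f, of l x] h[of x]
    by (simp add: partial_coord[OF f])
  then have "laplacian (normsq_mult f) x = (\<Sum>l\<in>UNIV. 2 * f x + 4 * (x $ l * partial l f x))"
    unfolding normsq_mult_def[abs_def] laplacian_sum by simp
  also have "\<dots> = 2 * real CARD('n) * f x + 4 * (\<Sum>l\<in>UNIV. x $ l * partial l f x)"
    by (simp add: sum.distrib sum_distrib_left)
  finally show ?thesis
    by (simp add: homogeneous_poly_Euler[OF f] algebra_simps)
qed

inductive harmonic_poly :: "(real^'n \<Rightarrow> real) \<Rightarrow> bool" where
  hom: "homogeneous_poly k f \<Longrightarrow> (\<And>x. laplacian f x = 0) \<Longrightarrow> harmonic_poly f"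
| add: "harmonic_poly f \<Longrightarrow> harmonic_poly g \<Longrightarrow> harmonic_poly (\<lambda>x. f x + g x)"

lemma harmonic_poly_cmult: "harmonic_poly f \<Longrightarrow> harmonic_poly (\<lambda>x. c * f x)"
proof (induction rule: harmonic_poly.induct)
  case (hom k f)
  then show ?case by (intro harmonic_poly.hom[OF homogeneous_poly_cmult[OF hom(1)]]) (simp add: laplacian_cmult)
next
  case (add f g)
  then show ?case using harmonic_poly.add by (simp add: distrib_left)
qed

lemma harmonic_poly_const: "harmonic_poly (\<lambda>_. c)"
  by (rule harmonic_poly.hom[OF homogeneous_poly.const]) (simp add: laplacian_def)

text \<open>On the unit sphere, multiplication by a coordinate preserves restrictions of harmonic
  polynomials: \<open>x\<^sub>l f\<close> differs from a harmonic polynomial of degree \<open>k +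
  1\<close> by a multiple of \<open>|x|\<^sup>2 \<partial>\<^sub>l f\<close>, and on the sphere that
  term equals the harmonic polynomial \<open>\<partial>\<^sub>l f\<close>.\<close>

lemma harmonic_poly_coord_sphere:
  fixes f :: "real^'n \<Rightarrow> real"
  assumes n: "CARD('n) \<ge> 2"
  shows "harmonic_poly f \<Longrightarrow> \<exists>q. harmonic_poly q \<and> (\<forall>x\<in>sphere 0 1. q x = x $ l * f x)"
proof (induction rule: harmonic_poly.induct)
  case (hom k f)
  \<comment> \<open>For \<open>k > 0\<close> the polynomial \<open>x\<^sub>l f - |x|\<^sup>2 \<partial>\<^sub>l f / (n + 2 k - 2)\<close> is harmonic, because
    \<open>\<Delta> (x\<^sub>l f) = 2 \<partial>\<^sub>l f\<close> and \<open>\<Delta> (|x|\<^sup>2 \<partial>\<^sub>l f) = (2 n + 4 (k - 1)) \<partial>\<^sub>l f\<close>. For \<open>k = 0\<close> the correction vanishes.\<close>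
  define c where "c = - 1 / (real CARD('n) + 2 * real (k - 1))"
  define g where "g x = x $ l * f x + c * normsq_mult (partial l f) x" for x
  note df = homogeneous_poly_partial[OF hom(1), of l]
  have hN: "homogeneous_poly (Suc (Suc (k - 1))) (\<lambda>x. c * normsq_mult (partial l f) x)"
    by (intro homogeneous_poly_cmult homogeneous_poly_normsq_mult df)
  have laplacian_g: "laplacian g x = 0" for x
  proof -
    have "laplacian g x = 2 * partial l f x + c * ((2 * real CARD('n) + 4 * real (k - 1)) * partial l f x)"
      unfolding g_def[abs_def]
      using laplacian_add[OF homogeneous_poly.coord[OF hom(1), of l] hN] laplacian_cmult[OF homogeneous_poly_normsq_mult[OF df], of c]
        laplacian_normsq_mult[OF df laplacian_partial[OF hom]] laplacian_coord[OF hom(1)] hom(2)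
      by simp
    also have "\<dots> = (2 + c * (2 * real CARD('n) + 4 * real (k - 1))) * partial l f x"
      by (simp add: algebra_simps)
    also have "2 + c * (2 * real CARD('n) + 4 * real (k - 1)) = 0"
      using n by (simp add: c_def divide_simps)
    finally show ?thesis by simp
  qed
  have "harmonic_poly g"
  proof (cases k)
    case 0
    have "partial l f = (\<lambda>_. 0)" if "homogeneous_poly 0 f" for f :: "real^'n \<Rightarrow> real"
      using that
    proof (induction "0 :: nat" f rule: homogeneous_poly.induct)
      case (add f g)
      then show ?case by (simp add: partial_add[of 0 f 0 g])
    qed simp
    then have "g = (\<lambda>x. x $ l * f x)"
      using hom(1) 0 by (simp add: g_def[abs_def] normsq_mult_def)
    then have "homogeneous_poly (Suc k) g"
      using homogeneous_poly.coord[OF hom(1)] by simp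
    then show ?thesis using laplacian_g by (rule harmonic_poly.hom)
  next
    case (Suc k')
    then have "homogeneous_poly (Suc k) g"
      unfolding g_def[abs_def] using hN by (intro homogeneous_poly.add homogeneous_poly.coord hom(1)) simp
    then show ?thesis using laplacian_g by (rule harmonic_poly.hom)
  qed
  moreover have "harmonic_poly (\<lambda>x. - c * partial l f x)"
    by (intro harmonic_poly_cmult harmonic_poly.hom[OF df] laplacian_partial[OF hom])
  ultimately have "harmonic_poly (\<lambda>x. g x + - c * partial l f x)"
    by (rule harmonic_poly.add)
  then show ?case
    by (intro exI[of _ "\<lambda>x. g x + - c * partial l f x"]) (auto simp: g_def normsq_mult_sphere)
next
  case (add f g)
  then obtain p q where "harmonic_poly p" "\<forall>x\<in>sphere 0 1. p x = x $ l * f x"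
    "harmonic_poly q" "\<forall>x\<in>sphere 0 1. q x = x $ l * g x" by blast
  then show ?case
    by (intro exI[of _ "\<lambda>x. p x + q x"]) (auto simp: distrib_left intro: harmonic_poly.add)
qed

lemma harmonic_poly_linear_sphere:
  fixes f :: "real^'n \<Rightarrow> real"
  assumes n: "CARD('n) \<ge> 2" and f: "harmonic_poly f" and L: "bounded_linear L"
  shows "\<exists>q. harmonic_poly q \<and> (\<forall>x\<in>sphere 0 1. q x = L x * f x)"
proof -
  have "\<exists>q. harmonic_poly q \<and> (\<forall>x\<in>sphere 0 1. q x = (\<Sum>l\<in>I. L (axis l 1) * (x $ l * f x)))" if "finite I" for I :: "'n set"
    using that
  proof (induction I)
    case empty
    then show ?case by (intro exI[of _ "\<lambda>_. 0"]) (auto intro: harmonic_poly_const)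
  next
    case (insert l I)
    obtain p where "harmonic_poly p" "\<forall>x\<in>sphere 0 1. p x = x $ l * f x"
      using harmonic_poly_coord_sphere[OF n f] by blast
    moreover obtain q where "harmonic_poly q" "\<forall>x\<in>sphere 0 1. q x = (\<Sum>l\<in>I. L (axis l 1) * (x $ l * f x))"
      using insert.IH by blast
    ultimately show ?case using insert.hyps
      by (intro exI[of _ "\<lambda>x. L (axis l 1) * p x + q x"]) (auto intro: harmonic_poly.add harmonic_poly_cmult)
  qed
  from this[of UNIV] obtain q where q: "harmonic_poly q" "\<forall>x\<in>sphere 0 1. q x = (\<Sum>l\<in>UNIV. L (axis l 1) * (x $ l * f x))"
    by auto
  have Lx: "L x = (\<Sum>l\<in>UNIV. L (axis l 1) * x $ l)" for x
  proof -
    have lin: "linear L" using L by (rule bounded_linear.linear)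
    have "L x = L (\<Sum>i\<in>UNIV. x $ i *\<^sub>R axis i 1)"
      using basis_expansion[of x] by (simp add: scalar_mult_eq_scaleR)
    then show ?thesis
      by (simp add: linear_sum[OF lin] linear_scale[OF lin] mult.commute)
  qed
  have "L x * f x = (\<Sum>l\<in>UNIV. L (axis l 1) * (x $ l * f x))" for x
    using arg_cong[OF Lx[of x], of "\<lambda>t. t * f x"] by (simp add: sum_distrib_right mult.assoc)
  then show ?thesis using q by auto
qed

text \<open>Since multiplication by coordinates is harmless, so is multiplication by any polynomial;
  \<open>f = 1\<close> solves the Dirichlet problem on the ball for polynomial boundary
  values.\<close>

lemma polynomial_eq_harmonic_poly_sphere:
  fixes p :: "real^'n \<Rightarrow> real"
  assumes n: "CARD('n) \<ge> 2"
  shows "real_polynomial_function p \<Longrightarrow> harmonic_poly f \<Longrightarrow> \<exists>q. harmonic_poly q \<and> (\<forall>x\<in>sphere 0 1. q x = p x * f x)"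
proof (induction arbitrary: f rule: real_polynomial_function.induct)
  case (linear L)
  then show ?case by (rule harmonic_poly_linear_sphere[OF n, rotated])
next
  case (const c)
  then show ?case by (intro exI[of _ "\<lambda>x. c * f x"]) (auto intro: harmonic_poly_cmult)
next
  case (add p1 p2)
  from add.IH(1)[OF add.prems] add.IH(2)[OF add.prems]
  obtain q1 q2 where "harmonic_poly q1" "\<forall>x\<in>sphere 0 1. q1 x = p1 x * f x"
    "harmonic_poly q2" "\<forall>x\<in>sphere 0 1. q2 x = p2 x * f x" by blast
  then show ?case
    by (intro exI[of _ "\<lambda>x. q1 x + q2 x"]) (auto simp: distrib_right intro: harmonic_poly.add)
next
  case (mult p1 p2)
  from mult.IH(2)[OF mult.prems] obtain q2 where q2: "harmonic_poly q2" "\<forall>x\<in>sphere 0 1. q2 x = p2 x * f x" by blast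
  from mult.IH(1)[OF q2(1)] obtain q where "harmonic_poly q" "\<forall>x\<in>sphere 0 1. q x = p1 x * q2 x" by blast
  then show ?case using q2(2) by (intro exI[of _ q]) (auto simp: mult.assoc)
qed

definition harmonic_C2 :: "(real^'n \<Rightarrow> real) \<Rightarrow> bool" where
  "harmonic_C2 f \<longleftrightarrow> (\<forall>x. \<exists>H. C2_near f x H \<and> trace H = 0)"

lemma homogeneous_poly_continuous: "homogeneous_poly k f \<Longrightarrow> continuous_on S f"
  by (intro continuous_at_imp_continuous_on) (auto dest: homogeneous_poly_differentiable intro: differentiable_imp_continuous_within)

lemma homogeneous_poly_has_derivative_grad:
  assumes f: "homogeneous_poly k f"
  shows "((\<lambda>x. \<chi> i. partial i f x) has_derivative (\<lambda>v. (\<chi> i j. partial j (partial i f) y) *v v)) (at y)"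
proof (subst has_derivative_componentwise_within, rule ballI)
  fix b :: "real^'a" assume "b \<in> Basis"
  then obtain i where b: "b = axis i 1"
    unfolding Basis_vec_def by auto
  have "(\<lambda>v. ((\<chi> i j. partial j (partial i f) y) *v v) \<bullet> b) = (\<lambda>v. (\<chi> j. partial j (partial i f) y) \<bullet> v)"
    unfolding b inner_axis by (rule ext) (simp add: matrix_vector_mult_def inner_vec_def)
  moreover have "(\<lambda>x. (\<chi> i. partial i f x) \<bullet> b) = partial i f"
    by (rule ext) (simp add: b inner_axis)
  ultimately show "((\<lambda>x. (\<chi> i. partial i f x) \<bullet> b) has_derivative (\<lambda>v. ((\<chi> i j. partial j (partial i f) y) *v v) \<bullet> b)) (at y)"
    using homogeneous_poly_has_derivative[OF homogeneous_poly_partial[OF f, of i], of y] by (simp only:)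
qed

lemma homogeneous_poly_C2_near:
  fixes f :: "real^'n \<Rightarrow> real"
  assumes f: "homogeneous_poly k f"
  shows "C2_near f x (\<chi> i j. partial j (partial i f) x)"
proof -
  have "continuous_on UNIV (\<lambda>x. \<chi> i j. partial j (partial i f) x)"
    by (intro continuous_on_vec_lambda homogeneous_poly_continuous[OF homogeneous_poly_partial[OF homogeneous_poly_partial[OF f]]])
  then show ?thesis
    unfolding C2_near_def
    using homogeneous_poly_has_derivative[OF f] homogeneous_poly_has_derivative_grad[OF f]
    by (intro exI[of _ UNIV] exI[of _ "\<lambda>x. \<chi> i. partial i f x"] exI[of _ "\<lambda>x. \<chi> i j. partial j (partial i f) x"]) simp
qed

lemma harmonic_poly_harmonic_C2: "harmonic_poly f \<Longrightarrow> harmonic_C2 f"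
proof (induction rule: harmonic_poly.induct)
  case (hom k f)
  have "trace (\<chi> i j. partial j (partial i f) x) = 0" for x
    using hom(2)[of x] by (simp add: trace_def laplacian_def)
  then show ?case
    unfolding harmonic_C2_def using homogeneous_poly_C2_near[OF hom(1)] by blast
next
  case (add f g)
  show ?case
    unfolding harmonic_C2_def
  proof
    fix x
    obtain A B where "C2_near f x A" "trace A = 0" "C2_near g x B" "trace B = 0"
      using add.IH unfolding harmonic_C2_def by blast
    then show "\<exists>H. C2_near (\<lambda>x. f x + g x) x H \<and> trace H = 0"
      by (intro exI[of _ "A + B"]) (simp add: C2_near_add trace_add)
  qed
qed

lemma C2_near_isCont:
  assumes "C2_near f x H"
  shows "isCont f x"
proof -
  obtain g where "(f has_derivative (\<lambda>h. g x \<bullet> h)) (at x)"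
    using assms unfolding C2_near_def by blast
  then show ?thesis
    by (rule has_derivative_continuous)
qed

lemma harmonic_C2_continuous:
  assumes "harmonic_C2 f"
  shows "continuous_on S f"
proof (rule continuous_at_imp_continuous_on, rule ballI)
  fix x
  obtain H where "C2_near f x H"
    using assms unfolding harmonic_C2_def by blast
  then show "isCont f x"
    by (rule C2_near_isCont)
qed

text \<open>By the Stone--Weierstrass theorem, the Dirichlet problem on the ball is solvable for a
  dense set of boundary values. This takes the place of the Poisson integral.\<close>

lemma harmonic_approx_on_sphere:
  fixes h :: "real^'n \<Rightarrow> real"
  assumes n: "CARD('n) \<ge> 2" and h: "continuous_on (sphere 0 1) h" and "0 < e"
  shows "\<exists>q. harmonic_C2 q \<and> (\<forall>x\<in>sphere 0 1. \<bar>h x - q x\<bar> < e)"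
proof -
  obtain p where p: "real_polynomial_function p" "\<And>x. x \<in> sphere 0 1 \<Longrightarrow> \<bar>h x - p x\<bar> < e"
    by (rule Stone_Weierstrass_real_polynomial_function[OF compact_sphere h \<open>0 < e\<close>]) blast
  obtain q where "harmonic_poly q" "\<forall>x\<in>sphere 0 1. q x = p x * 1"
    using polynomial_eq_harmonic_poly_sphere[OF n p(1) harmonic_poly_const[of 1]] by blast
  then show ?thesis
    using p(2) by (intro exI[of _ q]) (auto simp: harmonic_poly_harmonic_C2)
qed

section \<open>The mean value inequality for viscosity subsolutions\<close>

lemma inner_matrix_trace: "(A :: real^'n^'n) \<bullet> B = trace (transpose A ** B)"
proof -
  have "A \<bullet> B = (\<Sum>i\<in>UNIV. \<Sum>j\<in>UNIV. A $ i $ j * B $ i $ j)"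
    by (simp add: inner_vec_def)
  also have "\<dots> = (\<Sum>j\<in>UNIV. \<Sum>i\<in>UNIV. A $ i $ j * B $ i $ j)"
    by (rule sum.swap)
  finally show ?thesis
    by (simp add: trace_def matrix_matrix_mult_def transpose_def)
qed

text \<open>The matrix inner product with \<open>T T\<^sup>t\<close> is the Laplacian after the
  linear substitution \<open>T\<close>.\<close>

lemma inner_gram_trace: "(T ** transpose T) \<bullet> (H :: real^'n^'n) = trace (transpose T ** H ** T)"
proof -
  have "(T ** transpose T) \<bullet> H = trace (T ** (transpose T ** H))"
    by (simp add: inner_matrix_trace matrix_transpose_mul transpose_transpose matrix_mul_assoc)
  also have "\<dots> = trace (transpose T ** H ** T)"
    by (subst trace_mul_sym) simp
  finally show ?thesis .
qed

lemma inner_gram_nonneg: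
  fixes H :: "real^'n^'n"
  assumes "\<And>v. 0 \<le> v \<bullet> (H *v v)"
  shows "0 \<le> (T ** transpose T) \<bullet> H"
proof -
  have "(transpose T ** H ** T) $ i $ i = (T *v axis i 1) \<bullet> (H *v (T *v axis i 1))" for i
  proof -
    have "(transpose T ** H ** T) $ i $ i = axis i 1 \<bullet> ((transpose T ** H ** T) *v axis i 1)"
      by (simp add: inner_axis' matrix_vector_mul_component[symmetric] matrix_vector_mult_basis column_def)
    also have "\<dots> = axis i 1 \<bullet> (transpose T *v (H *v (T *v axis i 1)))"
      by (simp add: matrix_vector_mul_assoc matrix_mul_assoc)
    also have "\<dots> = (T *v axis i 1) \<bullet> (H *v (T *v axis i 1))"
      by (metis dot_lmul_matrix transpose_matrix_vector transpose_transpose)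
    finally show ?thesis .
  qed
  then show ?thesis
    using assms by (auto simp: inner_gram_trace trace_def intro!: sum_nonneg)
qed

text \<open>Viscosity subsolutions of the linear equation \<open>trace (B D\<^sup>2 u) =
  0\<close>.\<close>

definition viscosity_sub :: "real^'n^'n \<Rightarrow> (real^'n) set \<Rightarrow> (real^'n \<Rightarrow> real) \<Rightarrow> bool" where
  "viscosity_sub B X u \<longleftrightarrow> (\<forall>x\<in>X. \<forall>\<phi> H. C2_near \<phi> x H \<longrightarrow>
     (\<forall>\<^sub>F y in nhds x. u y \<le> \<phi> y) \<longrightarrow> u x = \<phi> x \<longrightarrow> 0 \<le> B \<bullet> H)"

text \<open>A test function touching \<open>- f\<close> from above differs from \<open>- f\<close>
  by a function with a local minimum, so the Hessians compare.\<close>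

lemma viscosity_sub_uminus_C2:
  assumes "\<And>x. x \<in> X \<Longrightarrow> \<exists>H. C2_near f x H \<and> (T ** transpose T) \<bullet> H \<le> 0"
  shows "viscosity_sub (T ** transpose T) X (\<lambda>x. - f x)"
  unfolding viscosity_sub_def
proof (intro ballI allI impI)
  fix x \<phi> H assume x: "x \<in> X" and \<phi>: "C2_near \<phi> x H"
    and le: "\<forall>\<^sub>F y in nhds x. - f y \<le> \<phi> y" and eq: "- f x = \<phi> x"
  obtain A where A: "C2_near f x A" "(T ** transpose T) \<bullet> A \<le> 0"
    using assms[OF x] by blast
  have "C2_near (\<lambda>y. \<phi> y + f y) x (H + A)"
    by (rule C2_near_add[OF \<phi> A(1)])
  moreover have "\<forall>\<^sub>F y in nhds x. \<phi> x + f x \<le> \<phi> y + f y"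
    using le eq by (auto elim!: eventually_mono)
  ultimately have "\<And>v. 0 \<le> v \<bullet> ((H + A) *v v)"
    by (rule C2_near_local_min)
  then have "0 \<le> (T ** transpose T) \<bullet> (H + A)"
    by (rule inner_gram_nonneg)
  then show "0 \<le> (T ** transpose T) \<bullet> H"
    using A(2) by (simp add: inner_add_right)
qed

lemma viscosity_sub_const: "viscosity_sub (T ** transpose T) X (\<lambda>_. c)"
  using viscosity_sub_uminus_C2[of X "\<lambda>_. - c" T] C2_near_const by fastforce

text \<open>Comparison on the image of the unit ball under \<open>z \<mapsto> x0 + T z\<close>. A
  harmonic function of \<open>z\<close>, transported by \<open>x = x0 + T z\<close> and made strict,
  is a test function that cannot touch \<open>u\<close> from above at an interior point.\<close>

lemma viscosity_sub_le_harmonic: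
  fixes u :: "real^'n \<Rightarrow> real" and T :: "real^'n^'n"
  assumes viscosity_sub: "viscosity_sub (T ** transpose T) X u" and usc: "real_usc X u" and T: "invertible T"
    and X: "\<And>z. z \<in> cball 0 1 \<Longrightarrow> x0 + T *v z \<in> X"
    and q: "harmonic_C2 q" and bd: "\<And>z. z \<in> sphere 0 1 \<Longrightarrow> u (x0 + T *v z) \<le> q z"
    and z: "z \<in> cball 0 1"
  shows "u (x0 + T *v z) \<le> q z"
proof (rule field_le_epsilon)
  fix e :: real assume "0 < e"
  \<comment> \<open>The term \<open>- e |z|\<^sup>2\<close> makes the harmonic comparison function strictly superharmonic; it is
    compensated on the unit sphere by the constant \<open>e\<close>.\<close>
  define p where "p z = q z - e * (norm (z - 0))\<^sup>2 + e" for z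
  define f where "f z = u (x0 + T *v z) - p z" for z
  have cont_T: "continuous_on S (\<lambda>z. x0 + T *v z)" for S
    by (intro continuous_intros matrix_vector_mult_linear_continuous_on)
  have "real_usc (cball 0 1) f"
    unfolding f_def
  proof (rule real_usc_diff_continuous)
    show "real_usc (cball 0 1) (\<lambda>z. u (x0 + T *v z))"
      by (rule real_usc_compose[OF usc cont_T]) (use X in auto)
    show "continuous_on (cball 0 1) p"
      unfolding p_def by (intro continuous_intros harmonic_C2_continuous[OF q])
  qed
  then obtain z1 where z1: "z1 \<in> cball 0 1" "\<And>z. z \<in> cball 0 1 \<Longrightarrow> f z \<le> f z1"
    by (rule real_usc_attains_sup) auto
  have "f z1 \<le> 0"
  proof (rule ccontr)
    assume pos: "\<not> f z1 \<le> 0"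
    have "norm z1 \<noteq> 1"
    proof
      assume "norm z1 = 1"
      then have "f z1 \<le> 0"
        using bd[of z1] by (simp add: f_def p_def)
      then show False using pos by simp
    qed
    then have z1': "z1 \<in> ball 0 1"
      using z1(1) by simp
    obtain S where ST: "S ** T = mat 1" and TS: "T ** S = mat 1"
      using T unfolding invertible_def by blast
    define x1 where "x1 = x0 + T *v z1"
    define \<zeta> where "\<zeta> y = S *v y + (- (S *v x0))" for y
    have \<zeta>: "x0 + T *v \<zeta> y = y" for y
      by (simp add: \<zeta>_def matrix_vector_right_distrib matrix_vector_mult_diff_distrib matrix_vector_mul_assoc TS)
    have \<zeta>x1: "\<zeta> x1 = z1"
      by (simp add: \<zeta>_def x1_def matrix_vector_right_distrib matrix_vector_mul_assoc ST)
    obtain H where H: "C2_near q z1 H" "trace H = 0"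
      using q unfolding harmonic_C2_def by blast
    let ?M = "H - e *\<^sub>R (2 *\<^sub>R mat 1) + 0"
    have "C2_near p z1 ?M"
      unfolding p_def
      by (intro C2_near_add C2_near_diff C2_near_cmult C2_near_quadratic C2_near_const H(1))
    then have "C2_near p (S *v x1 + (- (S *v x0))) ?M"
      using \<zeta>x1 by (simp add: \<zeta>_def)
    then have "C2_near (\<lambda>y. p (\<zeta> y)) x1 (transpose S ** ?M ** S)"
      unfolding \<zeta>_def by (rule C2_near_compose_affine)
    then have C2: "C2_near (\<lambda>y. p (\<zeta> y) + f z1) x1 (transpose S ** ?M ** S + 0)"
      by (intro C2_near_add C2_near_const)
    have cont_\<zeta>: "continuous_on UNIV \<zeta>"
      unfolding \<zeta>_def by (intro continuous_intros matrix_vector_mult_linear_continuous_on)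
    have "open (\<zeta> -` ball 0 1)"
      using cont_\<zeta> by (intro continuous_open_vimage) (auto simp: continuous_on_eq_continuous_at)
    moreover have "x1 \<in> \<zeta> -` ball 0 1"
      using \<zeta>x1 z1' by simp
    ultimately have "\<forall>\<^sub>F y in nhds x1. y \<in> \<zeta> -` ball 0 1"
      by (rule eventually_nhds_in_open)
    then have le: "\<forall>\<^sub>F y in nhds x1. u y \<le> p (\<zeta> y) + f z1"
    proof (rule eventually_mono)
      fix y assume "y \<in> \<zeta> -` ball 0 1"
      then have "f (\<zeta> y) \<le> f z1"
        by (intro z1(2)) auto
      then show "u y \<le> p (\<zeta> y) + f z1"
        by (simp add: f_def \<zeta>)
    qed
    have eq: "u x1 = p (\<zeta> x1) + f z1"
      unfolding \<zeta>x1 by (simp add: f_def x1_def)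
    have "x1 \<in> X"
      using X[OF z1(1)] by (simp add: x1_def)
    then have "0 \<le> (T ** transpose T) \<bullet> (transpose S ** ?M ** S + 0)"
      using viscosity_sub C2 le eq unfolding viscosity_sub_def by blast
    also have "\<dots> = trace (transpose T ** (transpose S ** ?M ** S) ** T)"
      by (simp add: inner_gram_trace)
    also have "transpose T ** (transpose S ** ?M ** S) ** T = transpose (S ** T) ** ?M ** (S ** T)"
      by (simp add: matrix_transpose_mul matrix_mul_assoc)
    also have "trace \<dots> = - 2 * e * real CARD('n)"
      by (simp add: ST transpose_mat trace_sub H(2)) (simp add: trace_def mat_def)
    finally show False
      using \<open>0 < e\<close> by (simp add: mult_le_0_iff zero_le_mult_iff)
  qed
  then have "f z \<le> 0"
    using z1(2)[OF z] by simp
  then have "u (x0 + T *v z) \<le> q z - e * (norm z)\<^sup>2 + e"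
    by (simp add: f_def p_def)
  also have "\<dots> \<le> q z + e"
    using \<open>0 < e\<close> by simp
  finally show "u (x0 + T *v z) \<le> q z + e" .
qed

lemma harmonic_C2_uminus: "harmonic_C2 q \<Longrightarrow> harmonic_C2 (\<lambda>x. - q x)"
  unfolding harmonic_C2_def
proof
  fix x assume "\<forall>x. \<exists>H. C2_near q x H \<and> trace H = 0"
  then obtain H where "C2_near q x H" "trace H = 0" by blast
  then show "\<exists>H. C2_near (\<lambda>x. - q x) x H \<and> trace H = 0"
    by (intro exI[of _ "- H"]) (simp add: C2_near_uminus trace_def sum_negf)
qed

lemma harmonic_C2_group_average:
  assumes q: "harmonic_C2 q" and L: "\<And>g. g \<in> set L \<Longrightarrow> orthogonal_matrix g"
  shows "harmonic_C2 (group_average L q)"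
  unfolding harmonic_C2_def
proof
  fix x
  have "\<exists>H. C2_near (\<lambda>x. \<Sum>g\<leftarrow>L. q (g *v x)) x H \<and> trace H = 0"
    using L
  proof (induction L)
    case Nil
    show ?case using C2_near_const[of 0 x] by (intro exI[of _ 0]) (simp add: trace_def)
  next
    case (Cons g L)
    then obtain A where A: "C2_near (\<lambda>x. \<Sum>g\<leftarrow>L. q (g *v x)) x A" "trace A = 0" by auto
    obtain H where H: "C2_near q (g *v x + 0) H" "trace H = 0"
      using q unfolding harmonic_C2_def by blast
    have "C2_near (\<lambda>x. q (g *v x)) x (transpose g ** H ** g)"
      using C2_near_compose_affine[OF H(1)] by simp
    from C2_near_add[OF this A(1)] have "C2_near (\<lambda>x. \<Sum>g\<leftarrow>g # L. q (g *v x)) x (transpose g ** H ** g + A)"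
      by simp
    moreover have "trace (transpose g ** H ** g) = trace H"
    proof -
      have "g ** transpose g = mat 1"
        using Cons.prems[of g] by (simp add: orthogonal_matrix_def)
      then show ?thesis
        by (subst trace_mul_sym) (simp add: matrix_mul_assoc)
    qed
    ultimately show ?case
      using A(2) H(2) by (intro exI[of _ "transpose g ** H ** g + A"]) (simp add: trace_add)
  qed
  then obtain H where H: "C2_near (\<lambda>x. \<Sum>g\<leftarrow>L. q (g *v x)) x H" "trace H = 0" by blast
  have "C2_near (\<lambda>x. (1 / real (length L)) * (\<Sum>g\<leftarrow>L. q (g *v x))) x ((1 / real (length L)) *\<^sub>R H)"
    by (rule C2_near_cmult[OF H(1)])
  moreover have "trace ((1 / real (length L)) *\<^sub>R H) = 0"
    using H(2) by (simp add: trace_def flip: sum_distrib_left sum_divide_distrib)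
  ultimately show "\<exists>H. C2_near (group_average L q) x H \<and> trace H = 0"
    by (auto simp: group_average_def[abs_def])
qed

text \<open>Averages of \<open>q\<close> over rotations are harmonic with the same value at the
  origin. Some of them are almost bounded by the mean of \<open>q\<close> on the sphere, hence also
  at the origin by the maximum principle.\<close>

lemma harmonic_le_sphere_mean:
  assumes q: "harmonic_C2 (q :: real^'n \<Rightarrow> real)"
  shows "q 0 \<le> sphere_mean q"
proof (rule field_le_epsilon)
  fix d :: real assume "0 < d"
  interpret transitive_isometries "{g :: real^'n^'n. orthogonal_matrix g}"
    by (rule transitive_isometries_orthogonal)
  obtain L where L: "L \<noteq> []" "set L \<subseteq> {g. orthogonal_matrix g}" "\<And>x. x \<in> sphere 0 1 \<Longrightarrow> group_average L q x \<le> sphere_mean q + d"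
    using group_average_le_sphere_mean[OF harmonic_C2_continuous[OF q] \<open>0 < d\<close>] by blast
  have "harmonic_C2 (group_average L q)"
    using L(2) by (intro harmonic_C2_group_average q) auto
  then have h: "harmonic_C2 (\<lambda>x. - group_average L q x)"
    by (rule harmonic_C2_uminus)
  have "- (sphere_mean q + d) \<le> - group_average L q 0"
  proof (rule viscosity_sub_le_harmonic[where T = "mat 1" and X = UNIV, OF viscosity_sub_const _ _ _ h])
    show "real_usc UNIV (\<lambda>_. - (sphere_mean q + d))"
      by (rule real_usc_continuous) (rule continuous_on_const)
    show "invertible (mat 1 :: real^'n^'n)"
      unfolding invertible_def by (intro exI[of _ "mat 1"]) simp
    show "- (sphere_mean q + d) \<le> - group_average L q z"
      if "z \<in> sphere 0 1" for z
      using L(3)[OF that] by simp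
  qed auto
  moreover have "group_average L q 0 = q 0"
    using L(1) by (simp add: group_average_def sum_list_triv)
  ultimately show "q 0 \<le> sphere_mean q + d" by simp
qed

text \<open>The mean value inequality over ellipsoids. In contrast to the viscosity condition it is
  linear in \<open>u\<close>, so it survives sums of subsolutions.\<close>

lemma viscosity_sub_le_sphere_mean:
  fixes u :: "real^'n \<Rightarrow> real" and T :: "real^'n^'n"
  assumes n: "CARD('n) \<ge> 2"
    and viscosity_sub: "viscosity_sub (T ** transpose T) X u" and usc: "real_usc X u" and T: "invertible T"
    and X: "\<And>z. z \<in> cball 0 1 \<Longrightarrow> x0 + T *v z \<in> X"
    and m: "\<And>x. x \<in> X \<Longrightarrow> m \<le> u x"
  shows "u x0 \<le> sphere_mean (\<lambda>z. u (x0 + T *v z))"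
proof (rule field_le_epsilon)
  fix e :: real assume "0 < e"
  have e3: "0 < e / 3" using \<open>0 < e\<close> by simp
  have "real_usc (sphere 0 1) (\<lambda>z. u (x0 + T *v z))"
    by (rule real_usc_compose[OF usc])
      (use X in \<open>auto intro!: continuous_intros matrix_vector_mult_linear_continuous_on\<close>)
  from real_usc_continuous_approx[OF this _ e3, of m]
  obtain h :: "real^'n \<Rightarrow> real" where h: "continuous_on (sphere 0 1) h" "\<And>z. z \<in> sphere 0 1 \<Longrightarrow> u (x0 + T *v z) \<le> h z"
    "sphere_mean h \<le> sphere_mean (\<lambda>z. u (x0 + T *v z)) + e / 3"
    using X m by auto
  obtain q where q: "harmonic_C2 q" "\<And>z. z \<in> sphere 0 1 \<Longrightarrow> \<bar>h z - q z\<bar> < e / 3"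
    using harmonic_approx_on_sphere[OF n h(1) e3] by blast
  define p where "p z = q z + e / 3" for z
  have p: "harmonic_C2 p"
    unfolding harmonic_C2_def
  proof
    fix x
    obtain H where "C2_near q x H" "trace H = 0"
      using q(1) unfolding harmonic_C2_def by blast
    then show "\<exists>H. C2_near p x H \<and> trace H = 0"
      using C2_near_add[OF _ C2_near_const[of "e / 3"], of q x H] unfolding p_def by auto
  qed
  have p_bounds: "h z \<le> p z" "p z \<le> h z + 2 * e / 3" if "z \<in> sphere 0 1" for z
    using q(2)[OF that] unfolding p_def abs_less_iff by linarith+
  have "u (x0 + T *v 0) \<le> p 0"
    by (rule viscosity_sub_le_harmonic[OF viscosity_sub usc T X p]) (use h(2) p_bounds(1) in \<open>auto intro: order_trans\<close>)
  also have "p 0 \<le> sphere_mean p"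
    by (rule harmonic_le_sphere_mean[OF p])
  also have "\<dots> \<le> sphere_mean (\<lambda>z. h z + 2 * e / 3)"
  proof (rule sphere_mean_mono)
    show "sphere_bounded p"
      by (intro continuous_on_imp_sphere_bounded harmonic_C2_continuous p)
    show "sphere_bounded (\<lambda>z. h z + 2 * e / 3)"
      by (intro continuous_on_imp_sphere_bounded continuous_intros h(1))
  qed (rule p_bounds(2))
  also have "\<dots> = sphere_mean h + 2 * e / 3"
    by (subst sphere_mean_add) (auto intro: continuous_on_imp_sphere_bounded h(1))
  also have "\<dots> \<le> sphere_mean (\<lambda>z. u (x0 + T *v z)) + e"
    using h(3) by simp
  finally show "u x0 \<le> sphere_mean (\<lambda>z. u (x0 + T *v z)) + e"
    by simp
qed

section \<open>Symmetric matrices and radial Hessians\<close>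

definition outer :: "real^'n \<Rightarrow> real^'n^'n" where
  "outer x = (\<chi> i j. x $ i * x $ j)"

lemma inner_outer: "A \<bullet> outer x = x \<bullet> (A *v x)"
  by (simp add: outer_def inner_vec_def matrix_vector_mult_def sum_distrib_left ac_simps)

lemma outer_mult_vec: "outer x *v y = (x \<bullet> y) *\<^sub>R x"
  by (simp add: outer_def vec_eq_iff matrix_vector_mult_def inner_vec_def sum_distrib_left ac_simps)

lemma norm_outer: "norm (outer x) = (norm x)\<^sup>2"
proof -
  have "outer x \<bullet> outer x = (x \<bullet> x)\<^sup>2"
    by (simp add: inner_outer outer_mult_vec power2_eq_square)
  then have "(norm (outer x))\<^sup>2 = ((norm x)\<^sup>2)\<^sup>2"
    by (simp only: power2_norm_eq_inner)
  then show ?thesis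
    by (rule power2_eq_imp_eq) auto
qed

lemma abs_quadratic_form_le:
  fixes A :: "real^'n^'n"
  shows "\<bar>x \<bullet> (A *v x)\<bar> \<le> norm A * (norm x)\<^sup>2"
  using Cauchy_Schwarz_ineq2[of A "outer x"] by (simp add: inner_outer norm_outer)

lemma outer_Sym2: "outer x \<in> Sym2"
  by (simp add: Sym2_def outer_def transpose_def mult.commute)

lemma outer_Psd: "outer x \<in> Psd"
  by (auto simp: Psd_def outer_Sym2 outer_mult_vec inner_commute)

lemma outer_scaleR: "outer (c *\<^sub>R x) = c\<^sup>2 *\<^sub>R outer x"
  by (simp add: outer_def vec_eq_iff power2_eq_square ac_simps)

lemma trace_outer: "trace (outer x) = (norm x)\<^sup>2"
  by (simp add: trace_def outer_def power2_norm_eq_inner inner_vec_def)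

lemma outer_conj: "g ** outer x ** transpose g = outer (g *v x)"
proof -
  have "(g ** outer x ** transpose g) $ i $ j = outer (g *v x) $ i $ j" for i j
  proof -
    have "(g ** outer x ** transpose g) $ i $ j = (\<Sum>k\<in>UNIV. (\<Sum>l\<in>UNIV. g $ i $ l * (x $ l * x $ k)) * g $ j $ k)"
      by (simp add: matrix_matrix_mult_def outer_def transpose_def)
    also have "\<dots> = (\<Sum>k\<in>UNIV. (\<Sum>l\<in>UNIV. g $ i $ l * x $ l) * (g $ j $ k * x $ k))"
      by (simp add: sum_distrib_right sum_distrib_left ac_simps)
    also have "\<dots> = outer (g *v x) $ i $ j"
      by (simp add: outer_def matrix_vector_mult_def sum_distrib_left)
    finally show ?thesis .
  qed
  then show ?thesis by (simp add: vec_eq_iff)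
qed

lemma Sym2_add: "A \<in> Sym2 \<Longrightarrow> B \<in> Sym2 \<Longrightarrow> A + B \<in> Sym2"
  by (simp add: Sym2_def transpose_def vec_eq_iff)

lemma Sym2_diff: "A \<in> Sym2 \<Longrightarrow> B \<in> Sym2 \<Longrightarrow> A - B \<in> Sym2"
  by (simp add: Sym2_def transpose_def vec_eq_iff)

lemma Sym2_scaleR: "A \<in> Sym2 \<Longrightarrow> c *\<^sub>R A \<in> Sym2"
  by (simp add: Sym2_def transpose_def vec_eq_iff)

lemma Sym2_mat: "mat c \<in> Sym2"
  by (simp add: Sym2_def transpose_mat)

lemma inner_transpose_mult: "x \<bullet> (transpose A *v y) = (A *v x) \<bullet> (y :: real^'n)"
  by (metis dot_lmul_matrix transpose_matrix_vector transpose_transpose)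

lemma matrix_conj_diff:
  fixes A B C D :: "real^'n^'n"
  shows "C ** (A - t *\<^sub>R B) ** D = C ** A ** D - t *\<^sub>R (C ** B ** D)"
  by (simp add: vec_eq_iff matrix_matrix_mult_def sum_subtractf sum_distrib_left sum_distrib_right algebra_simps)

lemma closed_Sym2: "closed (Sym2 :: (real^'n^'n) set)"
proof -
  have eq: "Sym2 = (\<Inter>i. \<Inter>j. {A :: real^'n^'n. A $ i $ j = A $ j $ i})"
    by (auto simp: Sym2_def transpose_def vec_eq_iff)
  show ?thesis
    unfolding eq by (intro closed_INT ballI closed_Collect_eq continuous_intros)
qed

lemma Sym2_inner_commute: "A \<in> Sym2 \<Longrightarrow> x \<bullet> (A *v y) = y \<bullet> (A *v x)"
proof -
  assume "A \<in> Sym2"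
  then have "transpose A = A" by (simp add: Sym2_def)
  then show ?thesis
    by (metis dot_lmul_matrix inner_commute transpose_matrix_vector)
qed

lemma mat_scaleR: "mat c = c *\<^sub>R (mat 1 :: real^'n^'n)"
  by (simp add: mat_def vec_eq_iff)

lemma mat_mult_vec: "mat c *v x = c *\<^sub>R (x :: real^'n)"
  by (simp add: mat_scaleR[of c] scaleR_matrix_vector_assoc[symmetric])

text \<open>The quadratic form of \<open>E\<close> is bounded below by \<open>- norm E
  |x|\<^sup>2\<close>.\<close>

lemma Psd_near:
  assumes "E \<in> Sym2" "norm E \<le> c"
  shows "E + mat c \<in> Psd"
proof -
  have "0 \<le> x \<bullet> ((E + mat c) *v x)" for x
  proof -
    have "x \<bullet> ((E + mat c) *v x) = x \<bullet> (E *v x) + c * (norm x)\<^sup>2"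
      by (simp add: matrix_vector_mult_add_rdistrib inner_add_right power2_norm_eq_inner mat_mult_vec)
    moreover have "norm E * (norm x)\<^sup>2 \<le> c * (norm x)\<^sup>2"
      using assms(2) by (intro mult_right_mono) auto
    ultimately show ?thesis
      using abs_quadratic_form_le[of x E] by linarith
  qed
  then show ?thesis
    using assms(1) by (simp add: Psd_def Sym2_add Sym2_mat)
qed

text \<open>Completing the square one coordinate at a time, with \<open>J\<close> the set of rows
  that are not yet cleared.\<close>

lemma Psd_sum_outer:
  fixes B :: "real^'n^'n"
  assumes "finite J" "B \<in> Psd" "\<And>i j. i \<notin> J \<Longrightarrow> B $ i $ j = 0"
  shows "\<exists>v. B = (\<Sum>j\<in>J. outer (v j))"
  using assms
proof (induction J arbitrary: B)
  case empty
  then show ?case by (simp add: vec_eq_iff)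
next
  case (insert j J)
  have sym: "B \<in> Sym2" and psd: "\<And>x. 0 \<le> x \<bullet> (B *v x)"
    using insert.prems(1) by (auto simp: Psd_def)
  have Bsym: "B $ i $ k = B $ k $ i" for i k
    using sym by (auto simp: Sym2_def transpose_def vec_eq_iff)
  define d where "d = B $ j $ j"
  define b where "b = B *v axis j 1"
  have b: "b $ i = B $ i $ j" for i
    by (simp add: b_def matrix_vector_mult_basis column_def)
  have bx: "axis j 1 \<bullet> (B *v x) = b \<bullet> x" for x
    using Sym2_inner_commute[OF sym, of "axis j 1" x] by (simp add: b_def inner_commute)
  have shift: "(x + t *\<^sub>R axis j 1) \<bullet> (B *v (x + t *\<^sub>R axis j 1)) = x \<bullet> (B *v x) + 2 * t * (b \<bullet> x) + t\<^sup>2 * d" for x t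
  proof -
    have "x \<bullet> b = b \<bullet> x" "axis j 1 \<bullet> b = d"
      by (simp_all add: inner_commute inner_axis b d_def)
    moreover have Bv: "B *v (x + t *\<^sub>R axis j 1) = B *v x + t *\<^sub>R b"
      unfolding b_def by (simp add: matrix_vector_right_distrib matrix_vector_mult_scaleR)
    ultimately show ?thesis
      unfolding Bv using bx[of x] by (simp add: inner_add_left inner_add_right algebra_simps power2_eq_square)
  qed
  have d0: "0 \<le> d"
    using shift[of 0 1] psd[of "0 + 1 *\<^sub>R axis j 1"] by simp
  show ?case
  proof (cases "d = 0")
    case True
    \<comment> \<open>A zero diagonal entry of a positive semidefinite matrix forces its whole row to vanish.\<close>
    have "b $ i = 0" for i
    proof (rule ccontr)
      assume nz: "b $ i \<noteq> 0"
      define x :: "real^'n" where "x = axis i 1"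
      define t where "t = - (x \<bullet> (B *v x) + 1) / (2 * b $ i)"
      have "b \<bullet> x = b $ i" by (simp add: x_def inner_axis)
      then have "(x + t *\<^sub>R axis j 1) \<bullet> (B *v (x + t *\<^sub>R axis j 1)) = - 1"
        unfolding shift using True nz by (simp add: t_def field_simps)
      then show False
        using psd[of "x + t *\<^sub>R axis j 1"] by simp
    qed
    then have "B $ j $ k = 0" for k
      using b[of k] Bsym[of j k] by simp
    then have "B $ i $ k = 0" if "i \<notin> J" for i k
      using insert.prems(2)[of i k] that by (cases "i = j") auto
    from insert.IH[OF insert.prems(1) this] obtain v where "B = (\<Sum>i\<in>J. outer (v i))" by blast
    moreover have "outer (0 :: real^'n) = 0"
      by (simp add: outer_def vec_eq_iff)
    ultimately show ?thesis
      using insert.hyps by (intro exI[of _ "v(j := 0)"]) (auto intro!: sum.cong)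
  next
    case False
    then have dpos: "0 < d" using d0 by simp
    define B' where "B' = B - (1 / d) *\<^sub>R outer b"
    have "0 \<le> x \<bullet> (B' *v x)" for x
    proof -
      define t where "t = - (b \<bullet> x) / d"
      have "(x + t *\<^sub>R axis j 1) \<bullet> (B *v (x + t *\<^sub>R axis j 1)) = x \<bullet> (B *v x) - (b \<bullet> x)\<^sup>2 / d"
        unfolding shift using dpos by (simp add: t_def field_simps power2_eq_square)
      moreover have "x \<bullet> (B' *v x) = x \<bullet> (B *v x) - (b \<bullet> x)\<^sup>2 / d"
        by (simp add: B'_def matrix_vector_mult_diff_rdistrib scaleR_matrix_vector_assoc[symmetric]
            outer_mult_vec inner_diff_right inner_commute power2_eq_square)
      ultimately show ?thesis
        using psd[of "x + t *\<^sub>R axis j 1"] by simp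
    qed
    then have "B' \<in> Psd"
      unfolding Psd_def B'_def using sym by (auto intro: Sym2_diff Sym2_scaleR outer_Sym2)
    moreover have "B' $ i $ k = 0" if "i \<notin> J" for i k
    proof (cases "i = j")
      case True
      then show ?thesis
        using dpos Bsym[of j k] by (simp add: B'_def outer_def b d_def)
    next
      case False
      then show ?thesis
        using insert.prems(2)[of i] that by (simp add: B'_def outer_def b)
    qed
    ultimately obtain v where v: "B' = (\<Sum>i\<in>J. outer (v i))"
      using insert.IH by blast
    have "(1 / d) *\<^sub>R outer b = outer ((1 / sqrt d) *\<^sub>R b)"
      using dpos by (simp add: outer_scaleR power_divide)
    then have "B = outer ((1 / sqrt d) *\<^sub>R b) + (\<Sum>i\<in>J. outer (v i))"
      using v by (simp add: B'_def algebra_simps)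
    also have "(\<Sum>i\<in>J. outer (v i)) = (\<Sum>i\<in>J. outer ((v(j := (1 / sqrt d) *\<^sub>R b)) i))"
      using insert.hyps by (intro sum.cong) auto
    finally show ?thesis
      using insert.hyps by (intro exI[of _ "v(j := (1 / sqrt d) *\<^sub>R b)"]) simp
  qed
qed

lemma Psd_gram:
  fixes B :: "real^'n^'n"
  assumes "B \<in> Psd"
  shows "\<exists>T :: real^'n^'n. B = T ** transpose T"
proof -
  have "\<exists>v. B = (\<Sum>j\<in>(UNIV :: 'n set). outer (v j))"
    by (rule Psd_sum_outer[OF finite assms]) simp
  then obtain v where v: "B = (\<Sum>j\<in>(UNIV :: 'n set). outer (v j))" by blast
  have "B = (\<chi> i (j :: 'n). v j $ i) ** transpose (\<chi> i j. v j $ i)"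
    by (simp add: v vec_eq_iff matrix_matrix_mult_def transpose_def outer_def)
  then show ?thesis by blast
qed

lemma invertible_gram_factor:
  fixes T :: "real^'n^'n"
  assumes "\<And>x. x \<noteq> 0 \<Longrightarrow> 0 < x \<bullet> ((T ** transpose T) *v x)"
  shows "invertible T"
proof -
  have "inj ((*v) (T ** transpose T))"
  proof (rule injI)
    fix x y assume "(T ** transpose T) *v x = (T ** transpose T) *v y"
    then have "(T ** transpose T) *v (x - y) = 0"
      by (simp add: matrix_vector_mult_diff_distrib)
    then have "\<not> 0 < (x - y) \<bullet> ((T ** transpose T) *v (x - y))"
      by simp
    then show "x = y"
      using assms[of "x - y"] by auto
  qed
  then obtain C where "C ** (T ** transpose T) = mat 1"
    using matrix_left_invertible_injective[of "T ** transpose T"] by blast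
  then have "(T ** transpose T) ** C = mat 1"
    using matrix_left_right_inverse by blast
  then have "T ** (transpose T ** C) = mat 1"
    by (simp add: matrix_mul_assoc)
  then show ?thesis
    using invertible_right_inverse by blast
qed

lemma C2_near_quadratic_form:
  assumes A: "A \<in> Sym2"
  shows "C2_near (\<lambda>x. x \<bullet> (A *v x)) x (2 *\<^sub>R A)"
  unfolding C2_near_def
proof (intro exI[of _ UNIV] exI[of _ "\<lambda>x. 2 *\<^sub>R (A *v x)"] exI[of _ "\<lambda>x. 2 *\<^sub>R A"] conjI ballI)
  fix y
  have lin: "((\<lambda>x. A *v x) has_derivative (\<lambda>v. A *v v)) (at y)"
    by (simp add: bounded_linear_imp_has_derivative)
  have "((\<lambda>x. x \<bullet> (A *v x)) has_derivative (\<lambda>v. y \<bullet> (A *v v) + v \<bullet> (A *v y))) (at y)"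
    using has_derivative_inner[OF has_derivative_ident lin] by simp
  then show "((\<lambda>x. x \<bullet> (A *v x)) has_derivative (\<lambda>v. (2 *\<^sub>R (A *v y)) \<bullet> v)) (at y)"
    using Sym2_inner_commute[OF A, of y] by (simp add: inner_commute)
  show "((\<lambda>x. 2 *\<^sub>R (A *v x)) has_derivative (\<lambda>v. 2 *\<^sub>R A *v v)) (at y)"
    using has_derivative_scaleR_right[OF lin, of 2] by (simp add: scaleR_matrix_vector_assoc)
qed auto

text \<open>Radial functions are written in the variable \<open>s = |x|\<^sup>2 / 2\<close>, whose
  gradient is \<open>x\<close>; this avoids square roots in the Hessian.\<close>

lemma C2_near_radial:
  fixes f f1 f2 :: "real \<Rightarrow> real" and x :: "real^'n"
  assumes f: "\<And>s. 0 < s \<Longrightarrow> (f has_real_derivative f1 s) (at s)"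
    and f1: "\<And>s. 0 < s \<Longrightarrow> (f1 has_real_derivative f2 s) (at s)"
    and f2: "continuous_on {0<..} f2" and "x \<noteq> 0"
  shows "C2_near (\<lambda>x. f ((norm x)\<^sup>2 / 2)) x
    (f1 ((norm x)\<^sup>2 / 2) *\<^sub>R mat 1 + f2 ((norm x)\<^sup>2 / 2) *\<^sub>R outer x)"
proof -
  define q where "q x = (norm x)\<^sup>2 / 2" for x :: "real^'n"
  have dq: "(q has_derivative (\<lambda>v. x \<bullet> v)) (at x)" for x
    unfolding q_def power2_norm_eq_inner
    by (auto intro!: derivative_eq_intros simp: inner_commute)
  have qpos: "0 < q x" if "x \<noteq> 0" for x
    using that by (simp add: q_def)
  have df: "((\<lambda>x. f (q x)) has_derivative (\<lambda>v. (f1 (q y) *\<^sub>R y) \<bullet> v)) (at y)" if "y \<noteq> 0" for y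
    using has_derivative_compose[OF dq, of f "(*) (f1 (q y))" y] f[OF qpos[OF that]]
    by (simp add: has_field_derivative_def)
  have df1: "((\<lambda>x. f1 (q x)) has_derivative (\<lambda>v. f2 (q y) * (y \<bullet> v))) (at y)" if "y \<noteq> 0" for y
    using has_derivative_compose[OF dq, of f1 "(*) (f2 (q y))" y] f1[OF qpos[OF that]]
    by (simp add: has_field_derivative_def)
  have dg: "((\<lambda>x. f1 (q x) *\<^sub>R x) has_derivative (\<lambda>v. (f1 (q y) *\<^sub>R mat 1 + f2 (q y) *\<^sub>R outer y) *v v)) (at y)" if "y \<noteq> 0" for y
    using has_derivative_scaleR[OF df1[OF that] has_derivative_ident]
    by (simp add: matrix_vector_mult_add_rdistrib scaleR_matrix_vector_assoc[symmetric] outer_mult_vec)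
  have cq: "continuous_on S q" for S
    unfolding q_def by (intro continuous_intros) auto
  have cf1: "continuous_on {0<..} f1"
    using f1 by (intro continuous_at_imp_continuous_on) (auto intro: DERIV_isCont)
  have c: "continuous_on (- {0}) (\<lambda>y. f1 (q y))" "continuous_on (- {0}) (\<lambda>y. f2 (q y))"
    using qpos by (auto intro!: continuous_on_compose2[OF cf1 cq] continuous_on_compose2[OF f2 cq])
  have "continuous_on (- {0}) (\<lambda>y. f1 (q y) *\<^sub>R mat 1 + f2 (q y) *\<^sub>R outer y :: real^'n^'n)"
    unfolding outer_def by (intro continuous_intros c)
  note cD = this
  show ?thesis
    unfolding C2_near_def q_def[symmetric]
  proof (intro exI conjI ballI)
    show "open (- {0 :: real^'n})" "x \<in> - {0}"
      using \<open>x \<noteq> 0\<close> by auto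
    show "((\<lambda>x. f (q x)) has_derivative (\<lambda>v. (f1 (q y) *\<^sub>R y) \<bullet> v)) (at y)" if "y \<in> - {0}" for y
      using that by (intro df) simp
    show "((\<lambda>x. f1 (q x) *\<^sub>R x) has_derivative (\<lambda>v. (f1 (q y) *\<^sub>R mat 1 + f2 (q y) *\<^sub>R outer y) *v v)) (at y)"
      if "y \<in> - {0}" for y
      using that by (intro dg) simp
  qed (rule cD, rule refl)
qed

text \<open>Subtracting the form from \<open>(trace A / n) |x|\<^sup>2\<close> leaves a harmonic
  function vanishing at the origin.\<close>

lemma sphere_mean_quadratic_form_le:
  fixes A :: "real^'n^'n"
  assumes "A \<in> Sym2"
  shows "sphere_mean (\<lambda>x. x \<bullet> (A *v x)) \<le> trace A / real CARD('n)"
proof -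
  define c where "c = trace A / real CARD('n)"
  define q where "q x = c * (norm (x - 0))\<^sup>2 - x \<bullet> (A *v x)" for x :: "real^'n"
  have "C2_near q x (c *\<^sub>R (2 *\<^sub>R mat 1) - 2 *\<^sub>R A)" for x
    unfolding q_def by (intro C2_near_diff C2_near_cmult C2_near_quadratic C2_near_quadratic_form assms)
  moreover have "trace (c *\<^sub>R (2 *\<^sub>R mat 1) - 2 *\<^sub>R A) = 0"
    by (simp add: trace_sub) (simp add: trace_def mat_def c_def sum_distrib_left[symmetric])
  ultimately have h: "harmonic_C2 q"
    unfolding harmonic_C2_def by blast
  have c1: "continuous_on S (\<lambda>x. x \<bullet> (A *v x))" for S
    by (intro continuous_intros matrix_vector_mult_linear_continuous_on)
  have "0 \<le> sphere_mean q"
    using harmonic_le_sphere_mean[OF h] by (simp add: q_def)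
  also have "sphere_mean q = sphere_mean (\<lambda>x. c + (- 1) * (x \<bullet> (A *v x)))"
    by (rule sphere_mean_cong) (simp add: q_def)
  also have "\<dots> = c - sphere_mean (\<lambda>x. x \<bullet> (A *v x))"
    by (subst sphere_mean_add) (auto simp: sphere_mean_uminus intro!: continuous_on_imp_sphere_bounded continuous_on_minus c1)
  finally show ?thesis
    by (simp add: c_def)
qed

section \<open>Convex cone subequations invariant under a transitive group\<close>

locale transitive_cone_subequation = transitive_isometries G for G :: "(real^'n^'n) set" +
  fixes F :: "(real^'n^'n) set"
  assumes cone_sub: "cone_subequation F" and convex: "convex F"
    and invariant: "g \<in> G \<Longrightarrow> A \<in> F \<Longrightarrow> g ** A ** transpose g \<in> F"
begin

lemma F_closedin: "closedin (top_of_set Sym2) F" and F_ne: "F \<noteq> {}" and F_proper: "F \<noteq> Sym2"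
  and F_add_Psd: "A \<in> F \<Longrightarrow> P \<in> Psd \<Longrightarrow> A + P \<in> F"
  and F_scale: "0 \<le> t \<Longrightarrow> A \<in> F \<Longrightarrow> t *\<^sub>R A \<in> F"
  using cone_sub unfolding cone_subequation_def subequation_def by auto

lemma F_Sym2: "A \<in> F \<Longrightarrow> A \<in> Sym2"
  using closedin_subset[OF F_closedin] by auto

lemma closed_F: "closed F"
  using closedin_closed_trans[OF F_closedin closed_Sym2] .

lemma zero_F: "0 \<in> F"
  using F_ne F_scale[of 0] by auto

lemma Psd_F: "P \<in> Psd \<Longrightarrow> P \<in> F"
  using F_add_Psd[OF zero_F] by simp

lemma F_add: "A \<in> F \<Longrightarrow> B \<in> F \<Longrightarrow> A + B \<in> F"
proof -
  assume "A \<in> F" "B \<in> F"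
  then have "(1/2) *\<^sub>R A + (1/2) *\<^sub>R B \<in> F"
    using convex by (intro convexD) auto
  from F_scale[OF _ this, of 2] show ?thesis
    by (simp add: scaleR_add_right)
qed

text \<open>Otherwise every symmetric matrix, being a positive semidefinite perturbation of a
  negative multiple of the identity, would belong to \<open>F\<close>.\<close>

lemma neg_mat_notin_F:
  assumes "0 < c" shows "mat (- c) \<notin> F"
proof
  assume neg: "mat (- c) \<in> F"
  have "A \<in> F" if "A \<in> Sym2" for A
  proof -
    have "(norm A / c) *\<^sub>R mat (- c) + (A + mat (norm A)) \<in> F"
      using neg Psd_near[OF that order_refl] assms by (intro F_add_Psd F_scale) auto
    moreover have "(norm A / c) *\<^sub>R mat (- c) + (A + mat (norm A)) = A"
      using assms by (simp add: mat_def vec_eq_iff)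
    ultimately show ?thesis by simp
  qed
  then show False
    using F_Sym2 F_proper by blast
qed

text \<open>By convexity and invariance, averaging quadratic forms over \<open>G\<close> does not
  leave \<open>F\<close>.\<close>

lemma F_group_average_form:
  assumes "set L \<subseteq> G" "A \<in> F"
  shows "\<exists>C\<in>F. \<forall>x. x \<bullet> (C *v x) = group_average L (\<lambda>x. x \<bullet> (A *v x)) x"
proof -
  have "\<exists>C\<in>F. \<forall>x. x \<bullet> (C *v x) = (\<Sum>g\<leftarrow>L. (g *v x) \<bullet> (A *v (g *v x)))"
    using assms(1)
  proof (induction L)
    case Nil
    show ?case using zero_F by (intro bexI[of _ 0]) auto
  next
    case (Cons g L)
    then obtain C where C: "C \<in> F" "\<And>x. x \<bullet> (C *v x) = (\<Sum>g\<leftarrow>L. (g *v x) \<bullet> (A *v (g *v x)))" by auto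
    have "transpose g ** A ** g \<in> F"
      using invariant[OF transpose_closed assms(2), of g] Cons.prems by (simp add: transpose_transpose)
    moreover have "x \<bullet> ((transpose g ** A ** g) *v x) = (g *v x) \<bullet> (A *v (g *v x))" for x
    proof -
      have "x \<bullet> ((transpose g ** A ** g) *v x) = x \<bullet> (transpose g *v (A *v (g *v x)))"
        by (simp add: matrix_vector_mul_assoc matrix_mul_assoc)
      then show ?thesis
        by (simp only: inner_transpose_mult)
    qed
    ultimately show ?case
      using C by (intro bexI[of _ "transpose g ** A ** g + C"])
        (auto simp: matrix_vector_mult_add_rdistrib inner_add_right F_add)
  qed
  then obtain C where C: "C \<in> F" "\<And>x. x \<bullet> (C *v x) = (\<Sum>g\<leftarrow>L. (g *v x) \<bullet> (A *v (g *v x)))" by blast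
  have "(1 / real (length L)) *\<^sub>R C \<in> F"
    using C(1) by (intro F_scale) auto
  moreover have "x \<bullet> (((1 / real (length L)) *\<^sub>R C) *v x) = group_average L (\<lambda>x. x \<bullet> (A *v x)) x" for x
    using C(2)[of x] by (simp add: group_average_def scaleR_matrix_vector_assoc[symmetric])
  ultimately show ?thesis by blast
qed

text \<open>If a member of \<open>F\<close> had negative trace, suitable averages of its form over
  \<open>G\<close> would be negative definite, and \<open>F\<close> would contain a negative
  multiple of the identity. Consequently functions subharmonic for \<open>F\<close> are classically
  subharmonic.\<close>

lemma trace_nonneg: "A \<in> F \<Longrightarrow> 0 \<le> trace A"
proof (rule ccontr)
  assume A: "A \<in> F" and "\<not> 0 \<le> trace A"
  then have neg: "trace A < 0" by simp
  define c where "c = - trace A / (2 * real CARD('n))"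
  have "0 < c" using neg by (simp add: c_def field_simps)
  have "continuous_on (sphere 0 1) (\<lambda>x. x \<bullet> (A *v x))"
    by (intro continuous_intros matrix_vector_mult_linear_continuous_on)
  from group_average_le_sphere_mean[OF this \<open>0 < c\<close>] obtain L where L: "set L \<subseteq> G"
    "\<forall>x\<in>sphere 0 1. group_average L (\<lambda>x. x \<bullet> (A *v x)) x \<le> sphere_mean (\<lambda>x. x \<bullet> (A *v x)) + c" by blast
  obtain C where C: "C \<in> F" "\<And>x. x \<bullet> (C *v x) = group_average L (\<lambda>x. x \<bullet> (A *v x)) x"
    using F_group_average_form[OF L(1) A] by blast
  have unit: "x \<bullet> (C *v x) \<le> - c" if "x \<in> sphere 0 1" for x
    using L(2) that sphere_mean_quadratic_form_le[OF F_Sym2[OF A]] unfolding C(2) by (fastforce simp: c_def)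
  have "0 \<le> x \<bullet> ((mat (- c) - C) *v x)" for x
  proof (cases "x = 0")
    case False
    define e where "e = x /\<^sub>R norm x"
    have e: "e \<in> sphere 0 1" "x = norm x *\<^sub>R e"
      using False by (simp_all add: e_def)
    have "x \<bullet> (C *v x) = (norm x)\<^sup>2 * (e \<bullet> (C *v e))"
      by (subst e(2), subst (2) e(2)) (simp add: matrix_vector_mult_scaleR power2_eq_square)
    also have "\<dots> \<le> (norm x)\<^sup>2 * (- c)"
      using unit[OF e(1)] by (intro mult_left_mono) auto
    finally show ?thesis
      by (simp add: matrix_vector_mult_diff_rdistrib mat_mult_vec inner_diff_right power2_norm_eq_inner mult.commute)
  qed simp
  then have "mat (- c) - C \<in> Psd"
    using F_Sym2[OF C(1)] by (simp add: Psd_def Sym2_diff Sym2_mat)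
  from F_add_Psd[OF C(1) this] have "mat (- c) \<in> F" by simp
  then show False
    using neg_mat_notin_F[OF \<open>0 < c\<close>] by simp
qed

text \<open>Outside \<open>F\<close>, a separating hyperplane can be chosen with a positive definite
  coefficient matrix: it is nonnegative on the positive semidefinite matrices since these lie in
  \<open>F\<close>, and the identity is nonnegative on \<open>F\<close> since traces are.\<close>

lemma separating_gram:
  assumes Z: "Z \<in> Sym2" "Z \<notin> F"
  shows "\<exists>T :: real^'n^'n. invertible T \<and> (\<forall>A\<in>F. 0 \<le> (T ** transpose T) \<bullet> A) \<and> (T ** transpose T) \<bullet> Z < 0"
proof -
  obtain a b where ab: "a \<bullet> Z < b" "\<And>A. A \<in> F \<Longrightarrow> b < a \<bullet> A"
    using separating_hyperplane_closed_point[OF convex closed_F Z(2)] by blast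
  have "b < 0" using ab(2)[OF zero_F] by simp
  have aF: "0 \<le> a \<bullet> A" if "A \<in> F" for A
  proof (rule ccontr)
    assume neg: "\<not> 0 \<le> a \<bullet> A"
    then have "0 \<le> b / (a \<bullet> A)"
      using \<open>b < 0\<close> by (simp add: divide_nonpos_neg)
    from ab(2)[OF F_scale[OF this that]] show False
      using neg by simp
  qed
  have aZ: "a \<bullet> Z < 0" using ab(1) \<open>b < 0\<close> by simp
  define B0 where "B0 = (1/2) *\<^sub>R (a + transpose a)"
  have B0: "B0 \<bullet> A = a \<bullet> A" if "A \<in> Sym2" for A
  proof -
    have "transpose a \<bullet> A = a \<bullet> transpose A"
      unfolding inner_vec_def transpose_def by simp (rule sum.swap)
    then show ?thesis
      using that by (simp add: B0_def inner_add_left Sym2_def)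
  qed
  have B0_sym: "B0 \<in> Sym2"
    by (simp add: B0_def Sym2_def transpose_def vec_eq_iff)
  \<comment> \<open>A small multiple of the identity, which is nonnegative on \<open>F\<close>, makes the functional positive definite
    without destroying the strict inequality at \<open>Z\<close>.\<close>
  define \<epsilon> where "\<epsilon> = - (a \<bullet> Z) / (2 * (\<bar>trace Z\<bar> + 1))"
  have "0 < \<epsilon>" using aZ by (simp add: \<epsilon>_def divide_neg_pos)
  define B where "B = B0 + \<epsilon> *\<^sub>R mat 1"
  have inner_I: "mat 1 \<bullet> A = trace A" for A :: "real^'n^'n"
    by (simp add: inner_matrix_trace transpose_mat)
  have pos: "\<epsilon> * (norm x)\<^sup>2 \<le> x \<bullet> (B *v x)" for x
  proof -
    have "0 \<le> B0 \<bullet> outer x"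
      using aF[OF Psd_F[OF outer_Psd]] B0[OF outer_Sym2] by simp
    then show ?thesis
      by (simp add: B_def inner_outer matrix_vector_mult_add_rdistrib inner_add_right power2_norm_eq_inner
          scaleR_matrix_vector_assoc[symmetric])
  qed
  have "B \<in> Psd"
  proof -
    have "0 \<le> x \<bullet> (B *v x)" for x
      using pos[of x] \<open>0 < \<epsilon>\<close> by (smt (verit) mult_nonneg_nonneg zero_le_power2)
    then show ?thesis
      by (simp add: Psd_def B_def B0_sym Sym2_add Sym2_scaleR Sym2_mat)
  qed
  then obtain T :: "real^'n^'n" where T: "B = T ** transpose T"
    using Psd_gram by blast
  have "invertible T"
  proof (rule invertible_gram_factor)
    fix x :: "real^'n" assume "x \<noteq> 0"
    then have "0 < \<epsilon> * (norm x)\<^sup>2" using \<open>0 < \<epsilon>\<close> by simp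
    then show "0 < x \<bullet> ((T ** transpose T) *v x)"
      using pos[of x] T by simp
  qed
  moreover have "0 \<le> B \<bullet> A" if "A \<in> F" for A
    using aF[OF that] trace_nonneg[OF that] B0[OF F_Sym2[OF that]] \<open>0 < \<epsilon>\<close>
    by (simp add: B_def inner_add_left inner_I)
  moreover have "B \<bullet> Z < 0"
  proof -
    have "B \<bullet> Z = a \<bullet> Z + \<epsilon> * trace Z"
      using B0[OF Z(1)] by (simp add: B_def inner_add_left inner_I)
    also have "\<epsilon> * trace Z \<le> \<epsilon> * (\<bar>trace Z\<bar> + 1)"
      using \<open>0 < \<epsilon>\<close> by (intro mult_left_mono) auto
    also have "\<epsilon> * (\<bar>trace Z\<bar> + 1) = - (a \<bullet> Z) / 2"
      by (simp add: \<epsilon>_def field_simps add_pos_nonneg)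
    finally show ?thesis using aZ by simp
  qed
  ultimately show ?thesis
    unfolding T by blast
qed

lemma interior_F:
  assumes A: "A \<in> Sym2" "A - mat c \<in> F" "0 < c"
  shows "A \<in> (top_of_set Sym2) interior_of F"
proof -
  have "E \<in> F" if E: "E \<in> Sym2" "dist A E < c" for E
  proof -
    have "(E - A) + mat c \<in> Psd"
      using E A(1) by (intro Psd_near) (auto simp: Sym2_diff dist_norm norm_minus_commute)
    from F_add_Psd[OF A(2) this] show ?thesis by simp
  qed
  then have "Sym2 \<inter> ball A c \<subseteq> F" by auto
  moreover have "openin (top_of_set Sym2) (Sym2 \<inter> ball A c)"
    by (intro openin_open_Int open_ball)
  ultimately show ?thesis
    using A(1,3) unfolding interior_of_def by (auto intro!: exI[of _ "Sym2 \<inter> ball A c"])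
qed

text \<open>The set of \<open>\<tau>\<close> with \<open>mat 1 - \<tau> *\<^sub>R outer e \<in>
  F\<close> does not depend on \<open>e\<close> by transitivity. It is closed downwards by
  positivity, contains \<open>1\<close>, and is bounded by the dimension because traces on
  \<open>F\<close> are nonnegative.\<close>

lemma ex_riesz_char:
  "\<exists>p. 1 \<le> p \<and> p \<le> real CARD('n) \<and> (\<forall>e\<in>sphere 0 1.
     (\<forall>\<tau>\<le>p. mat 1 - \<tau> *\<^sub>R outer e \<in> F) \<and> (\<forall>\<tau>>p. mat 1 - \<tau> *\<^sub>R outer e \<notin> F))"
proof -
  define T where "T = {\<tau>. \<forall>e\<in>sphere 0 1. mat 1 - \<tau> *\<^sub>R outer e \<in> F}"
  have ne: "sphere 0 1 \<noteq> ({} :: (real^'n) set)"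
    using vector_choose_size[of 1] by auto
  have all: "\<tau> \<in> T" if "e \<in> sphere 0 1" "mat 1 - \<tau> *\<^sub>R outer e \<in> F" for \<tau> e
    unfolding T_def
  proof (intro CollectI ballI)
    fix e' :: "real^'n" assume "e' \<in> sphere 0 1"
    from transitive[OF that(1) this] obtain g where g: "g \<in> G" "g *v e = e'"
      by blast
    have "g ** (mat 1 - \<tau> *\<^sub>R outer e) ** transpose g = g ** transpose g - \<tau> *\<^sub>R (g ** outer e ** transpose g)"
      by (simp add: matrix_conj_diff)
    also have "\<dots> = mat 1 - \<tau> *\<^sub>R outer e'"
      using orthogonal[OF g(1)] g(2) by (simp add: orthogonal_matrix_def outer_conj)
    finally show "mat 1 - \<tau> *\<^sub>R outer e' \<in> F"
      using invariant[OF g(1) that(2)] by simp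
  qed
  have down: "\<tau> \<in> T" if "\<tau>' \<in> T" "\<tau> \<le> \<tau>'" for \<tau> \<tau>'
    unfolding T_def
  proof (intro CollectI ballI)
    fix e :: "real^'n" assume "e \<in> sphere 0 1"
    then have "mat 1 - \<tau>' *\<^sub>R outer e \<in> F"
      using that(1) by (simp add: T_def)
    then have "(mat 1 - \<tau>' *\<^sub>R outer e) + (\<tau>' - \<tau>) *\<^sub>R outer e \<in> F"
      by (rule F_add[OF _ F_scale[OF _ Psd_F[OF outer_Psd]]]) (use that(2) in simp)
    then show "mat 1 - \<tau> *\<^sub>R outer e \<in> F"
      by (simp add: algebra_simps)
  qed
  have one: "1 \<in> T"
    unfolding T_def
  proof (intro CollectI ballI Psd_F)
    fix e :: "real^'n" assume e: "e \<in> sphere 0 1"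
    have "0 \<le> x \<bullet> ((mat 1 - 1 *\<^sub>R outer e) *v x)" for x
    proof -
      have "(e \<bullet> x)\<^sup>2 \<le> (e \<bullet> e) * (x \<bullet> x)"
        by (rule Cauchy_Schwarz_ineq)
      moreover have "e \<bullet> e = 1"
        using e by (simp add: norm_eq_1)
      ultimately show ?thesis
        by (simp add: matrix_vector_mult_diff_rdistrib outer_mult_vec inner_diff_right power2_eq_square inner_commute)
    qed
    then show "mat 1 - 1 *\<^sub>R outer e \<in> Psd"
      unfolding Psd_def by (auto intro: Sym2_diff Sym2_scaleR Sym2_mat outer_Sym2)
  qed
  have bdd: "\<tau> \<le> real CARD('n)" if "\<tau> \<in> T" for \<tau>
  proof -
    obtain e :: "real^'n" where e: "e \<in> sphere 0 1" using ne by blast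
    then have "0 \<le> trace (mat 1 - \<tau> *\<^sub>R outer e)"
      using that by (intro trace_nonneg) (simp add: T_def)
    also have "\<dots> = real CARD('n) - \<tau> * trace (outer e)"
      by (simp add: trace_sub trace_I) (simp add: trace_def sum_distrib_left)
    finally show ?thesis
      using e by (simp add: trace_outer)
  qed
  have "closed T"
  proof -
    have "T = (\<Inter>e\<in>sphere 0 1. (\<lambda>\<tau>. mat 1 - \<tau> *\<^sub>R outer e) -` F)"
      by (auto simp: T_def)
    moreover have "closed ((\<lambda>\<tau>. mat 1 - \<tau> *\<^sub>R outer e) -` F)" for e
      by (intro closed_vimage closed_F continuous_intros)
    ultimately show ?thesis by auto
  qed
  moreover have bddT: "bdd_above T" using bdd by (rule bdd_aboveI)
  ultimately have Sup: "Sup T \<in> T"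
    using one by (intro closed_contains_Sup) auto
  have "mat 1 - \<tau> *\<^sub>R outer e \<notin> F" if "e \<in> sphere 0 1" "Sup T < \<tau>" for e \<tau>
    using all[OF that(1)] cSup_upper[OF _ bddT, of \<tau>] that(2) by auto
  moreover have "mat 1 - \<tau> *\<^sub>R outer e \<in> F" if "e \<in> sphere 0 1" "\<tau> \<le> Sup T" for e \<tau>
    using down[OF Sup that(2)] that(1) by (simp add: T_def)
  ultimately show ?thesis
    using cSup_upper[OF one bddT] bdd[OF Sup] by blast
qed

text \<open>The Riesz characteristic of \<open>F\<close>. It determines which Hessians of increasing
  radial functions lie in \<open>F\<close>.\<close>

definition riesz_char :: real where
  "riesz_char = (SOME p. 1 \<le> p \<and> p \<le> real CARD('n) \<and> (\<forall>e\<in>sphere 0 1.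
     (\<forall>\<tau>\<le>p. mat 1 - \<tau> *\<^sub>R outer e \<in> F) \<and> (\<forall>\<tau>>p. mat 1 - \<tau> *\<^sub>R outer e \<notin> F)))"

lemma riesz_char_ge_1: "1 \<le> riesz_char" and riesz_char_le: "riesz_char \<le> real CARD('n)"
  and riesz_char_in: "e \<in> sphere 0 1 \<Longrightarrow> \<tau> \<le> riesz_char \<Longrightarrow> mat 1 - \<tau> *\<^sub>R outer e \<in> F"
  and riesz_char_notin: "e \<in> sphere 0 1 \<Longrightarrow> riesz_char < \<tau> \<Longrightarrow> mat 1 - \<tau> *\<^sub>R outer e \<notin> F"
  using someI_ex[OF ex_riesz_char] unfolding riesz_char_def by blast+

text \<open>The eigenvalue in the radial direction is \<open>1 - \<tau>\<close> times the tangential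
  one, with \<open>\<tau> = - c2 |x|\<^sup>2 / c1\<close>.\<close>

lemma radial_hessian:
  assumes "x \<noteq> 0" "0 < c1"
  shows "\<exists>e\<in>sphere 0 1. c1 *\<^sub>R mat 1 + c2 *\<^sub>R outer x = c1 *\<^sub>R (mat 1 - (- c2 * (norm x)\<^sup>2 / c1) *\<^sub>R outer (e :: real^'n))"
proof (rule bexI[of _ "x /\<^sub>R norm x"])
  have "x = norm x *\<^sub>R (x /\<^sub>R norm x)" using assms by simp
  then have "outer x = (norm x)\<^sup>2 *\<^sub>R outer (x /\<^sub>R norm x)"
    by (metis outer_scaleR)
  then show "c1 *\<^sub>R mat 1 + c2 *\<^sub>R outer x = c1 *\<^sub>R (mat 1 - (- c2 * (norm x)\<^sup>2 / c1) *\<^sub>R outer (x /\<^sub>R norm x))"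
    using assms(2) by (simp add: algebra_simps)
qed (use assms in auto)

lemma radial_hessian_in:
  assumes "x \<noteq> 0" "0 < c1" "0 \<le> c1 * riesz_char + c2 * (norm x)\<^sup>2"
  shows "c1 *\<^sub>R mat 1 + c2 *\<^sub>R outer x \<in> F"
proof -
  obtain e where e: "e \<in> sphere 0 1"
    "c1 *\<^sub>R mat 1 + c2 *\<^sub>R outer x = c1 *\<^sub>R (mat 1 - (- c2 * (norm x)\<^sup>2 / c1) *\<^sub>R outer e)"
    using radial_hessian[OF assms(1,2)] by blast
  have "- c2 * (norm x)\<^sup>2 / c1 \<le> riesz_char"
    using assms(2,3) by (simp add: field_simps)
  then show ?thesis
    unfolding e(2) using assms(2) by (intro F_scale riesz_char_in e(1)) auto
qed

lemma radial_hessian_notin: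
  assumes "x \<noteq> 0" "0 < c1" "c1 * riesz_char + c2 * (norm x)\<^sup>2 < 0"
  shows "c1 *\<^sub>R mat 1 + c2 *\<^sub>R outer x \<notin> F"
proof
  assume inF: "c1 *\<^sub>R mat 1 + c2 *\<^sub>R outer x \<in> F"
  obtain e where e: "e \<in> sphere 0 1"
    "c1 *\<^sub>R mat 1 + c2 *\<^sub>R outer x = c1 *\<^sub>R (mat 1 - (- c2 * (norm x)\<^sup>2 / c1) *\<^sub>R outer e)"
    using radial_hessian[OF assms(1,2)] by blast
  from F_scale[OF _ inF, of "1 / c1"] have "mat 1 - (- c2 * (norm x)\<^sup>2 / c1) *\<^sub>R outer e \<in> F"
    unfolding e(2) using assms(2) by simp
  moreover have "riesz_char < - c2 * (norm x)\<^sup>2 / c1"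
    using assms(2,3) by (simp add: field_simps)
  ultimately show False
    using riesz_char_notin[OF e(1)] by blast
qed

text \<open>Subtracting a small multiple of the identity changes \<open>\<tau>\<close> only a
  little, so strict inequality gives an interior point.\<close>

lemma radial_hessian_interior:
  assumes "x \<noteq> 0" "0 < c1" "0 < c1 * riesz_char + c2 * (norm x)\<^sup>2"
  shows "c1 *\<^sub>R mat 1 + c2 *\<^sub>R outer x \<in> (top_of_set Sym2) interior_of F"
proof -
  define m where "m = min (c1 / 2) ((c1 * riesz_char + c2 * (norm x)\<^sup>2) / riesz_char)"
  have r: "0 < riesz_char" using riesz_char_ge_1 by simp
  have m: "0 < m" "m < c1" "m * riesz_char \<le> c1 * riesz_char + c2 * (norm x)\<^sup>2"
  proof -
    show "0 < m" "m < c1" using assms(2,3) r by (auto simp: m_def)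
    have "m \<le> (c1 * riesz_char + c2 * (norm x)\<^sup>2) / riesz_char" by (simp add: m_def)
    then show "m * riesz_char \<le> c1 * riesz_char + c2 * (norm x)\<^sup>2"
      using r by (simp add: field_simps)
  qed
  have "(c1 - m) *\<^sub>R mat 1 + c2 *\<^sub>R outer x \<in> F"
    by (rule radial_hessian_in[OF assms(1)]) (use m in \<open>auto simp: algebra_simps\<close>)
  moreover have "(c1 - m) *\<^sub>R mat 1 + c2 *\<^sub>R outer x = c1 *\<^sub>R mat 1 + c2 *\<^sub>R outer x - mat m"
    by (simp add: mat_scaleR[of m] algebra_simps)
  ultimately show ?thesis
    using m(1) by (intro interior_F[of _ m] Sym2_add Sym2_scaleR Sym2_mat outer_Sym2) auto
qed

end

section \<open>Null sets and spheres\<close>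

lemma AE_lborel_affine_iff:
  fixes c :: real and t :: "'a::euclidean_space"
  assumes "c \<noteq> 0" and P: "Measurable.pred borel P"
  shows "(AE x in lborel. P (t + c *\<^sub>R x)) \<longleftrightarrow> (AE x in lborel. P x)"
proof -
  have "(AE x in lborel. P x) \<longleftrightarrow> (AE x in density (distr lborel borel (\<lambda>x. t + c *\<^sub>R x)) (\<lambda>_. \<bar>c\<bar>^DIM('a)). P x)"
    by (subst lborel_affine[OF assms(1), of t]) simp
  also have "\<dots> \<longleftrightarrow> (AE x in distr lborel borel (\<lambda>x. t + c *\<^sub>R x). P x)"
    using assms(1) by (subst AE_density) auto
  also have "\<dots> \<longleftrightarrow> (AE x in lborel. P (t + c *\<^sub>R x))"
    using P by (subst AE_distr_iff) auto
  finally show ?thesis by simp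
qed

lemma sphere_null_iff:
  fixes D :: "(real^'n) set"
  assumes D: "D \<in> sets borel"
  shows "emeasure sphere_measure {\<sigma>\<in>sphere 0 1. t *\<^sub>R \<sigma> \<in> D} = 0 \<longleftrightarrow>
    (AE x in lborel. \<not> (x \<in> cball 0 1 - {0} \<and> t *\<^sub>R sgn x \<in> D))"
proof -
  have "(\<lambda>\<sigma>. t *\<^sub>R \<sigma>) -` D \<inter> space borel \<in> sets borel"
    by (rule measurable_sets[OF _ D]) measurable
  then have E: "{\<sigma>\<in>sphere 0 1. t *\<^sub>R \<sigma> \<in> D} \<in> sets borel"
    by (auto simp: vimage_def Collect_conj_eq intro!: sets.Int)
  have eq: "{x \<in> cball 0 1 - {0}. sgn x \<in> {\<sigma>\<in>sphere 0 1. t *\<^sub>R \<sigma> \<in> D}} = {x \<in> cball 0 1 - {0}. t *\<^sub>R sgn x \<in> D}"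
    by (auto simp: norm_sgn)
  have "(\<lambda>x. t *\<^sub>R sgn x) -` D \<inter> space borel \<in> sets borel"
    by (rule measurable_sets[OF _ D]) (intro borel_measurable_scaleR borel_measurable_const sgn_borel_measurable)
  then have m: "{x \<in> cball 0 1 - {0}. t *\<^sub>R sgn x \<in> D} \<in> sets borel"
    by (auto simp: vimage_def Collect_conj_eq set_diff_eq intro!: sets.Int)
  have "emeasure sphere_measure {\<sigma>\<in>sphere 0 1. t *\<^sub>R \<sigma> \<in> D} =
      of_nat CARD('n) * emeasure lborel {x \<in> cball 0 1 - {0}. t *\<^sub>R sgn x \<in> D}"
    using emeasure_sphere_measure[OF E] unfolding eq by (simp add: subset_iff)
  then have "emeasure sphere_measure {\<sigma>\<in>sphere 0 1. t *\<^sub>R \<sigma> \<in> D} = 0 \<longleftrightarrow>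
      emeasure lborel {x \<in> cball 0 1 - {0}. t *\<^sub>R sgn x \<in> D} = 0"
    by simp
  also have "\<dots> \<longleftrightarrow> {x \<in> cball 0 1 - {0}. t *\<^sub>R sgn x \<in> D} \<in> null_sets lborel"
    using m by (simp add: null_sets_def)
  also have "\<dots> \<longleftrightarrow> (AE x in lborel. x \<notin> {x \<in> cball 0 1 - {0}. t *\<^sub>R sgn x \<in> D})"
    by (rule AE_iff_null_sets) (use m in simp)
  finally show ?thesis by simp
qed

text \<open>By Fubini, both sides say that the rays through almost all points of the punctured ball
  meet \<open>D\<close> in null sets; along a ray the two parametrisations differ by the scaling
  \<open>t = |x| s\<close>.\<close>

lemma spheres_null_iff_dilates_null:
  fixes D :: "(real^'n) set"
  assumes D: "D \<in> sets borel"
  shows "(AE t in lborel. 0 < t \<longrightarrow> emeasure sphere_measure {\<sigma>\<in>sphere 0 1. t *\<^sub>R \<sigma> \<in> D} = 0) \<longleftrightarrow>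
    (AE s in lborel. AE x in lborel. \<not> (0 < s \<and> x \<in> cball 0 1 - {0} \<and> s *\<^sub>R x \<in> D))"
proof -
  let ?C = "cball 0 1 - {0 :: real^'n}"
  have meas: "{z \<in> space (lborel \<Otimes>\<^sub>M lborel). \<not> (0 < fst z \<and> snd z \<in> ?C \<and> fst z *\<^sub>R h (snd z) \<in> D)}
      \<in> sets (lborel \<Otimes>\<^sub>M lborel)" if h: "h \<in> borel_measurable borel" for h :: "real^'n \<Rightarrow> real^'n"
  proof -
    have h': "(\<lambda>z. h (snd z)) \<in> lborel \<Otimes>\<^sub>M lborel \<rightarrow>\<^sub>M borel"
      by (rule measurable_compose[OF measurable_snd]) (use h in simp)
    have "(\<lambda>z. fst z *\<^sub>R h (snd z)) \<in> lborel \<Otimes>\<^sub>M lborel \<rightarrow>\<^sub>M borel"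
      by (intro borel_measurable_scaleR h') measurable
    from measurable_sets[OF this D]
    have 1: "{z \<in> space (lborel \<Otimes>\<^sub>M lborel). fst z *\<^sub>R h (snd z) \<in> D} \<in> sets (lborel \<Otimes>\<^sub>M lborel)"
      by (simp add: vimage_def Int_def conj_commute)
    have "(\<lambda>z. snd z :: real^'n) \<in> (lborel :: real measure) \<Otimes>\<^sub>M (lborel :: (real^'n) measure) \<rightarrow>\<^sub>M borel" by measurable
    from measurable_sets[OF this, of ?C]
    have 2: "{z \<in> space ((lborel :: real measure) \<Otimes>\<^sub>M lborel). snd z \<in> ?C} \<in> sets ((lborel :: real measure) \<Otimes>\<^sub>M lborel)"
      by (simp add: vimage_def Int_def conj_commute)
    have "(\<lambda>z. fst z :: real) \<in> lborel \<Otimes>\<^sub>M (lborel :: (real^'n) measure) \<rightarrow>\<^sub>M borel" by measurable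
    from measurable_sets[OF this, of "{0<..}"]
    have 3: "{z \<in> space ((lborel :: real measure) \<Otimes>\<^sub>M (lborel :: (real^'n) measure)). 0 < fst z} \<in> sets ((lborel :: real measure) \<Otimes>\<^sub>M (lborel :: (real^'n) measure))"
      by (simp add: vimage_def space_pair_measure)
    show ?thesis
      using 1 2 3 by (intro sets.sets_Collect_neg sets.sets_Collect_conj)
  qed
  have "(AE t in lborel. 0 < t \<longrightarrow> emeasure sphere_measure {\<sigma>\<in>sphere 0 1. t *\<^sub>R \<sigma> \<in> D} = 0) \<longleftrightarrow>
      (AE t in lborel. AE x in lborel. \<not> (0 < t \<and> x \<in> ?C \<and> t *\<^sub>R sgn x \<in> D))"
  proof (rule AE_cong)
    fix t :: real
    show "(0 < t \<longrightarrow> emeasure sphere_measure {\<sigma>\<in>sphere 0 1. t *\<^sub>R \<sigma> \<in> D} = 0) \<longleftrightarrow>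
      (AE x in lborel. \<not> (0 < t \<and> x \<in> ?C \<and> t *\<^sub>R sgn x \<in> D))"
      using sphere_null_iff[OF D, of t] by (cases "0 < t") simp_all
  qed
  also have "\<dots> \<longleftrightarrow> (AE x in lborel. AE t in lborel. \<not> (0 < t \<and> x \<in> ?C \<and> t *\<^sub>R sgn x \<in> D))"
    by (rule lborel_pair.AE_commute[where P = "\<lambda>t x. \<not> (0 < t \<and> x \<in> ?C \<and> t *\<^sub>R sgn x \<in> D)",
          OF meas[OF sgn_borel_measurable]])
  also have "\<dots> \<longleftrightarrow> (AE x in lborel. AE s in lborel. \<not> (0 < s \<and> x \<in> ?C \<and> s *\<^sub>R x \<in> D))"
  proof (rule AE_cong)
    fix x :: "real^'n"
    show "(AE t in lborel. \<not> (0 < t \<and> x \<in> ?C \<and> t *\<^sub>R sgn x \<in> D)) \<longleftrightarrow> (AE s in lborel. \<not> (0 < s \<and> x \<in> ?C \<and> s *\<^sub>R x \<in> D))"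
    proof (cases "x = 0")
      case False
      have p: "Measurable.pred borel (\<lambda>t :: real. \<not> (0 < t \<and> x \<in> ?C \<and> t *\<^sub>R sgn x \<in> D))"
      proof -
        have "(\<lambda>t :: real. t *\<^sub>R sgn x) \<in> borel_measurable borel" by measurable
        from measurable_sets[OF this D] have "Measurable.pred borel (\<lambda>t :: real. t *\<^sub>R sgn x \<in> D)"
          by (simp add: pred_def vimage_def)
        then show ?thesis by measurable
      qed
      have "(AE s in lborel. \<not> (0 < s \<and> x \<in> ?C \<and> s *\<^sub>R x \<in> D)) \<longleftrightarrow>
          (AE s in lborel. \<not> (0 < 0 + norm x *\<^sub>R s \<and> x \<in> ?C \<and> (0 + norm x *\<^sub>R s) *\<^sub>R sgn x \<in> D))"
      proof (rule AE_cong)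
        fix s :: real
        have "(0 + norm x *\<^sub>R s) *\<^sub>R sgn x = s *\<^sub>R x" "0 < 0 + norm x *\<^sub>R s \<longleftrightarrow> 0 < s"
          using False by (simp_all add: sgn_div_norm zero_less_mult_iff)
        then show "\<not> (0 < s \<and> x \<in> ?C \<and> s *\<^sub>R x \<in> D) \<longleftrightarrow>
          \<not> (0 < 0 + norm x *\<^sub>R s \<and> x \<in> ?C \<and> (0 + norm x *\<^sub>R s) *\<^sub>R sgn x \<in> D)"
          by simp
      qed
      also have "\<dots> \<longleftrightarrow> (AE t in lborel. \<not> (0 < t \<and> x \<in> ?C \<and> t *\<^sub>R sgn x \<in> D))"
        by (rule AE_lborel_affine_iff[OF _ p]) (use False in simp)
      finally show ?thesis by simp
    qed simp
  qed
  also have "\<dots> \<longleftrightarrow> (AE s in lborel. AE x in lborel. \<not> (0 < s \<and> x \<in> ?C \<and> s *\<^sub>R x \<in> D))"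
    by (rule lborel_pair.AE_commute[where P = "\<lambda>t x. \<not> (0 < t \<and> x \<in> ?C \<and> t *\<^sub>R x \<in> D)", symmetric,
          OF meas[of "\<lambda>x. x"]]) simp
  finally show ?thesis .
qed

lemma AE_lborel_obtain:
  fixes l :: real
  assumes "AE t in lborel. P t" "l < u"
  obtains t where "l < t" "t < u" "P t"
proof (rule ccontr)
  assume "\<not> thesis"
  then have no: "\<And>t. l < t \<Longrightarrow> t < u \<Longrightarrow> \<not> P t" using that by blast
  have "AE t in lborel. t \<notin> {l<..<u}"
    using assms(1) by eventually_elim (use no in auto)
  then have "{l<..<u} \<in> null_sets lborel"
    using AE_iff_null_sets[of "{l<..<u}" lborel] by simp
  then show False
    using assms(2) by (simp add: null_sets_def)
qed

lemma null_if_spheres_null: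
  fixes D :: "(real^'n) set"
  assumes D: "D \<in> sets borel" "0 \<notin> D" "bounded D"
    and null: "\<And>t. 0 < t \<Longrightarrow> emeasure sphere_measure {\<sigma>\<in>sphere 0 1. t *\<^sub>R \<sigma> \<in> D} = 0"
  shows "AE x in lborel. x \<notin> D"
proof -
  obtain R where R: "0 < R" "\<And>x. x \<in> D \<Longrightarrow> norm x \<le> R"
    using D(3) by (auto simp: bounded_pos)
  have "AE s in lborel. AE x in lborel. \<not> (0 < s \<and> x \<in> cball 0 1 - {0} \<and> s *\<^sub>R x \<in> D)"
    using null by (subst spheres_null_iff_dilates_null[OF D(1), symmetric]) auto
  \<comment> \<open>For a dilation factor larger than the radius of \<open>D\<close> the rescaled set lies in the unit ball.\<close>
  then obtain s where s: "R < s" "AE x in lborel. \<not> (0 < s \<and> x \<in> cball 0 1 - {0} \<and> s *\<^sub>R x \<in> D)"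
    by (rule AE_lborel_obtain[of _ R "R + 1"]) auto
  have "0 < s" using R s by simp
  from s(2) have "AE x in lborel. 0 + s *\<^sub>R x \<notin> D"
  proof eventually_elim
    case (elim x)
    show ?case
    proof
      assume "0 + s *\<^sub>R x \<in> D"
      then have "s *\<^sub>R x \<in> D" "x \<noteq> 0"
        using D(2) by auto
      then have "s * norm x \<le> R"
        using R(2)[of "s *\<^sub>R x"] \<open>0 < s\<close> by simp
      then have "norm x \<le> 1"
        using s(1) R(1) \<open>0 < s\<close> by (smt (verit) mult_less_cancel_left1)
      then show False
        using elim \<open>s *\<^sub>R x \<in> D\<close> \<open>x \<noteq> 0\<close> \<open>0 < s\<close> by simp
    qed
  qed
  moreover have "Measurable.pred borel (\<lambda>x. x \<notin> D)"
    using D(1) by measurable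
  ultimately show ?thesis
    using AE_lborel_affine_iff[of s "\<lambda>x. x \<notin> D" 0] \<open>0 < s\<close> by simp
qed

lemma spheres_null_if_null:
  fixes D :: "(real^'n) set"
  assumes D: "D \<in> sets borel" and null: "AE x in lborel. x \<notin> D"
  shows "AE t in lborel. 0 < t \<longrightarrow> emeasure sphere_measure {\<sigma>\<in>sphere 0 1. x0 + t *\<^sub>R \<sigma> \<in> D} = 0"
proof -
  define D' where "D' = {y. x0 + y \<in> D}"
  have "(\<lambda>y. x0 + y) -` D \<inter> space borel \<in> sets borel"
    by (rule measurable_sets[OF _ D]) measurable
  then have D': "D' \<in> sets borel"
    by (simp add: D'_def vimage_def)
  have p: "Measurable.pred borel (\<lambda>x. x \<notin> D)"
    using D by measurable
  have "AE x in lborel. \<not> (0 < s \<and> x \<in> cball 0 1 - {0} \<and> s *\<^sub>R x \<in> D')" for s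
  proof (cases "0 < s")
    case True
    then have "AE x in lborel. x0 + s *\<^sub>R x \<notin> D"
      using AE_lborel_affine_iff[OF _ p, of s x0] null by simp
    then show ?thesis
      by eventually_elim (simp add: D'_def)
  qed simp
  then have "AE t in lborel. 0 < t \<longrightarrow> emeasure sphere_measure {\<sigma>\<in>sphere 0 1. t *\<^sub>R \<sigma> \<in> D'} = 0"
    by (subst spheres_null_iff_dilates_null[OF D']) simp
  then show ?thesis
    by (simp add: D'_def)
qed

section \<open>Truncations of extended real valued functions\<close>

text \<open>Truncation from below makes functions with values in \<open>[-\<infinity>,
  \<infinity>)\<close> real valued and locally bounded.\<close>

definition truncation :: "('a \<Rightarrow> ereal) \<Rightarrow> nat \<Rightarrow> 'a \<Rightarrow> real" where
  "truncation u N x = real_of_ereal (max (u x) (ereal (- real N)))"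

lemma ereal_truncation: "u x < \<infinity> \<Longrightarrow> ereal (truncation u N x) = max (u x) (ereal (- real N))"
  unfolding truncation_def by (cases "u x") (auto simp: max_def)

lemma truncation_ge: "u x < \<infinity> \<Longrightarrow> - real N \<le> truncation u N x"
  unfolding truncation_def by (cases "u x") (auto simp: max_def)

lemma truncation_mono: "u x \<le> v x \<Longrightarrow> v x < \<infinity> \<Longrightarrow> truncation u N x \<le> truncation v N x"
  unfolding truncation_def by (cases "u x"; cases "v x") (auto simp: max_def)

lemma truncation_antimono: "u x < \<infinity> \<Longrightarrow> M \<le> N \<Longrightarrow> truncation u N x \<le> truncation u M x"
  unfolding truncation_def by (cases "u x") (auto simp: max_def)

lemma usc_on_open_less:
  assumes "usc_on X u" "open X"
  shows "open {x\<in>X. u x < c}"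
proof (subst open_subopen, intro ballI)
  fix x assume x: "x \<in> {x\<in>X. u x < c}"
  then have "\<forall>\<^sub>F y in at x within X. u y < c"
    using assms(1) by (auto simp: usc_on_def)
  moreover have "at x within X = at x"
    using x assms(2) by (intro at_within_open) auto
  ultimately have "\<forall>\<^sub>F y in at x. u y < c"
    by (simp only:)
  then obtain S where S: "open S" "x \<in> S" "\<forall>y\<in>S. y \<noteq> x \<longrightarrow> u y < c"
    unfolding eventually_at_topological by blast
  then show "\<exists>T. open T \<and> x \<in> T \<and> T \<subseteq> {x\<in>X. u x < c}"
    using x assms(2) by (intro exI[of _ "S \<inter> X"]) auto
qed

lemma real_usc_truncation:
  assumes "usc_on X u" "open X" "\<And>x. x \<in> X \<Longrightarrow> u x < \<infinity>"
  shows "real_usc X (truncation u N)"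
  unfolding real_usc_def
proof
  fix c
  show "openin (top_of_set X) {x\<in>X. truncation u N x < c}"
  proof (cases "- real N < c")
    case True
    have "truncation u N x < c \<longleftrightarrow> u x < ereal c" if "x \<in> X" for x
    proof -
      have "truncation u N x < c \<longleftrightarrow> ereal (truncation u N x) < ereal c" by simp
      also have "\<dots> \<longleftrightarrow> u x < ereal c"
        unfolding ereal_truncation[of u x, OF assms(3)[OF that]] using True by simp
      finally show ?thesis .
    qed
    then have "{x\<in>X. truncation u N x < c} = {x\<in>X. u x < ereal c}" by auto
    then show ?thesis
      using usc_on_open_less[OF assms(1,2)] assms(2) by (simp add: openin_open_eq)
  next
    case False
    have "\<not> truncation u N x < c" if "x \<in> X" for x
      using truncation_ge[of u x N, OF assms(3)[OF that]] False by simp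
    then have empty: "{x\<in>X. truncation u N x < c} = {}"
      by blast
    show ?thesis
      unfolding empty by simp
  qed
qed

lemma sphere_bounded_truncation:
  fixes u :: "real^'n \<Rightarrow> ereal"
  assumes "usc_on X u" "open X" "\<And>x. x \<in> X \<Longrightarrow> u x < \<infinity>"
    and "continuous_on (sphere 0 1) \<gamma>" "\<And>\<sigma>. \<sigma> \<in> sphere 0 1 \<Longrightarrow> \<gamma> \<sigma> \<in> X"
  shows "sphere_bounded (\<lambda>\<sigma> :: real^'n. truncation u N (\<gamma> \<sigma>))"
proof -
  have "real_usc X (truncation u N)"
    by (rule real_usc_truncation[OF assms(1,2)]) (rule assms(3))
  moreover have "\<gamma> ` sphere 0 1 \<subseteq> X"
    by (rule image_subsetI) (rule assms(5))
  ultimately have "real_usc (sphere 0 1) (\<lambda>\<sigma>. truncation u N (\<gamma> \<sigma>))"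
    using assms(4) real_usc_compose[of X "truncation u N" "sphere 0 1" \<gamma>] by blast
  moreover have "- real N \<le> truncation u N (\<gamma> \<sigma>)" if "\<sigma> \<in> sphere 0 1" for \<sigma>
    by (rule truncation_ge, rule assms(3), rule assms(5), rule that)
  ultimately show ?thesis
    by (rule real_usc_sphere_bounded)
qed

text \<open>The means of the truncations decrease to the spherical average by monotone convergence,
  applied to the negative part.\<close>

lemma spherical_average_truncation:
  fixes u :: "real^'n \<Rightarrow> ereal"
  assumes fin: "spherical_average u t = ereal c"
    and bdd: "\<And>N. sphere_bounded (\<lambda>\<sigma>. truncation u N (t *\<^sub>R \<sigma>))"
    and lt: "\<And>\<sigma>. \<sigma> \<in> sphere 0 1 \<Longrightarrow> u (t *\<^sub>R \<sigma>) < \<infinity>"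
  shows "c \<le> sphere_mean (\<lambda>\<sigma>. truncation u N (t *\<^sub>R \<sigma>))"
    and "0 < d \<Longrightarrow> \<exists>N0. \<forall>N\<ge>N0. sphere_mean (\<lambda>\<sigma>. truncation u N (t *\<^sub>R \<sigma>)) \<le> c + d"
proof -
  define \<mu> where "\<mu> = measure (sphere_measure :: (real^'n) measure) (sphere 0 1)"
  have \<mu>: "0 < \<mu>" unfolding \<mu>_def by (rule sphere_area_pos)
  define f where "f = (\<lambda>N \<sigma>. truncation u N (t *\<^sub>R \<sigma>))"
  have f_int: "integrable sphere_measure (f N)" for N
    unfolding f_def by (rule sphere_bounded_integrable[OF bdd])
  define I where "I N = (LINT \<sigma>|sphere_measure. f N \<sigma>)" for N
  have f_mono: "f N \<sigma> \<le> f M \<sigma>" if "M \<le> N" "\<sigma> \<in> sphere 0 1" for M N \<sigma>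
    unfolding f_def by (rule truncation_antimono[of u "t *\<^sub>R \<sigma>", OF lt[OF that(2)] that(1)])
  have f0: "0 \<le> f 0 \<sigma>" if "\<sigma> \<in> sphere 0 1" for \<sigma>
    using truncation_ge[of u "t *\<^sub>R \<sigma>" 0, OF lt[OF that]] by (simp add: f_def)
  have pos: "(\<integral>\<^sup>+\<sigma>. e2ennreal (u (t *\<^sub>R \<sigma>)) \<partial>sphere_measure) = ennreal (I 0)"
  proof -
    have "e2ennreal (u (t *\<^sub>R \<sigma>)) = ennreal (f 0 \<sigma>)" if "\<sigma> \<in> sphere 0 1" for \<sigma>
      using lt[OF that] unfolding f_def truncation_def
      by (cases "u (t *\<^sub>R \<sigma>)") (auto simp: max_def ennreal_neg e2ennreal_neg)
    then have "(\<integral>\<^sup>+\<sigma>. e2ennreal (u (t *\<^sub>R \<sigma>)) \<partial>sphere_measure) = (\<integral>\<^sup>+\<sigma>. ennreal (f 0 \<sigma>) \<partial>sphere_measure)"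
      by (intro nn_integral_cong) simp
    also have "\<dots> = ennreal (I 0)"
      unfolding I_def
      by (rule nn_integral_eq_integral[OF f_int])
        (auto intro!: AE_I2 f0)
    finally show ?thesis .
  qed
  have I0: "0 \<le> I 0"
    unfolding I_def by (intro integral_nonneg_AE AE_I2 f0) simp
  have nn: "(\<integral>\<^sup>+\<sigma>. ennreal (f 0 \<sigma> - f N \<sigma>) \<partial>sphere_measure) = ennreal (I 0 - I N)" for N
    unfolding I_def Bochner_Integration.integral_diff[OF f_int f_int, symmetric]
    by (rule nn_integral_eq_integral) (auto intro!: AE_I2 f_int Bochner_Integration.integrable_diff f_mono)
  have neg: "(\<integral>\<^sup>+\<sigma>. e2ennreal (- u (t *\<^sub>R \<sigma>)) \<partial>sphere_measure) = (SUP N. ennreal (I 0 - I N))"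
  proof -
    have "e2ennreal (- u (t *\<^sub>R \<sigma>)) = (SUP N. ennreal (f 0 \<sigma> - f N \<sigma>))" if \<sigma>: "\<sigma> \<in> sphere 0 1" for \<sigma>
    proof (cases "u (t *\<^sub>R \<sigma>)")
      case (real r)
      show ?thesis
      proof (rule antisym)
        obtain N :: nat where N: "- r \<le> real N" using real_arch_simple by blast
        have "e2ennreal (- u (t *\<^sub>R \<sigma>)) = ennreal (f 0 \<sigma> - f N \<sigma>)"
          using N real by (cases "0 \<le> r") (auto simp: f_def truncation_def max_def ennreal_neg)
        then show "e2ennreal (- u (t *\<^sub>R \<sigma>)) \<le> (SUP N. ennreal (f 0 \<sigma> - f N \<sigma>))"
          by (auto intro: SUP_upper)
        show "(SUP N. ennreal (f 0 \<sigma> - f N \<sigma>)) \<le> e2ennreal (- u (t *\<^sub>R \<sigma>))"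
        proof (rule SUP_least)
          fix N
          have "f 0 \<sigma> - f N \<sigma> \<le> max 0 (- r)"
            using real by (auto simp: f_def truncation_def max_def)
          then have "ennreal (f 0 \<sigma> - f N \<sigma>) \<le> ennreal (max 0 (- r))"
            by (rule ennreal_leI)
          also have "\<dots> = e2ennreal (- u (t *\<^sub>R \<sigma>))"
            using real by (auto simp: max_def ennreal_neg)
          finally show "ennreal (f 0 \<sigma> - f N \<sigma>) \<le> e2ennreal (- u (t *\<^sub>R \<sigma>))" .
        qed
      qed
    next
      case PInf
      then show ?thesis using lt[OF \<sigma>] by simp
    next
      case MInf
      then have "f 0 \<sigma> - f N \<sigma> = real N" for N
        by (simp add: f_def truncation_def max_def)
      then have "(SUP N. ennreal (f 0 \<sigma> - f N \<sigma>)) = (SUP N :: nat. of_nat N)"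
        by (simp only: ennreal_of_nat_eq_real_of_nat)
      moreover have "- u (t *\<^sub>R \<sigma>) = \<infinity>"
        unfolding MInf by simp
      ultimately show ?thesis
        by (simp only: ennreal_SUP_of_nat_eq_top e2ennreal_infty)
    qed
    then have "(\<integral>\<^sup>+\<sigma>. e2ennreal (- u (t *\<^sub>R \<sigma>)) \<partial>sphere_measure) = (\<integral>\<^sup>+\<sigma>. (SUP N. ennreal (f 0 \<sigma> - f N \<sigma>)) \<partial>sphere_measure)"
      by (intro nn_integral_cong) simp
    also have "\<dots> = (SUP N. \<integral>\<^sup>+\<sigma>. ennreal (f 0 \<sigma> - f N \<sigma>) \<partial>sphere_measure)"
    proof (rule nn_integral_monotone_convergence_SUP_AE)
      show "AE \<sigma> in sphere_measure. ennreal (f 0 \<sigma> - f N \<sigma>) \<le> ennreal (f 0 \<sigma> - f (Suc N) \<sigma>)" for N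
        using f_mono[of N "Suc N"] by (intro AE_I2 ennreal_leI) auto
      show "(\<lambda>\<sigma>. ennreal (f 0 \<sigma> - f N \<sigma>)) \<in> borel_measurable sphere_measure" for N
        using f_int[of 0] f_int[of N] by (intro measurable_compose[OF _ measurable_ennreal] borel_measurable_diff) auto
    qed
    also have "\<dots> = (SUP N. ennreal (I 0 - I N))"
      by (simp add: nn)
    finally show ?thesis .
  qed
  \<comment> \<open>The integral of the negative part; it is finite because the average is.\<close>
  define Q where "Q = (SUP N. ennreal (I 0 - I N))"
  have avg: "ereal (1 / \<mu>) * (ereal (I 0) - enn2ereal Q) = ereal c"
    using fin I0 unfolding spherical_average_def ereal_integral_def pos neg Q_def \<mu>_def
    by (simp add: enn2ereal_ennreal)
  have "Q \<noteq> \<infinity>"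
  proof
    assume "Q = \<infinity>"
    then have "enn2ereal Q = \<infinity>" by simp
    then show False
      using avg \<mu> by simp
  qed
  then obtain q where q: "Q = ennreal q" "0 \<le> q"
    by (cases Q) auto
  then have c: "c = (I 0 - q) / \<mu>"
    using avg \<mu> by (simp add: enn2ereal_ennreal)
  have IN: "I 0 - I N \<le> q" for N
  proof -
    have "ennreal (I 0 - I N) \<le> ennreal q"
      unfolding q(1)[symmetric] Q_def by (rule SUP_upper) simp
    then show ?thesis using q(2) by (simp add: ennreal_le_iff)
  qed
  have sphere_mean_I: "sphere_mean (\<lambda>\<sigma>. truncation u N (t *\<^sub>R \<sigma>)) = I N / \<mu>" for N
    by (simp add: sphere_mean_def I_def f_def \<mu>_def)
  show "c \<le> sphere_mean (\<lambda>\<sigma>. truncation u N (t *\<^sub>R \<sigma>))"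
    unfolding sphere_mean_I c using IN[of N] \<mu> by (intro divide_right_mono) auto
  show "\<exists>N0. \<forall>N\<ge>N0. sphere_mean (\<lambda>\<sigma>. truncation u N (t *\<^sub>R \<sigma>)) \<le> c + d" if "0 < d"
  proof -
    have "\<exists>N0. q - d * \<mu> \<le> I 0 - I N0"
    proof (rule ccontr)
      assume "\<not> ?thesis"
      then have lt: "I 0 - I N < q - d * \<mu>" for N by (simp add: not_le)
      then have "Q \<le> ennreal (q - d * \<mu>)"
        unfolding Q_def by (intro SUP_least ennreal_leI less_imp_le)
      moreover have "0 \<le> q - d * \<mu>" using lt[of 0] by simp
      ultimately have "q \<le> q - d * \<mu>"
        using q by (simp add: ennreal_le_iff)
      then show False using \<mu> \<open>0 < d\<close> by (simp add: mult_le_0_iff)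
    qed
    then obtain N0 where N0: "q - d * \<mu> \<le> I 0 - I N0" by blast
    have "I N / \<mu> \<le> c + d" if "N0 \<le> N" for N
    proof -
      have "I N \<le> I N0"
        unfolding I_def using f_mono[OF that] by (intro integral_mono f_int) auto
      then have "I N \<le> I 0 - q + d * \<mu>" using N0 by simp
      then show ?thesis
        using \<mu> by (simp add: c field_simps)
    qed
    then show ?thesis unfolding sphere_mean_I by blast
  qed
qed

section \<open>Comparison with radial functions\<close>

lemma F_subharmonic_open: "F_subharmonic F X u \<Longrightarrow> open X"
  unfolding F_subharmonic_def by (elim conjE)

lemma F_subharmonic_usc: "F_subharmonic F X u \<Longrightarrow> usc_on X u"
  unfolding F_subharmonic_def by (elim conjE)

lemma F_subharmonic_less_top: "F_subharmonic F X u \<Longrightarrow> x \<in> X \<Longrightarrow> u x < \<infinity>"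
  unfolding F_subharmonic_def by (elim conjE) (rule bspec)

lemma F_subharmonic_test:
  assumes "F_subharmonic F X u" "x \<in> X" "C2_near \<phi> x H"
    "\<forall>\<^sub>F y in nhds x. u y \<le> ereal (\<phi> y)" "u x = ereal (\<phi> x)"
  shows "H \<in> F"
  using assms unfolding F_subharmonic_def by (elim conjE) (drule (1) bspec, blast)

text \<open>The linear inequalities implied by membership of test Hessians in \<open>F\<close>.
  Truncations satisfy them at once, since at points where the constant is active a test function has
  a local minimum; membership in \<open>F\<close> itself would require the symmetry of its
  Hessian.\<close>

definition cone_viscosity_sub :: "(real^'n^'n) set \<Rightarrow> (real^'n) set \<Rightarrow> (real^'n \<Rightarrow> real) \<Rightarrow> bool" where
  "cone_viscosity_sub F X w \<longleftrightarrow>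
     (\<forall>T :: real^'n^'n. (\<forall>A\<in>F. 0 \<le> (T ** transpose T) \<bullet> A) \<longrightarrow> viscosity_sub (T ** transpose T) X w)"

lemma cone_viscosity_sub_truncation_max:
  fixes F :: "(real^'n^'n) set"
  assumes u: "F_subharmonic F X u" and v: "F_subharmonic F X v"
  shows "cone_viscosity_sub F X (truncation (\<lambda>x. max (u x) (v x)) N)"
  unfolding cone_viscosity_sub_def viscosity_sub_def
proof (intro allI impI ballI)
  fix T :: "real^'n^'n" and x \<phi> H
  let ?w = "\<lambda>x. max (u x) (v x)"
  assume T: "\<forall>A\<in>F. 0 \<le> (T ** transpose T) \<bullet> A" and x: "x \<in> X" and \<phi>: "C2_near \<phi> x H"
    and le: "\<forall>\<^sub>F y in nhds x. truncation ?w N y \<le> \<phi> y" and eq: "truncation ?w N x = \<phi> x"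
  note op = F_subharmonic_open[OF u]
  have fin: "?w y < \<infinity>" if "y \<in> X" for y
    unfolding max_less_iff_conj
    using F_subharmonic_less_top[OF u that] F_subharmonic_less_top[OF v that] by (rule conjI)
  have ev: "\<forall>\<^sub>F y in nhds x. y \<in> X \<and> truncation ?w N y \<le> \<phi> y"
    using le eventually_nhds_in_open[OF op x] by eventually_elim simp
  have tr: "ereal (truncation ?w N y) = max (?w y) (ereal (- real N))" if "y \<in> X" for y
    by (rule ereal_truncation) (rule fin[OF that])
  have test: "0 \<le> (T ** transpose T) \<bullet> H"
    if sub: "F_subharmonic F X s" and s: "\<And>y. y \<in> X \<Longrightarrow> s y \<le> ?w y" "s x = ereal (truncation ?w N x)" for s
  proof -
    have "\<forall>\<^sub>F y in nhds x. s y \<le> ereal (\<phi> y)"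
      using ev
    proof eventually_elim
      case (elim y)
      then have "s y \<le> ereal (truncation ?w N y)"
        unfolding tr[OF conjunct1[OF elim]] using s(1)[of y] by (simp add: le_max_iff_disj)
      also have "\<dots> \<le> ereal (\<phi> y)"
        using elim by simp
      finally show ?case .
    qed
    moreover have "s x = ereal (\<phi> x)"
      using s(2) eq by simp
    ultimately have "H \<in> F"
      by (rule F_subharmonic_test[OF sub x \<phi>])
    then show ?thesis using T by blast
  qed
  consider "u x = ereal (truncation ?w N x)" | "v x = ereal (truncation ?w N x)" | "truncation ?w N x = - real N"
    using tr[OF x] by (auto simp: max_def split: if_splits)
  then show "0 \<le> (T ** transpose T) \<bullet> H"
  proof cases
    case 1
    then show ?thesis by (intro test[OF u]) auto
  next
    case 2
    then show ?thesis by (intro test[OF v]) auto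
  next
    case 3
    have "\<forall>\<^sub>F y in nhds x. \<phi> x \<le> \<phi> y"
      using ev
    proof eventually_elim
      case (elim y)
      then have "- real N \<le> truncation ?w N y"
        by (intro truncation_ge fin) simp
      then show ?case using elim 3 eq by simp
    qed
    then show ?thesis
      by (intro inner_gram_nonneg C2_near_local_min[OF \<phi>])
  qed
qed

text \<open>In the variable \<open>s = |x|\<^sup>2 / 2\<close>, radial functions whose Hessian lies
  on the boundary of the cone solve \<open>2 s k'' + p k' = 0\<close>, that is \<open>k' = \<alpha>
  s powr (- p / 2)\<close>. Here \<open>\<alpha> \<ge> 0\<close> because the boundary values
  increase.\<close>

lemma radial_profile:
  fixes p q1 q2 A B :: real
  assumes q: "0 < q1" "q1 < q2" and AB: "A \<le> B"
  shows "\<exists>k k1 k2. (\<forall>s>0. (k has_real_derivative k1 s) (at s)) \<and> (\<forall>s>0. (k1 has_real_derivative k2 s) (at s)) \<and>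
    continuous_on {0<..} k2 \<and> (\<forall>s>0. 0 \<le> k1 s \<and> k1 s * p + 2 * s * k2 s = 0) \<and> k q1 = A \<and> k q2 = B"
proof -
  have "\<exists>G. \<forall>s>0. (G has_real_derivative s powr (- p / 2)) (at s)"
  proof (cases "p = 2")
    case True
    then show ?thesis
      by (intro exI[of _ ln]) (auto intro!: derivative_eq_intros simp: powr_minus_divide)
  next
    case False
    show ?thesis
    proof (intro exI allI impI)
      fix s :: real assume "0 < s"
      have "((\<lambda>s. s powr (1 - p / 2)) has_real_derivative (1 - p / 2) * s powr (1 - p / 2 - 1)) (at s)"
        using \<open>0 < s\<close> by (rule has_real_derivative_powr)
      from DERIV_cdivide[OF this, of "1 - p / 2"]
      show "((\<lambda>s. s powr (1 - p / 2) / (1 - p / 2)) has_real_derivative s powr (- p / 2)) (at s)"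
        using False by simp
    qed
  qed
  then obtain G where G: "\<And>s. 0 < s \<Longrightarrow> (G has_real_derivative s powr (- p / 2)) (at s)"
    by blast
  have "G q1 < G q2"
  proof (rule DERIV_pos_imp_increasing[OF q(2)])
    fix s assume "q1 \<le> s" "s \<le> q2"
    then have "0 < s" using q by simp
    then show "\<exists>y. (G has_real_derivative y) (at s) \<and> 0 < y"
      using G by (intro exI[of _ "s powr (- p / 2)"]) auto
  qed
  define \<alpha> where "\<alpha> = (B - A) / (G q2 - G q1)"
  have "0 \<le> \<alpha>" using AB \<open>G q1 < G q2\<close> by (simp add: \<alpha>_def)
  show ?thesis
  proof (intro exI conjI allI impI)
    fix s :: real assume s: "0 < s"
    show "((\<lambda>s. A + \<alpha> * (G s - G q1)) has_real_derivative \<alpha> * s powr (- p / 2)) (at s)"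
      using G[OF s] by (auto intro!: derivative_eq_intros)
    have "((\<lambda>s. s powr (- p / 2)) has_real_derivative (- p / 2) * s powr (- p / 2 - 1)) (at s)"
      using s by (rule has_real_derivative_powr)
    from DERIV_cmult[OF this, of \<alpha>]
    show "((\<lambda>s. \<alpha> * s powr (- p / 2)) has_real_derivative \<alpha> * ((- p / 2) * s powr (- p / 2 - 1))) (at s)" .
    show "0 \<le> \<alpha> * s powr (- p / 2)"
      using \<open>0 \<le> \<alpha>\<close> by simp
    have "s * s powr (- p / 2 - 1) = s powr (- p / 2)"
      using s powr_mult_base[of s "- p / 2 - 1"] by simp
    moreover have "2 * s * (\<alpha> * ((- p / 2) * X)) = - (\<alpha> * (s * X) * p)" for X
      by simp
    ultimately have "2 * s * (\<alpha> * ((- p / 2) * s powr (- p / 2 - 1))) = - (\<alpha> * s powr (- p / 2) * p)"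
      by (simp only:)
    then show "\<alpha> * s powr (- p / 2) * p + 2 * s * (\<alpha> * ((- p / 2) * s powr (- p / 2 - 1))) = 0"
      by (simp only: right_minus)
  next
    show "continuous_on {0<..} (\<lambda>s. \<alpha> * ((- p / 2) * s powr (- p / 2 - 1)))"
      by (intro continuous_intros) auto
    show "A + \<alpha> * (G q1 - G q1) = A" by simp
    show "A + \<alpha> * (G q2 - G q1) = B"
      using \<open>G q1 < G q2\<close> by (simp add: \<alpha>_def)
  qed
qed

lemma real_usc_group_average:
  assumes w: "real_usc X w" and L: "L \<noteq> []" "\<And>g x. g \<in> set L \<Longrightarrow> x \<in> X \<Longrightarrow> g *v x \<in> X"
  shows "real_usc X (group_average L w)"
proof -
  have "real_usc X (\<lambda>x. \<Sum>g\<leftarrow>L. w (g *v x))"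
    using L(2)
  proof (induction L)
    case Nil
    show ?case by (simp add: real_usc_continuous)
  next
    case (Cons g L)
    have "real_usc X (\<lambda>x. w (g *v x))"
      by (rule real_usc_compose[OF w matrix_vector_mult_linear_continuous_on]) (use Cons.prems in auto)
    moreover have "real_usc X (\<lambda>x. \<Sum>g\<leftarrow>L. w (g *v x))"
      by (rule Cons.IH) (use Cons.prems in auto)
    ultimately show ?case
      using real_usc_add by fastforce
  qed
  from real_usc_cmult[OF this, of "1 / real (length L)"] show ?thesis
    using L(1) by (simp add: group_average_def[abs_def])
qed

lemma sphere_mean_group_average_compose:
  assumes "\<And>g. g \<in> set L \<Longrightarrow> sphere_bounded (\<lambda>z. w (g *v \<gamma> z))"
  shows "sphere_bounded (\<lambda>z. group_average L w (\<gamma> z))"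
    and "sphere_mean (\<lambda>z. group_average L w (\<gamma> z)) = (\<Sum>g\<leftarrow>L. sphere_mean (\<lambda>z. w (g *v \<gamma> z))) / real (length L)"
proof -
  have "sphere_bounded (\<lambda>z. \<Sum>g\<leftarrow>L. w (g *v \<gamma> z)) \<and>
      sphere_mean (\<lambda>z. \<Sum>g\<leftarrow>L. w (g *v \<gamma> z)) = (\<Sum>g\<leftarrow>L. sphere_mean (\<lambda>z. w (g *v \<gamma> z)))"
    using assms
  proof (induction L)
    case (Cons g L)
    then have "sphere_bounded (\<lambda>z. w (g *v \<gamma> z))" "sphere_bounded (\<lambda>z. \<Sum>g\<leftarrow>L. w (g *v \<gamma> z))"
      "sphere_mean (\<lambda>z. \<Sum>g\<leftarrow>L. w (g *v \<gamma> z)) = (\<Sum>g\<leftarrow>L. sphere_mean (\<lambda>z. w (g *v \<gamma> z)))"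
      by auto
    then show ?case
      by (simp add: sphere_bounded_add sphere_mean_add)
  qed simp
  then show "sphere_bounded (\<lambda>z. group_average L w (\<gamma> z))"
    and "sphere_mean (\<lambda>z. group_average L w (\<gamma> z)) = (\<Sum>g\<leftarrow>L. sphere_mean (\<lambda>z. w (g *v \<gamma> z))) / real (length L)"
    using sphere_bounded_cmult[of "\<lambda>z. \<Sum>g\<leftarrow>L. w (g *v \<gamma> z)" "1 / real (length L)"]
      sphere_mean_cmult[of "1 / real (length L)" "\<lambda>z. \<Sum>g\<leftarrow>L. w (g *v \<gamma> z)"]
    by (simp_all add: group_average_def)
qed

lemma scaleR_gram: "(r *\<^sub>R T) ** transpose (r *\<^sub>R T) = r\<^sup>2 *\<^sub>R (T ** transpose T :: real^'n^'n)"
  by (simp add: vec_eq_iff matrix_matrix_mult_def transpose_def sum_distrib_left power2_eq_square ac_simps)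

lemma invertible_scaleR_matrix:
  fixes T :: "real^'n^'n"
  assumes "invertible T" "r \<noteq> 0"
  shows "invertible (r *\<^sub>R T)"
proof -
  obtain S where S: "T ** S = mat 1" "S ** T = mat 1"
    using assms(1) unfolding invertible_def by blast
  have "(r *\<^sub>R T) ** ((1 / r) *\<^sub>R S) = T ** S" "((1 / r) *\<^sub>R S) ** (r *\<^sub>R T) = S ** T"
    using assms(2) by (simp_all add: vec_eq_iff matrix_matrix_mult_def)
  then show ?thesis
    using S unfolding invertible_def by metis
qed

lemma invertible_norm_lower_bound:
  fixes T :: "real^'n^'n"
  assumes "invertible T"
  obtains c where "0 < c" "\<And>z. norm z = 1 \<Longrightarrow> c \<le> norm (T *v z)"
proof -
  obtain S where S: "S ** T = mat 1"
    using assms unfolding invertible_def by blast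
  obtain M where M: "0 < M" "\<And>x. norm (S *v x) \<le> M * norm x"
    using linear_bounded_pos[OF matrix_vector_mul_linear[of S]] by blast
  have "1 / M \<le> norm (T *v z)" if "norm z = 1" for z
  proof -
    have "S *v (T *v z) = z" by (simp add: matrix_vector_mul_assoc S)
    then have "1 \<le> M * norm (T *v z)"
      using M(2)[of "T *v z"] that by simp
    then show ?thesis using M(1) by (simp add: field_simps)
  qed
  then show thesis using that[of "1 / M"] M(1) by simp
qed

context transitive_cone_subequation
begin

text \<open>An increasing radial profile below a supersolution on the boundary of a shell stays
  below it: adding a small multiple of \<open>|x|\<^sup>2\<close> moves its Hessian into the
  interior of \<open>F\<close>, so that it cannot touch the supersolution from below.\<close>

lemma radial_barrier_below:
  assumes t: "0 < t1" "t1 < t2"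
    and k: "\<And>s. 0 < s \<Longrightarrow> (k has_real_derivative k1 s) (at s)"
      "\<And>s. 0 < s \<Longrightarrow> (k1 has_real_derivative k2 s) (at s)" "continuous_on {0<..} k2"
      "\<And>s. 0 < s \<Longrightarrow> 0 \<le> k1 s" "\<And>s. 0 < s \<Longrightarrow> k1 s * riesz_char + 2 * s * k2 s = 0"
    and usc: "real_usc {x :: real^'n. t1 \<le> norm x \<and> norm x \<le> t2} (\<lambda>x. - \<psi> (norm x))"
    and super: "\<And>x \<phi> H. t1 < norm x \<Longrightarrow> norm x < t2 \<Longrightarrow> C2_near \<phi> x H \<Longrightarrow>
      (\<forall>\<^sub>F y in nhds x. \<phi> y \<le> \<psi> (norm y)) \<Longrightarrow> \<phi> x = \<psi> (norm x) \<Longrightarrow> H \<notin> (top_of_set Sym2) interior_of F"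
    and bd: "k (t1\<^sup>2 / 2) \<le> \<psi> t1" "k (t2\<^sup>2 / 2) \<le> \<psi> t2"
    and x: "t1 \<le> norm x" "norm (x :: real^'n) \<le> t2"
  shows "k ((norm x)\<^sup>2 / 2) \<le> \<psi> (norm x)"
proof (rule field_le_epsilon)
  fix e :: real assume "0 < e"
  let ?q = "\<lambda>x :: real^'n. (norm x)\<^sup>2 / 2"
  define q2 where "q2 = t2\<^sup>2 / 2"
  have "0 < q2" using t by (simp add: q2_def)
  \<comment> \<open>The profile is made a strict subsolution by adding a multiple of \<open>|x|\<^sup>2 / 2\<close>.\<close>
  define d where "d = e / q2"
  have "0 < d" using \<open>0 < e\<close> \<open>0 < q2\<close> by (simp add: d_def)
  let ?S = "{x :: real^'n. t1 \<le> norm x \<and> norm x \<le> t2}"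
  define f where "f s = k s + d * (s - q2)" for s
  define g where "g y = f (?q y) - \<psi> (norm y)" for y
  have qpos: "0 < ?q y" if "t1 \<le> norm y" for y
  proof -
    have "0 < norm y" using that t by linarith
    then show ?thesis by simp
  qed
  have qle: "?q y \<le> q2" if "norm y \<le> t2" for y
    using that by (simp add: q2_def power_mono)
  have C2: "C2_near (\<lambda>y. f (?q y) - c) y ((k1 (?q y) + d) *\<^sub>R mat 1 + k2 (?q y) *\<^sub>R outer y)" if "y \<noteq> 0" for y c
    by (rule C2_near_radial[where f = "\<lambda>s. f s - c" and ?f1.0 = "\<lambda>s. k1 s + d"])
      (use that in \<open>auto simp: f_def intro!: derivative_eq_intros k\<close>)
  have contf: "continuous_on ?S (\<lambda>y. f (?q y))"
  proof (rule continuous_at_imp_continuous_on, rule ballI)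
    fix y assume "y \<in> ?S"
    then have "y \<noteq> 0" using t by auto
    from C2_near_isCont[OF C2[OF this, of 0]] show "isCont (\<lambda>y. f (?q y)) y" by simp
  qed
  have "real_usc ?S g"
    unfolding g_def using real_usc_add[OF real_usc_continuous[OF contf] usc] by simp
  moreover have "compact ?S"
  proof -
    have "?S = cball 0 t2 - ball 0 t1" by auto
    then show ?thesis by (simp add: compact_diff)
  qed
  ultimately obtain x0 where x0: "x0 \<in> ?S" "\<And>y. y \<in> ?S \<Longrightarrow> g y \<le> g x0"
    using x by (elim real_usc_attains_sup) auto
  have "g x0 \<le> 0"
  proof (rule ccontr)
    assume pos: "\<not> g x0 \<le> 0"
    have "norm x0 \<noteq> t1" "norm x0 \<noteq> t2"
    proof -
      show "norm x0 \<noteq> t2"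
      proof
        assume "norm x0 = t2"
        then show False using pos bd(2) by (simp add: g_def f_def q2_def)
      qed
      show "norm x0 \<noteq> t1"
      proof
        assume n: "norm x0 = t1"
        have "d * (?q x0 - q2) \<le> 0"
          using \<open>0 < d\<close> qle[of x0] x0(1) by (simp add: mult_le_0_iff)
        then show False using pos bd(1) by (simp add: g_def f_def n)
      qed
    qed
    then have int: "t1 < norm x0" "norm x0 < t2" using x0(1) by auto
    then have nz: "x0 \<noteq> 0" using t by auto
    let ?H = "(k1 (?q x0) + d) *\<^sub>R mat 1 + k2 (?q x0) *\<^sub>R outer x0"
    have "open ((\<lambda>y :: real^'n. norm y) -` {t1<..<t2})"
      by (intro continuous_open_vimage) (auto intro: continuous_intros)
    then have "\<forall>\<^sub>F y in nhds x0. y \<in> (\<lambda>y. norm y) -` {t1<..<t2}"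
      by (rule eventually_nhds_in_open) (use int in simp)
    then have le: "\<forall>\<^sub>F y in nhds x0. f (?q y) - g x0 \<le> \<psi> (norm y)"
    proof eventually_elim
      case (elim y)
      then show ?case using x0(2)[of y] by (simp add: g_def)
    qed
    have "?H \<notin> (top_of_set Sym2) interior_of F"
      by (rule super[OF int C2[OF nz] le]) (simp add: g_def)
    moreover have "?H \<in> (top_of_set Sym2) interior_of F"
    proof (rule radial_hessian_interior[OF nz])
      have q0: "0 < ?q x0" using qpos int by simp
      show "0 < k1 (?q x0) + d" using k(4)[OF q0] \<open>0 < d\<close> by simp
      have "k1 (?q x0) * riesz_char + k2 (?q x0) * (norm x0)\<^sup>2 = 0"
        using k(5)[OF q0] by (simp add: mult.commute)
      moreover have "0 < d * riesz_char" using \<open>0 < d\<close> riesz_char_ge_1 by simp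
      ultimately show "0 < (k1 (?q x0) + d) * riesz_char + k2 (?q x0) * (norm x0)\<^sup>2"
        by (simp add: distrib_right)
    qed
    ultimately show False by simp
  qed
  then have "g x \<le> 0" using x0(2)[of x] x by simp
  then have "k (?q x) \<le> \<psi> (norm x) + d * (q2 - ?q x)"
    by (simp add: g_def f_def algebra_simps)
  also have "d * (q2 - ?q x) \<le> d * q2"
    using \<open>0 < d\<close> by (intro mult_left_mono) auto
  also have "d * q2 = e" using \<open>0 < q2\<close> by (simp add: d_def)
  finally show "k (?q x) \<le> \<psi> (norm x) + e" by simp
qed

text \<open>A maximum of \<open>W - \<phi>\<close>, with \<open>W\<close> an average of
  \<open>w\<close> over \<open>G\<close>, is excluded wherever the Hessian of \<open>\<phi>\<close>
  lies outside \<open>F\<close>. A linear functional separates this Hessian from \<open>F\<close>.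
  With respect to the corresponding small ellipsoids \<open>W\<close> lies below its mean, by
  linearity of the mean value inequality, whereas \<open>\<phi>\<close> lies strictly above its
  mean.\<close>

lemma no_interior_max:
  assumes n: "CARD('n) \<ge> 2" and t: "0 < t1"
    and f: "\<And>s. 0 < s \<Longrightarrow> (f has_real_derivative f1 s) (at s)"
      "\<And>s. 0 < s \<Longrightarrow> (f1 has_real_derivative f2 s) (at s)" "continuous_on {0<..} f2"
    and w: "cone_viscosity_sub F X w" "real_usc X w" "\<And>x. x \<in> X \<Longrightarrow> m \<le> w x"
    and X: "\<And>x. t1 < norm x \<Longrightarrow> norm x < t2 \<Longrightarrow> x \<in> X" "\<And>g x. g \<in> G \<Longrightarrow> x \<in> X \<Longrightarrow> g *v x \<in> X"
    and L: "L \<noteq> []" "set L \<subseteq> G"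
    and x0: "t1 < norm x0" "norm (x0 :: real^'n) < t2"
    and f1: "0 < f1 ((norm x0)\<^sup>2 / 2)" "f1 ((norm x0)\<^sup>2 / 2) * riesz_char + (norm x0)\<^sup>2 * f2 ((norm x0)\<^sup>2 / 2) < 0"
    and max: "\<And>x. t1 < norm x \<Longrightarrow> norm x < t2 \<Longrightarrow>
      group_average L w x - f ((norm x)\<^sup>2 / 2) \<le> group_average L w x0 - f ((norm x0)\<^sup>2 / 2)"
  shows False
proof -
  let ?q = "\<lambda>x :: real^'n. (norm x)\<^sup>2 / 2"
  define \<phi> where "\<phi> y = f (?q y)" for y
  define H where "H y = f1 (?q y) *\<^sub>R mat 1 + f2 (?q y) *\<^sub>R outer y" for y
  have nz: "x0 \<noteq> 0" using x0 t by auto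
  have C2: "C2_near \<phi> y (H y)" if "y \<noteq> 0" for y
    unfolding \<phi>_def H_def by (rule C2_near_radial[OF f that])
  have "H x0 \<notin> F"
    unfolding H_def using f1 by (intro radial_hessian_notin nz) (simp_all add: mult.commute)
  moreover have "H x0 \<in> Sym2"
    unfolding H_def by (intro Sym2_add Sym2_scaleR Sym2_mat outer_Sym2)
  ultimately obtain T0 :: "real^'n^'n" where T0: "invertible T0" "\<forall>A\<in>F. 0 \<le> (T0 ** transpose T0) \<bullet> A"
    "(T0 ** transpose T0) \<bullet> H x0 < 0"
    using separating_gram by blast
  define B where "B = T0 ** transpose T0"
  define c where "c = - (B \<bullet> H x0)"
  have "0 < c" using T0(3) by (simp add: c_def B_def)
  define \<beta> where "\<beta> = B \<bullet> mat 1"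
  define \<epsilon> where "\<epsilon> = c / (4 * (\<bar>\<beta>\<bar> + 1))"
  have "0 < \<epsilon>" using \<open>0 < c\<close> by (simp add: \<epsilon>_def add_pos_pos add_nonneg_pos)
  have \<epsilon>\<beta>: "2 * \<epsilon> * \<beta> \<le> c / 2"
  proof -
    have "2 * \<epsilon> * \<beta> \<le> 2 * \<epsilon> * (\<bar>\<beta>\<bar> + 1)"
      using \<open>0 < \<epsilon>\<close> by (intro mult_left_mono) auto
    also have "\<dots> = c / 2" by (simp add: \<epsilon>_def field_simps add_nonneg_pos)
    finally show ?thesis .
  qed
  have contH: "continuous_on (- {0}) (\<lambda>y. B \<bullet> H y)"
  proof -
    have cq: "continuous_on (- {0}) ?q" by (intro continuous_intros) auto
    have qpos: "?q ` (- {0}) \<subseteq> {0<..}" by auto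
    have cf1: "continuous_on {0<..} f1"
      using f(2) by (intro continuous_at_imp_continuous_on) (auto intro: DERIV_isCont)
    show ?thesis
      unfolding H_def outer_def
      by (intro continuous_intros continuous_on_compose2[OF cf1 cq qpos] continuous_on_compose2[OF f(3) cq qpos])
  qed
  define V where "V = ((- {0}) \<inter> (\<lambda>y. B \<bullet> H y) -` {..<- c / 2}) \<inter> (\<lambda>y. norm y) -` {t1<..<t2}"
  have "open V"
    unfolding V_def
  proof (rule open_Int)
    show "open ((- {0}) \<inter> (\<lambda>y. B \<bullet> H y) -` {..<- c / 2})"
      by (rule continuous_open_preimage[OF contH]) auto
    show "open ((\<lambda>y :: real^'n. norm y) -` {t1<..<t2})"
      by (intro continuous_open_vimage) (auto intro: continuous_intros)
  qed
  moreover have "x0 \<in> V"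
    using nz x0 \<open>0 < c\<close> by (simp add: V_def c_def)
  ultimately obtain \<rho> where "0 < \<rho>" and \<rho>: "cball x0 \<rho> \<subseteq> V"
    using open_contains_cball by blast
  obtain M where M: "0 < M" "\<And>x. norm (T0 *v x) \<le> M * norm x"
    using linear_bounded_pos[OF matrix_vector_mul_linear[of T0]] by blast
  define r where "r = \<rho> / (2 * M)"
  have "0 < r" using \<open>0 < \<rho>\<close> M(1) by (simp add: r_def)
  define T where "T = r *\<^sub>R T0"
  have TT: "T ** transpose T = r\<^sup>2 *\<^sub>R B"
    by (simp add: T_def B_def scaleR_gram)
  have invT: "invertible T"
    unfolding T_def by (rule invertible_scaleR_matrix[OF T0(1)]) (use \<open>0 < r\<close> in simp)
  have Tball: "x0 + T *v z \<in> ball x0 \<rho>" if "z \<in> cball 0 1" for z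
  proof -
    have "norm (T *v z) = r * norm (T0 *v z)"
      using \<open>0 < r\<close> by (simp add: T_def scaleR_matrix_vector_assoc[symmetric])
    also have "\<dots> \<le> r * (M * 1)"
    proof (rule mult_left_mono)
      have "norm (T0 *v z) \<le> M * norm z" by (rule M(2))
      also have "\<dots> \<le> M * 1" using that M(1) by (intro mult_left_mono) auto
      finally show "norm (T0 *v z) \<le> M * 1" .
    qed (use \<open>0 < r\<close> in simp)
    also have "\<dots> = \<rho> / 2" using M(1) by (simp add: r_def)
    finally show ?thesis using \<open>0 < \<rho>\<close> by (simp add: dist_norm)
  qed
  have ball: "y \<noteq> 0" "B \<bullet> H y < - c / 2" "t1 < norm y" "norm y < t2" if "y \<in> cball x0 \<rho>" for y
    using \<rho> that by (auto simp: V_def)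
  have contT: "continuous_on S (\<lambda>z. x0 + T *v z)" for S
    by (intro continuous_intros matrix_vector_mult_linear_continuous_on)

  \<comment> \<open>By strictness \<open>p\<close> is still a supersolution; its quadratic term keeps the mean of \<open>\<phi>\<close> away from \<open>\<phi> x0\<close>.\<close>
  define p where "p y = \<phi> y + \<epsilon> * (norm (y - x0))\<^sup>2" for y
  have C2p: "C2_near p y (H y + \<epsilon> *\<^sub>R (2 *\<^sub>R mat 1))" if "y \<noteq> 0" for y
    unfolding p_def by (intro C2_near_add C2_near_cmult C2_near_quadratic C2 that)
  have contp: "continuous_on (cball x0 \<rho>) p"
  proof (rule continuous_at_imp_continuous_on, rule ballI)
    fix y assume "y \<in> cball x0 \<rho>"
    then show "isCont p y" by (intro C2_near_isCont[OF C2p] ball(1))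
  qed
  then have contmp: "continuous_on (cball x0 \<rho>) (\<lambda>y. - p y)"
    by (rule continuous_on_minus)
  have cont\<phi>: "continuous_on (cball x0 \<rho>) \<phi>"
  proof (rule continuous_at_imp_continuous_on, rule ballI)
    fix y assume "y \<in> cball x0 \<rho>"
    then show "isCont \<phi> y" by (intro C2_near_isCont[OF C2] ball(1))
  qed
  have "compact (p ` cball x0 \<rho>)"
    by (rule compact_continuous_image[OF contp]) simp
  then have "bounded (p ` cball x0 \<rho>)"
    by (rule compact_imp_bounded)
  then obtain C where C0: "\<forall>z\<in>p ` cball x0 \<rho>. norm z \<le> C"
    unfolding bounded_iff by blast
  have C: "\<bar>p y\<bar> \<le> C" if "y \<in> cball x0 \<rho>" for y
    using bspec[OF C0 imageI[OF that]] by simp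
  have viscp: "viscosity_sub (T ** transpose T) (ball x0 \<rho>) (\<lambda>y. - p y)"
  proof (rule viscosity_sub_uminus_C2)
    fix y assume "y \<in> ball x0 \<rho>"
    then have y: "y \<in> cball x0 \<rho>" by simp
    have "B \<bullet> (H y + \<epsilon> *\<^sub>R (2 *\<^sub>R mat 1)) = B \<bullet> H y + 2 * \<epsilon> * \<beta>"
      by (simp add: inner_add_right \<beta>_def)
    then have "B \<bullet> (H y + \<epsilon> *\<^sub>R (2 *\<^sub>R mat 1)) \<le> 0"
      using ball(2)[OF y] \<epsilon>\<beta> by simp
    then have "(T ** transpose T) \<bullet> (H y + \<epsilon> *\<^sub>R (2 *\<^sub>R mat 1)) \<le> 0"
      by (simp add: TT mult_le_0_iff)
    then show "\<exists>H. C2_near p y H \<and> (T ** transpose T) \<bullet> H \<le> 0"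
      using C2p[OF ball(1)[OF y]] by blast
  qed
  have "- p x0 \<le> sphere_mean (\<lambda>z. - p (x0 + T *v z))"
  proof (rule viscosity_sub_le_sphere_mean[OF n viscp _ invT Tball])
    show "real_usc (ball x0 \<rho>) (\<lambda>y. - p y)"
      by (rule real_usc_subset[OF real_usc_continuous[OF contmp]]) auto
    show "- C \<le> - p y" if "y \<in> ball x0 \<rho>" for y
      using C[of y] that by (simp add: abs_le_iff)
  qed
  then have pm: "sphere_mean (\<lambda>z. p (x0 + T *v z)) \<le> \<phi> x0"
    by (simp add: sphere_mean_uminus) (simp add: p_def)
  obtain \<kappa> where \<kappa>: "0 < \<kappa>" "\<And>z. norm z = 1 \<Longrightarrow> \<kappa> \<le> norm (T *v z)"
    by (rule invertible_norm_lower_bound[OF invT]) blast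
  have Tcball: "(\<lambda>z. x0 + T *v z) ` sphere 0 1 \<subseteq> cball x0 \<rho>"
  proof (rule image_subsetI)
    fix z :: "real^'n" assume "z \<in> sphere 0 1"
    then have "x0 + T *v z \<in> ball x0 \<rho>" by (intro Tball) simp
    then show "x0 + T *v z \<in> cball x0 \<rho>" by simp
  qed
  have bd\<phi>: "sphere_bounded (\<lambda>z. \<phi> (x0 + T *v z))"
    by (intro continuous_on_imp_sphere_bounded continuous_on_compose2[OF cont\<phi> contT Tcball])
  have bdp: "sphere_bounded (\<lambda>z. p (x0 + T *v z))"
    by (intro continuous_on_imp_sphere_bounded continuous_on_compose2[OF contp contT Tcball])
  have "sphere_mean (\<lambda>z. \<phi> (x0 + T *v z)) + \<epsilon> * \<kappa>\<^sup>2 = sphere_mean (\<lambda>z. \<phi> (x0 + T *v z) + \<epsilon> * \<kappa>\<^sup>2)"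
    by (subst sphere_mean_add[OF bd\<phi>]) auto
  also have "\<dots> \<le> sphere_mean (\<lambda>z. p (x0 + T *v z))"
  proof (rule sphere_mean_mono[OF _ bdp])
    show "sphere_bounded (\<lambda>z. \<phi> (x0 + T *v z) + \<epsilon> * \<kappa>\<^sup>2)"
      by (intro sphere_bounded_add bd\<phi> sphere_bounded_const)
    show "\<phi> (x0 + T *v z) + \<epsilon> * \<kappa>\<^sup>2 \<le> p (x0 + T *v z)" if "z \<in> sphere 0 1" for z
      using \<kappa>(1) \<kappa>(2)[of z] that \<open>0 < \<epsilon>\<close> by (simp add: p_def power_mono)
  qed
  finally have \<phi>m: "sphere_mean (\<lambda>z. \<phi> (x0 + T *v z)) + \<epsilon> * \<kappa>\<^sup>2 \<le> \<phi> x0"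
    using pm by simp

  \<comment> \<open>Invariance of \<open>F\<close> under \<open>G\<close> turns the inequality for \<open>w\<close> at \<open>g *v x0\<close> into one at \<open>x0\<close> with the same \<open>T\<close>, so that the inequalities can be added.\<close>
  have TX: "x0 + T *v z \<in> X" if "z \<in> cball 0 1" for z
  proof -
    have "x0 + T *v z \<in> cball x0 \<rho>" using Tball[OF that] by simp
    then show ?thesis by (intro X(1) ball(3,4))
  qed
  have wm: "w (g *v x0) \<le> sphere_mean (\<lambda>z. w (g *v (x0 + T *v z)))" "sphere_bounded (\<lambda>z. w (g *v (x0 + T *v z)))"
    if g: "g \<in> G" for g
  proof -
    have inX: "g *v x0 + (g ** T) *v z \<in> X" if "z \<in> cball 0 1" for z
      using X(2)[OF g TX[OF that]] by (simp add: matrix_vector_right_distrib matrix_vector_mul_assoc)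
    have inv: "invertible (g ** T)"
    proof -
      have "invertible g"
        using orthogonal[OF g] unfolding invertible_def orthogonal_matrix_def by blast
      then show ?thesis using invT by (rule invertible_mult)
    qed
    have "0 \<le> ((g ** T) ** transpose (g ** T)) \<bullet> A" if "A \<in> F" for A
    proof -
      have gA: "transpose g ** A ** g \<in> F"
        using invariant[OF transpose_closed[OF g] that] by (simp add: transpose_transpose)
      have "((g ** T) ** transpose (g ** T)) \<bullet> A = trace (transpose T ** (transpose g ** A ** g) ** T)"
        unfolding inner_gram_trace by (simp add: matrix_transpose_mul matrix_mul_assoc)
      also have "\<dots> = (T ** transpose T) \<bullet> (transpose g ** A ** g)"
        by (simp add: inner_gram_trace)
      also have "\<dots> = r\<^sup>2 * (B \<bullet> (transpose g ** A ** g))"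
        by (simp add: TT)
      finally show ?thesis
        using T0(2) gA by (simp add: B_def)
    qed
    then have "viscosity_sub ((g ** T) ** transpose (g ** T)) X w"
      using w(1) unfolding cone_viscosity_sub_def by blast
    from viscosity_sub_le_sphere_mean[OF n this w(2) inv inX w(3)]
    show "w (g *v x0) \<le> sphere_mean (\<lambda>z. w (g *v (x0 + T *v z)))"
      by (simp add: matrix_vector_right_distrib matrix_vector_mul_assoc)
    show "sphere_bounded (\<lambda>z. w (g *v (x0 + T *v z)))"
    proof (rule real_usc_sphere_bounded)
      have "(\<lambda>z. g *v (x0 + T *v z)) ` sphere 0 1 \<subseteq> X"
      proof (rule image_subsetI)
        fix z :: "real^'n" assume "z \<in> sphere 0 1"
        then show "g *v (x0 + T *v z) \<in> X" by (intro X(2)[OF g] TX) simp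
      qed
      moreover have "continuous_on (sphere 0 1) (\<lambda>z. g *v (x0 + T *v z))"
        by (intro continuous_on_compose2[OF matrix_vector_mult_linear_continuous_on contT]) auto
      ultimately show "real_usc (sphere 0 1) (\<lambda>z. w (g *v (x0 + T *v z)))"
        by (intro real_usc_compose[OF w(2)])
      show "m \<le> w (g *v (x0 + T *v z))" if "z \<in> sphere 0 1" for z
        by (intro w(3) X(2)[OF g] TX) (use that in simp)
    qed
  qed
  have bdL: "\<And>g. g \<in> set L \<Longrightarrow> sphere_bounded (\<lambda>z. w (g *v (x0 + T *v z)))"
    using wm(2) L(2) by blast
  have "group_average L w x0 \<le> (\<Sum>g\<leftarrow>L. sphere_mean (\<lambda>z. w (g *v (x0 + T *v z)))) / real (length L)"
    unfolding group_average_def using wm(1) L(2) by (intro divide_right_mono sum_list_mono) auto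
  also have "\<dots> = sphere_mean (\<lambda>z. group_average L w (x0 + T *v z))"
    by (rule sphere_mean_group_average_compose(2)[OF bdL, symmetric])
  also have "\<dots> \<le> sphere_mean (\<lambda>z. \<phi> (x0 + T *v z) + (group_average L w x0 - \<phi> x0))"
  proof (rule sphere_mean_mono[OF sphere_mean_group_average_compose(1)[OF bdL]])
    show "sphere_bounded (\<lambda>z. \<phi> (x0 + T *v z) + (group_average L w x0 - \<phi> x0))"
      by (intro sphere_bounded_add bd\<phi> sphere_bounded_const)
    show "group_average L w (x0 + T *v z) \<le> \<phi> (x0 + T *v z) + (group_average L w x0 - \<phi> x0)" if "z \<in> sphere 0 1" for z
    proof -
      have "x0 + T *v z \<in> cball x0 \<rho>" using Tcball that by blast
      from max[OF ball(3,4)[OF this]] show ?thesis by (simp add: \<phi>_def)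
    qed
  qed
  also have "\<dots> = sphere_mean (\<lambda>z. \<phi> (x0 + T *v z)) + (group_average L w x0 - \<phi> x0)"
    by (subst sphere_mean_add[OF bd\<phi>]) auto
  finally have "\<epsilon> * \<kappa>\<^sup>2 \<le> 0" using \<phi>m by simp
  then show False using \<open>0 < \<epsilon>\<close> \<kappa>(1) by (simp add: mult_le_0_iff)
qed

text \<open>Perturbing the profile to a strict supersolution that is still increasing moves its
  Hessian out of \<open>F\<close>, which excludes an interior maximum of the difference.\<close>

lemma radial_barrier_above:
  assumes n: "CARD('n) \<ge> 2" and t: "0 < t1" "t1 < t2"
    and k: "\<And>s. 0 < s \<Longrightarrow> (k has_real_derivative k1 s) (at s)"
      "\<And>s. 0 < s \<Longrightarrow> (k1 has_real_derivative k2 s) (at s)" "continuous_on {0<..} k2"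
      "\<And>s. 0 < s \<Longrightarrow> 0 \<le> k1 s" "\<And>s. 0 < s \<Longrightarrow> k1 s * riesz_char + 2 * s * k2 s = 0"
    and w: "cone_viscosity_sub F X w" "real_usc X w" "\<And>x. x \<in> X \<Longrightarrow> m \<le> w x"
    and X: "\<And>x. t1 \<le> norm x \<Longrightarrow> norm x \<le> t2 \<Longrightarrow> x \<in> X" "\<And>g x. g \<in> G \<Longrightarrow> x \<in> X \<Longrightarrow> g *v x \<in> X"
    and L: "L \<noteq> []" "set L \<subseteq> G"
    and bd: "\<And>x. norm x = t1 \<Longrightarrow> group_average L w x \<le> k (t1\<^sup>2 / 2)" "\<And>x. norm x = t2 \<Longrightarrow> group_average L w x \<le> k (t2\<^sup>2 / 2)"
    and x: "t1 \<le> norm x" "norm (x :: real^'n) \<le> t2"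
  shows "group_average L w x \<le> k ((norm x)\<^sup>2 / 2)"
proof (rule field_le_epsilon)
  fix e :: real assume "0 < e"
  let ?q = "\<lambda>x :: real^'n. (norm x)\<^sup>2 / 2"
  \<comment> \<open>The profile is made a strict supersolution by subtracting a multiple of \<open>s powr (- N)\<close>. This keeps
    it increasing, and it is strict because the characteristic is at most \<open>N\<close>, hence below \<open>2 * N + 2\<close>.\<close>
  define N where "N = real CARD('n)"
  have N: "0 < N" by (simp add: N_def)
  define q1 where "q1 = t1\<^sup>2 / 2"
  have "0 < q1" using t by (simp add: q1_def)
  define d where "d = e / q1 powr (- N)"
  have "0 < d" using \<open>0 < e\<close> \<open>0 < q1\<close> by (simp add: d_def)
  let ?S = "{x :: real^'n. t1 \<le> norm x \<and> norm x \<le> t2}"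
  define f where "f s = k s + d * (q1 powr (- N) - s powr (- N))" for s
  define f1 where "f1 s = k1 s + d * (N * s powr (- N - 1))" for s
  define f2 where "f2 s = k2 s + d * (N * ((- N - 1) * s powr (- N - 1 - 1)))" for s
  have pw: "((\<lambda>s. s powr a) has_real_derivative a * s powr (a - 1)) (at s)" if "0 < s" for a s :: real
    using that by (rule has_real_derivative_powr)
  have f: "\<And>s. 0 < s \<Longrightarrow> (f has_real_derivative f1 s) (at s)"
      "\<And>s. 0 < s \<Longrightarrow> (f1 has_real_derivative f2 s) (at s)"
    unfolding f_def f1_def f2_def
    by (auto intro!: derivative_eq_intros k(1,2) pw)
  have f2: "continuous_on {0<..} f2"
    unfolding f2_def by (intro continuous_intros k(3)) auto
  have f1pos: "0 < f1 s" if "0 < s" for s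
    unfolding f1_def using k(4)[OF that] \<open>0 < d\<close> N that by (intro add_nonneg_pos) auto
  have fneg: "f1 s * riesz_char + 2 * s * f2 s < 0" if s: "0 < s" for s
  proof -
    have "1 + (- N - 1 - 1) = - N - 1" by simp
    then have "s * s powr (- N - 1 - 1) = s powr (- N - 1)"
      using s powr_mult_base[of s "- N - 1 - 1"] by (simp only: less_imp_le)
    moreover have "2 * s * (d * (N * ((- N - 1) * Y))) = - (2 * N + 2) * (d * N * (s * Y))" for Y
      by (simp add: algebra_simps)
    ultimately have "2 * s * (d * (N * ((- N - 1) * s powr (- N - 1 - 1)))) = - (2 * N + 2) * (d * N * s powr (- N - 1))"
      by (simp only:)
    then have "f1 s * riesz_char + 2 * s * f2 s = (riesz_char - (2 * N + 2)) * (d * N * s powr (- N - 1))"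
      using k(5)[OF s] by (simp add: f1_def f2_def algebra_simps)
    moreover have "riesz_char - (2 * N + 2) < 0"
      using riesz_char_le N by (simp add: N_def)
    moreover have "0 < d * N * s powr (- N - 1)"
      using \<open>0 < d\<close> N s by simp
    ultimately show ?thesis by (simp add: mult_neg_pos)
  qed
  define g where "g y = group_average L w y - f (?q y)" for y
  have qpos: "0 < ?q y" if "t1 \<le> norm y" for y
  proof -
    have "0 < norm y" using that t by linarith
    then show ?thesis by simp
  qed
  have qge: "q1 \<le> ?q y" if "t1 \<le> norm y" for y
    using that t by (simp add: q1_def power_mono)
  have f_ge: "k (?q y) \<le> f (?q y)" if "t1 \<le> norm y" for y
  proof -
    have "(?q y) powr (- N) \<le> q1 powr (- N)"
      using qge[OF that] \<open>0 < q1\<close> N by (intro powr_mono2') auto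
    then show ?thesis using \<open>0 < d\<close> by (simp add: f_def)
  qed
  have contf: "continuous_on ?S (\<lambda>y. f (?q y))"
  proof -
    have "continuous_on {0<..} f"
      using f(1) by (intro continuous_at_imp_continuous_on) (auto intro: DERIV_isCont)
    moreover have "?q ` ?S \<subseteq> {0<..}" using qpos by auto
    moreover have "continuous_on ?S ?q" by (intro continuous_intros) auto
    ultimately show ?thesis
      using continuous_on_compose2[of "{0<..}" f ?S ?q] by blast
  qed
  have "real_usc X (group_average L w)"
    by (rule real_usc_group_average[OF w(2) L(1)]) (use L(2) X(2) in auto)
  then have "real_usc ?S (group_average L w)"
    by (rule real_usc_subset) (use X(1) in auto)
  then have "real_usc ?S g"
    unfolding g_def by (rule real_usc_diff_continuous[OF _ contf])
  moreover have "compact ?S"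
  proof -
    have "?S = cball 0 t2 - ball 0 t1" by auto
    then show ?thesis by (simp add: compact_diff)
  qed
  ultimately obtain x0 where x0: "x0 \<in> ?S" "\<And>y. y \<in> ?S \<Longrightarrow> g y \<le> g x0"
    using x by (elim real_usc_attains_sup) auto
  have "g x0 \<le> 0"
  proof (rule ccontr)
    assume pos: "\<not> g x0 \<le> 0"
    have "norm x0 \<noteq> t1"
      using pos bd(1)[of x0] f_ge[of x0] by (auto simp: g_def)
    moreover have "norm x0 \<noteq> t2"
      using pos bd(2)[of x0] f_ge[of x0] t by (auto simp: g_def)
    ultimately have int: "t1 < norm x0" "norm x0 < t2" using x0(1) by auto
    have q0: "0 < ?q x0" using qpos int by simp
    show False
    proof (rule no_interior_max[OF n t(1) f f2 w _ X(2) L int])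
      show "x \<in> X" if "t1 < norm x" "norm x < t2" for x
        using that by (intro X(1)) auto
      show "0 < f1 (?q x0)" by (rule f1pos[OF q0])
      show "f1 (?q x0) * riesz_char + (norm x0)\<^sup>2 * f2 (?q x0) < 0"
        using fneg[OF q0] by simp
      show "group_average L w x - f (?q x) \<le> group_average L w x0 - f (?q x0)" if "t1 < norm x" "norm x < t2" for x
        using x0(2)[of x] that by (simp add: g_def)
    qed
  qed
  then have "g x \<le> 0" using x0(2)[of x] x by simp
  then have "group_average L w x \<le> k (?q x) + d * (q1 powr (- N) - ?q x powr (- N))"
    by (simp add: g_def f_def)
  also have "d * (q1 powr (- N) - ?q x powr (- N)) \<le> d * q1 powr (- N)"
    using \<open>0 < d\<close> by (intro mult_left_mono) auto
  also have "\<dots> = e" using \<open>0 < q1\<close> by (simp add: d_def)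
  finally show "group_average L w x \<le> k (?q x) + e" by simp
qed

end

section \<open>Maximality\<close>

lemma usc_on_max:
  assumes "usc_on X u" "usc_on X v"
  shows "usc_on X (\<lambda>x. max (u x) (v x))"
  unfolding usc_on_def
proof (intro ballI allI impI)
  fix x c assume x: "x \<in> X" "max (u x) (v x) < c"
  then have "\<forall>\<^sub>F y in at x within X. u y < c" "\<forall>\<^sub>F y in at x within X. v y < c"
    using assms unfolding usc_on_def max_less_iff_conj by blast+
  then show "\<forall>\<^sub>F y in at x within X. max (u y) (v y) < c"
    by eventually_elim simp
qed

lemma group_average_mono:
  assumes "\<And>g. g \<in> set L \<Longrightarrow> f (g *v x) \<le> h (g *v y)"
  shows "group_average L f x \<le> group_average L h y"
  unfolding group_average_def using assms by (intro divide_right_mono sum_list_mono) auto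

lemma sphere_mean_AE_le:
  fixes f :: "real^'n \<Rightarrow> real"
  assumes "sphere_bounded f" "AE \<sigma> in sphere_measure. f \<sigma> \<le> c"
  shows "sphere_mean f \<le> c"
proof -
  let ?m = "measure (sphere_measure :: (real^'n) measure) (sphere 0 1)"
  have "(LINT \<sigma>|sphere_measure. f \<sigma>) \<le> (LINT \<sigma>|(sphere_measure :: (real^'n) measure). c)"
    using assms by (intro integral_mono_AE sphere_bounded_integrable) auto
  also have "\<dots> = c * ?m" by simp
  finally show ?thesis
    using sphere_area_pos[where 'n = 'n] by (simp add: sphere_mean_def divide_le_eq)
qed

lemma sphere_slice_sets:
  fixes D :: "(real^'n) set"
  assumes "D \<in> sets borel"
  shows "{\<sigma>\<in>sphere 0 1. c + t *\<^sub>R \<sigma> \<in> D} \<in> sets sphere_measure"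
proof -
  have "(\<lambda>\<sigma>. c + t *\<^sub>R \<sigma>) -` D \<inter> space borel \<in> sets borel"
    by (rule measurable_sets[OF _ assms]) measurable
  then have "sphere 0 1 \<inter> ((\<lambda>\<sigma>. c + t *\<^sub>R \<sigma>) -` D \<inter> space borel) \<in> sets borel"
    by (intro sets.Int) auto
  moreover have "sphere 0 1 \<inter> ((\<lambda>\<sigma>. c + t *\<^sub>R \<sigma>) -` D \<inter> space borel) = {\<sigma>\<in>sphere 0 1. c + t *\<^sub>R \<sigma> \<in> D}"
    by auto
  ultimately show ?thesis
    by (auto simp: sets_sphere_measure sets_restrict_space_iff)
qed

context transitive_cone_subequation
begin

text \<open>The means of \<open>w\<close> do not exceed \<open>\<psi>\<close>. The profile
  \<open>k\<close> through the values of \<open>\<psi>\<close> at \<open>t1\<close> and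
  \<open>t2\<close> lies below \<open>\<psi>\<close> because \<open>\<psi>\<close> is a
  supersolution. Up to \<open>d\<close> it lies above a suitable average of truncations of
  \<open>w\<close> over \<open>G\<close>, because this average is almost bounded by
  \<open>\<psi>\<close> on the two boundary spheres; and averaging over \<open>G\<close> does not
  change spherical means.\<close>

lemma spherical_mean_le:
  fixes U v :: "real^'n \<Rightarrow> ereal"
  defines "w \<equiv> \<lambda>x. max (v x) (U x)"
  assumes n: "CARD('n) \<ge> 2" and a: "0 \<le> a"
    and U: "F_subharmonic F (annulus a b) U" and v: "F_subharmonic F (annulus a b) v"
    and harm: "F_harmonic F (annulus a b) (\<lambda>x. spherical_average U (norm x))"
    and mono: "mono_on {t. a < t \<and> ereal t < b} (spherical_average U)"
    and \<psi>: "\<And>t. a < t \<Longrightarrow> ereal t < b \<Longrightarrow> spherical_average U t = ereal (\<psi> t)"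
    and t: "a < t1" "t1 < t2" "ereal t2 < b"
    and vU: "\<And>x. norm x = t1 \<or> norm x = t2 \<Longrightarrow> v x \<le> U x"
    and t12: "t1 \<le> t" "t \<le> t2" and "0 < d"
  shows "\<exists>N0. \<forall>N\<ge>N0. sphere_mean (\<lambda>\<sigma>. truncation w N (t *\<^sub>R \<sigma>)) \<le> \<psi> t + d"
proof -
  let ?X = "annulus a b :: (real^'n) set"
  have t0: "0 < t1" using a t by simp
  have inb: "ereal s < b" if "s \<le> t2" for s
    using that t(3) by (metis ereal_less_eq(3) le_less_trans)
  have Xs: "x \<in> ?X" if "t1 \<le> norm x" "norm x \<le> t2" for x
    using that t inb by (auto simp: annulus_def)
  have XG: "g *v x \<in> ?X" if "g \<in> G" "x \<in> ?X" for g x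
    using that by (simp add: annulus_def)
  note op = F_subharmonic_open[OF U]
  have scale: "s *\<^sub>R \<sigma> \<in> ?X" if "\<sigma> \<in> sphere 0 1" "t1 \<le> s" "s \<le> t2" for s \<sigma>
    using that t0 by (intro Xs) auto
  have wusc: "usc_on ?X w"
    unfolding w_def by (rule usc_on_max[OF F_subharmonic_usc[OF v] F_subharmonic_usc[OF U]])
  have wfin: "w x < \<infinity>" if "x \<in> ?X" for x
    unfolding w_def max_less_iff_conj
    using F_subharmonic_less_top[OF v that] F_subharmonic_less_top[OF U that] by (rule conjI)
  have cs: "continuous_on S (\<lambda>\<sigma> :: real^'n. s *\<^sub>R \<sigma>)" for S s
    by (intro continuous_intros)
  have bdU: "sphere_bounded (\<lambda>\<sigma>. truncation U N (s *\<^sub>R \<sigma>))" if "t1 \<le> s" "s \<le> t2" for s N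
    by (rule sphere_bounded_truncation[OF F_subharmonic_usc[OF U] op F_subharmonic_less_top[OF U] cs scale])
      (use that in auto)
  have bdw: "sphere_bounded (\<lambda>\<sigma>. truncation w N (s *\<^sub>R \<sigma>))" if "t1 \<le> s" "s \<le> t2" for s N
    by (rule sphere_bounded_truncation[OF wusc op wfin cs scale]) (use that in auto)

  have "ereal (\<psi> t1) \<le> ereal (\<psi> t2)"
    using mono_onD[OF mono, of t1 t2] t inb[of t1] \<psi>[of t1] \<psi>[of t2] by simp
  then have "\<psi> t1 \<le> \<psi> t2" by simp
  moreover have "0 < t1\<^sup>2 / 2" "t1\<^sup>2 / 2 < t2\<^sup>2 / 2"
    using t0 t by (simp_all add: power_strict_mono)
  ultimately obtain k k1 k2 where k: "\<And>s. 0 < s \<Longrightarrow> (k has_real_derivative k1 s) (at s)"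
      "\<And>s. 0 < s \<Longrightarrow> (k1 has_real_derivative k2 s) (at s)" "continuous_on {0<..} k2"
      "\<And>s. 0 < s \<Longrightarrow> 0 \<le> k1 s" "\<And>s. 0 < s \<Longrightarrow> k1 s * riesz_char + 2 * s * k2 s = 0"
      "k (t1\<^sup>2 / 2) = \<psi> t1" "k (t2\<^sup>2 / 2) = \<psi> t2"
    using radial_profile[of "t1\<^sup>2 / 2" "t2\<^sup>2 / 2" "\<psi> t1" "\<psi> t2" riesz_char] by blast
  have dual: "F_subharmonic (dual_subequation F) ?X (\<lambda>x. - spherical_average U (norm x))"
    using harm unfolding F_harmonic_def by (rule conjunct2)
  have \<psi>X: "spherical_average U (norm x) = ereal (\<psi> (norm x))" if "x \<in> ?X" for x
    using that by (intro \<psi>) (auto simp: annulus_def)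
  have below: "k ((norm x)\<^sup>2 / 2) \<le> \<psi> (norm x)" if x: "t1 \<le> norm x" "norm x \<le> t2" for x :: "real^'n"
  proof (rule radial_barrier_below[OF t0 t(2) k(1-5) _ _ _ _ x])
    have "real_usc ?X (\<lambda>x. - \<psi> (norm x))"
      unfolding real_usc_def
    proof
      fix c
      have "{x \<in> ?X. - \<psi> (norm x) < c} = {x \<in> ?X. - spherical_average U (norm x) < ereal c}"
        using \<psi>X by auto
      then show "openin (top_of_set ?X) {x \<in> ?X. - \<psi> (norm x) < c}"
        using usc_on_open_less[OF F_subharmonic_usc[OF dual] op, of "ereal c"] op
        by (simp add: openin_open_eq)
    qed
    then show "real_usc {x. t1 \<le> norm x \<and> norm x \<le> t2} (\<lambda>x :: real^'n. - \<psi> (norm x))"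
      by (rule real_usc_subset) (use Xs in auto)
  next
    fix x :: "real^'n" and \<phi> H
    assume x: "t1 < norm x" "norm x < t2" and \<phi>: "C2_near \<phi> x H"
      and le: "\<forall>\<^sub>F y in nhds x. \<phi> y \<le> \<psi> (norm y)" and eq: "\<phi> x = \<psi> (norm x)"
    have xX: "x \<in> ?X" using x by (intro Xs) auto
    have "- H \<in> dual_subequation F"
    proof (rule F_subharmonic_test[OF dual xX C2_near_uminus[OF \<phi>]])
      show "\<forall>\<^sub>F y in nhds x. - spherical_average U (norm y) \<le> ereal (- \<phi> y)"
        using le eventually_nhds_in_open[OF op xX] by eventually_elim (simp add: \<psi>X)
      show "- spherical_average U (norm x) = ereal (- \<phi> x)"
        using eq \<psi>X[OF xX] by simp
    qed
    then show "H \<notin> (top_of_set Sym2) interior_of F"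
      by (simp add: dual_subequation_def)
  qed (simp_all add: k)

  have d3: "0 < d / 3" using \<open>0 < d\<close> by simp
  have "\<exists>N0. \<forall>N\<ge>N0. sphere_mean (\<lambda>\<sigma>. truncation U N (s *\<^sub>R \<sigma>)) \<le> \<psi> s + d / 3" if s: "t1 \<le> s" "s \<le> t2" for s
    by (rule spherical_average_truncation(2)[OF \<psi> bdU _ d3])
      (use s t inb F_subharmonic_less_top[OF U scale] in auto)
  then obtain N1 N2 where N1: "\<And>N. N1 \<le> N \<Longrightarrow> sphere_mean (\<lambda>\<sigma>. truncation U N (t1 *\<^sub>R \<sigma>)) \<le> \<psi> t1 + d / 3"
    and N2: "\<And>N. N2 \<le> N \<Longrightarrow> sphere_mean (\<lambda>\<sigma>. truncation U N (t2 *\<^sub>R \<sigma>)) \<le> \<psi> t2 + d / 3"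
    using t(2) by (meson less_imp_le order_refl)
  have "sphere_mean (\<lambda>\<sigma>. truncation w N (t *\<^sub>R \<sigma>)) \<le> \<psi> t + d" if N: "max N1 N2 \<le> N" for N
  proof -
    have approx: "\<exists>h. continuous_on (sphere 0 1) h \<and> (\<forall>\<sigma>\<in>sphere 0 1. truncation U N (s *\<^sub>R \<sigma>) \<le> h \<sigma>) \<and>
        sphere_mean h \<le> sphere_mean (\<lambda>\<sigma>. truncation U N (s *\<^sub>R \<sigma>)) + d / 3" if s: "t1 \<le> s" "s \<le> t2" for s
    proof (rule real_usc_continuous_approx[OF _ _ d3])
      show "real_usc (sphere 0 1) (\<lambda>\<sigma>. truncation U N (s *\<^sub>R \<sigma>))"
      proof (rule real_usc_compose[OF _ cs])
        show "real_usc ?X (truncation U N)"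
          by (rule real_usc_truncation[OF F_subharmonic_usc[OF U] op]) (rule F_subharmonic_less_top[OF U])
        show "(\<lambda>\<sigma>. s *\<^sub>R \<sigma>) ` sphere 0 1 \<subseteq> ?X"
          by (rule image_subsetI) (rule scale[OF _ s])
      qed
      show "- real N \<le> truncation U N (s *\<^sub>R \<sigma>)" if "\<sigma> \<in> sphere 0 1" for \<sigma>
        by (rule truncation_ge, rule F_subharmonic_less_top[OF U], rule scale[OF that s])
    qed
    obtain h1 where h1: "continuous_on (sphere 0 1) h1" "\<forall>\<sigma>\<in>sphere 0 1. truncation U N (t1 *\<^sub>R \<sigma>) \<le> h1 \<sigma>"
      "sphere_mean h1 \<le> sphere_mean (\<lambda>\<sigma>. truncation U N (t1 *\<^sub>R \<sigma>)) + d / 3"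
      using approx[of t1] t(2) by auto
    obtain h2 where h2: "continuous_on (sphere 0 1) h2" "\<forall>\<sigma>\<in>sphere 0 1. truncation U N (t2 *\<^sub>R \<sigma>) \<le> h2 \<sigma>"
      "sphere_mean h2 \<le> sphere_mean (\<lambda>\<sigma>. truncation U N (t2 *\<^sub>R \<sigma>)) + d / 3"
      using approx[of t2] t(2) by auto
    obtain L where L: "L \<noteq> []" "set L \<subseteq> G"
      "\<forall>x\<in>sphere 0 1. group_average L h1 x \<le> sphere_mean h1 + d / 3 \<and> group_average L h2 x \<le> sphere_mean h2 + d / 3"
      using group_average_le_sphere_mean2[OF h1(1) h2(1) d3] by blast
    have bdry: "group_average L (truncation w N) x \<le> group_average L h (x /\<^sub>R s)"
      if s: "s = t1 \<or> s = t2" and x: "norm x = s" and h: "\<forall>\<sigma>\<in>sphere 0 1. truncation U N (s *\<^sub>R \<sigma>) \<le> h \<sigma>" for s x h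
    proof (rule group_average_mono)
      fix g assume "g \<in> set L"
      then have g: "g \<in> G" using L(2) by blast
      have "0 < s" using s t0 t by auto
      have "w (g *v x) = U (g *v x)"
        unfolding w_def using vU[of "g *v x"] g x s by (simp add: max_absorb2)
      then have "truncation w N (g *v x) = truncation U N (g *v x)"
        by (simp add: truncation_def)
      also have "\<dots> \<le> h (g *v (x /\<^sub>R s))"
      proof -
        have gx: "s *\<^sub>R (g *v (x /\<^sub>R s)) = g *v x"
          using \<open>0 < s\<close> by (simp add: matrix_vector_mult_scaleR)
        have "truncation U N (s *\<^sub>R (g *v (x /\<^sub>R s))) \<le> h (g *v (x /\<^sub>R s))"
          by (rule bspec[OF h]) (use g x \<open>0 < s\<close> in simp)
        then show ?thesis by (simp only: gx)
      qed
      finally show "truncation w N (g *v x) \<le> h (g *v (x /\<^sub>R s))" .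
    qed
    have above: "group_average L (truncation w N) x \<le> k ((norm x)\<^sup>2 / 2) + d" if x: "t1 \<le> norm x" "norm x \<le> t2" for x
    proof (rule radial_barrier_above[where k = "\<lambda>s. k s + d", OF n t0 t(2) _ k(2-5) _ _ _ Xs XG L(1,2) _ _ x])
      show "((\<lambda>s. k s + d) has_real_derivative k1 s) (at s)" if "0 < s" for s
        using k(1)[OF that] by (auto intro!: derivative_eq_intros)
      show "cone_viscosity_sub F ?X (truncation w N)"
        unfolding w_def by (rule cone_viscosity_sub_truncation_max[OF v U])
      show "real_usc ?X (truncation w N)"
        by (rule real_usc_truncation[OF wusc op]) (rule wfin)
      show "- real N \<le> truncation w N x" if "x \<in> ?X" for x
        by (rule truncation_ge) (rule wfin[OF that])
      show "group_average L (truncation w N) x \<le> k (t1\<^sup>2 / 2) + d" if x: "norm x = t1" for x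
      proof -
        have "x /\<^sub>R t1 \<in> sphere 0 1" using x t0 by simp
        then have "group_average L h1 (x /\<^sub>R t1) \<le> sphere_mean h1 + d / 3" using L(3) by blast
        moreover have "sphere_mean h1 \<le> \<psi> t1 + d / 3 + d / 3"
          using h1(3) N1[of N] N by simp
        ultimately show ?thesis
          using bdry[OF disjI1[OF refl] x h1(2)] by (simp add: k(6))
      qed
      show "group_average L (truncation w N) x \<le> k (t2\<^sup>2 / 2) + d" if x: "norm x = t2" for x
      proof -
        have "x /\<^sub>R t2 \<in> sphere 0 1" using x t0 t by simp
        then have "group_average L h2 (x /\<^sub>R t2) \<le> sphere_mean h2 + d / 3" using L(3) by blast
        moreover have "sphere_mean h2 \<le> \<psi> t2 + d / 3 + d / 3"
          using h2(3) N2[of N] N by simp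
        ultimately show ?thesis
          using bdry[OF disjI2[OF refl] x h2(2)] by (simp add: k(7))
      qed
    qed
    note bdt = bdw[OF t12, of N]
    have "sphere_mean (\<lambda>\<sigma>. truncation w N (t *\<^sub>R \<sigma>)) = sphere_mean (group_average L (\<lambda>\<sigma>. truncation w N (t *\<^sub>R \<sigma>)))"
      by (rule sphere_mean_group_average[OF bdt L(2,1), symmetric])
    also have "\<dots> \<le> sphere_mean (\<lambda>\<sigma> :: real^'n. \<psi> t + d)"
    proof (rule sphere_mean_mono[OF group_average_sphere_bounded[OF bdt L(2)] sphere_bounded_const])
      fix \<sigma> :: "real^'n" assume \<sigma>: "\<sigma> \<in> sphere 0 1"
      have nt: "norm (t *\<^sub>R \<sigma>) = t" using \<sigma> t0 t12 by simp
      have "group_average L (\<lambda>\<sigma>. truncation w N (t *\<^sub>R \<sigma>)) \<sigma> = group_average L (truncation w N) (t *\<^sub>R \<sigma>)"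
        by (simp add: group_average_def matrix_vector_mult_scaleR)
      also have "\<dots> \<le> k (t\<^sup>2 / 2) + d"
        using above[of "t *\<^sub>R \<sigma>"] t12 nt by simp
      also have "\<dots> \<le> \<psi> t + d"
        using below[of "t *\<^sub>R \<sigma>"] t12 nt by simp
      finally show "group_average L (\<lambda>\<sigma>. truncation w N (t *\<^sub>R \<sigma>)) \<sigma> \<le> \<psi> t + d" .
    qed
    finally show ?thesis by simp
  qed
  then show ?thesis by blast
qed

text \<open>As \<open>U \<le> w\<close> and the means of \<open>w\<close> do not exceed those of
  \<open>U\<close>, the two functions are separated by a gap \<open>[c1, c2]\<close> only on a null
  subset of each sphere.\<close>

lemma excess_null_on_spheres:
  fixes U v :: "real^'n \<Rightarrow> ereal"
  defines "w \<equiv> \<lambda>x. max (v x) (U x)"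
  assumes n: "CARD('n) \<ge> 2" and a: "0 \<le> a"
    and U: "F_subharmonic F (annulus a b) U" and v: "F_subharmonic F (annulus a b) v"
    and harm: "F_harmonic F (annulus a b) (\<lambda>x. spherical_average U (norm x))"
    and mono: "mono_on {t. a < t \<and> ereal t < b} (spherical_average U)"
    and t: "a < t1" "t1 < t2" "ereal t2 < b"
    and vU: "\<And>x. norm x = t1 \<or> norm x = t2 \<Longrightarrow> v x \<le> U x"
    and t12: "t1 \<le> t" "t \<le> t2" and c: "c1 < c2"
  shows "{\<sigma>\<in>sphere 0 1. ereal c2 \<le> w (t *\<^sub>R \<sigma>) \<and> U (t *\<^sub>R \<sigma>) < ereal c1} \<in> null_sets sphere_measure"
proof -
  let ?X = "annulus a b :: (real^'n) set"
  have t0: "0 < t1" using a t by simp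
  have inb: "ereal s < b" if "s \<le> t2" for s
    using that t(3) by (metis ereal_less_eq(3) le_less_trans)
  note op = F_subharmonic_open[OF U]
  have scale: "t *\<^sub>R \<sigma> \<in> ?X" if "\<sigma> \<in> sphere 0 1" for \<sigma>
    using that t0 t t12 inb[of t] by (auto simp: annulus_def)
  define \<psi> where "\<psi> s = real_of_ereal (spherical_average U s)" for s
  have \<psi>: "spherical_average U s = ereal (\<psi> s)" if s: "a < s" "ereal s < b" for s
  proof -
    obtain x :: "real^'n" where x: "norm x = s"
      using vector_choose_size[of s] s a by auto
    then have xX: "x \<in> ?X" using s by (simp add: annulus_def)
    have "spherical_average U (norm x) < \<infinity>" "- spherical_average U (norm x) < \<infinity>"
      using harm F_subharmonic_less_top[OF _ xX] unfolding F_harmonic_def by blast+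
    then show ?thesis
      unfolding \<psi>_def x by (cases "spherical_average U s") auto
  qed
  have wusc: "usc_on ?X w"
    unfolding w_def by (rule usc_on_max[OF F_subharmonic_usc[OF v] F_subharmonic_usc[OF U]])
  have wfin: "w x < \<infinity>" if "x \<in> ?X" for x
    unfolding w_def max_less_iff_conj
    using F_subharmonic_less_top[OF v that] F_subharmonic_less_top[OF U that] by (rule conjI)
  have cs: "continuous_on S (\<lambda>\<sigma> :: real^'n. t *\<^sub>R \<sigma>)" for S
    by (intro continuous_intros)
  have bdU: "sphere_bounded (\<lambda>\<sigma>. truncation U N (t *\<^sub>R \<sigma>))" for N
    by (rule sphere_bounded_truncation[OF F_subharmonic_usc[OF U] op F_subharmonic_less_top[OF U] cs scale])
  have bdw: "sphere_bounded (\<lambda>\<sigma>. truncation w N (t *\<^sub>R \<sigma>))" for N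
    by (rule sphere_bounded_truncation[OF wusc op wfin cs scale])
  define E where "E = {\<sigma>\<in>sphere 0 1. ereal c2 \<le> w (t *\<^sub>R \<sigma>) \<and> U (t *\<^sub>R \<sigma>) < ereal c1}"
  have "E \<in> sets sphere_measure"
  proof -
    let ?D = "{x\<in>?X. U x < ereal c1} - {x\<in>?X. w x < ereal c2}"
    have "E = {\<sigma>\<in>sphere 0 1. 0 + t *\<^sub>R \<sigma> \<in> ?D}"
      using scale unfolding E_def by (auto simp: not_less)
    moreover have "?D \<in> sets borel"
      by (intro sets.Diff borel_open usc_on_open_less[OF wusc op] usc_on_open_less[OF F_subharmonic_usc[OF U] op])
    ultimately show ?thesis
      using sphere_slice_sets[of ?D 0 t] by (simp only:)
  qed
  then have bdE: "sphere_bounded (indicat_real E)"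
    unfolding sphere_bounded_def by (auto intro!: exI[of _ 1] simp: indicator_def)
  have "(c2 - c1) * sphere_mean (indicat_real E) \<le> 0"
  proof (rule field_le_epsilon)
    fix d :: real assume "0 < d"
    obtain N0 where N0: "\<And>N. N0 \<le> N \<Longrightarrow> sphere_mean (\<lambda>\<sigma>. truncation w N (t *\<^sub>R \<sigma>)) \<le> \<psi> t + d"
      using spherical_mean_le[OF n a U v harm mono \<psi> t vU t12 \<open>0 < d\<close>] unfolding w_def by blast
    obtain N1 :: nat where N1: "- c1 \<le> real N1" using real_arch_simple by blast
    \<comment> \<open>From \<open>- N \<le> c1\<close> on, truncation leaves the gap between \<open>U\<close> and \<open>w\<close> on \<open>E\<close> at least \<open>c2 - c1\<close>.\<close>
    define N where "N = max N0 N1"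
    have N: "N0 \<le> N" "- real N \<le> c1" using N1 by (auto simp: N_def)
    have "\<psi> t \<le> sphere_mean (\<lambda>\<sigma>. truncation U N (t *\<^sub>R \<sigma>))"
      by (rule spherical_average_truncation(1)[OF \<psi> bdU]) (use t t12 inb[of t] F_subharmonic_less_top[OF U scale] in auto)
    then have "\<psi> t + (c2 - c1) * sphere_mean (indicat_real E) \<le> sphere_mean (\<lambda>\<sigma>. truncation U N (t *\<^sub>R \<sigma>)) + sphere_mean (\<lambda>\<sigma>. (c2 - c1) * indicat_real E \<sigma>)"
      by (simp add: sphere_mean_cmult)
    also have "\<dots> = sphere_mean (\<lambda>\<sigma>. truncation U N (t *\<^sub>R \<sigma>) + (c2 - c1) * indicat_real E \<sigma>)"
      by (rule sphere_mean_add[symmetric]) (intro bdU sphere_bounded_cmult bdE)+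
    also have "\<dots> \<le> sphere_mean (\<lambda>\<sigma>. truncation w N (t *\<^sub>R \<sigma>))"
    proof (rule sphere_mean_mono[OF _ bdw])
      show "sphere_bounded (\<lambda>\<sigma>. truncation U N (t *\<^sub>R \<sigma>) + (c2 - c1) * indicat_real E \<sigma>)"
        by (intro sphere_bounded_add bdU sphere_bounded_cmult bdE)
      fix \<sigma> :: "real^'n" assume \<sigma>: "\<sigma> \<in> sphere 0 1"
      have Ufin: "U (t *\<^sub>R \<sigma>) < \<infinity>" by (rule F_subharmonic_less_top[OF U scale[OF \<sigma>]])
      show "truncation U N (t *\<^sub>R \<sigma>) + (c2 - c1) * indicat_real E \<sigma> \<le> truncation w N (t *\<^sub>R \<sigma>)"
      proof (cases "\<sigma> \<in> E")
        case True
        then have E: "ereal c2 \<le> w (t *\<^sub>R \<sigma>)" "U (t *\<^sub>R \<sigma>) < ereal c1" by (auto simp: E_def)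
        have "ereal (truncation U N (t *\<^sub>R \<sigma>)) \<le> ereal c1"
          unfolding ereal_truncation[of U, OF Ufin] using E(2) N(2) by simp
        moreover have "ereal c2 \<le> ereal (truncation w N (t *\<^sub>R \<sigma>))"
          unfolding ereal_truncation[of w, OF wfin[OF scale[OF \<sigma>]]] using E(1) by (simp add: le_max_iff_disj)
        ultimately show ?thesis using True by simp
      next
        case False
        have "truncation U N (t *\<^sub>R \<sigma>) \<le> truncation w N (t *\<^sub>R \<sigma>)"
          by (rule truncation_mono) (use wfin[OF scale[OF \<sigma>]] in \<open>auto simp: w_def\<close>)
        then show ?thesis using False by simp
      qed
    qed
    also have "\<dots> \<le> \<psi> t + d" by (rule N0[OF N(1)])
    finally show "(c2 - c1) * sphere_mean (indicat_real E) \<le> 0 + d" by simp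
  qed
  then have "sphere_mean (indicat_real E) \<le> 0"
    using c by (simp add: mult_le_0_iff)
  moreover have "E \<inter> sphere 0 1 = E" by (auto simp: E_def)
  ultimately have "measure sphere_measure E \<le> 0"
    using \<open>E \<in> sets sphere_measure\<close> sphere_area_pos[where 'n = 'n]
    by (simp add: sphere_mean_def divide_le_0_iff not_less)
  then have "measure sphere_measure E = 0"
    using measure_nonneg[of sphere_measure E] by (rule antisym)
  then have "emeasure sphere_measure E = 0"
    by (simp add: sphere_measure.emeasure_eq_measure)
  then have "E \<in> null_sets sphere_measure"
    using \<open>E \<in> sets sphere_measure\<close> by (simp add: null_sets_def)
  then show ?thesis by (simp only: E_def)
qed

text \<open>If \<open>v\<close> exceeds \<open>U\<close> at \<open>x0\<close>, then \<open>U <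
  c1\<close> on a ball about \<open>x0\<close>, for some \<open>c1 < c2 < v x0\<close>. The set
  where \<open>w \<ge> c2\<close> in this ball is negligible, so \<open>w \<le> c2\<close> almost
  everywhere on almost every small sphere about \<open>x0\<close>, which contradicts the classical
  mean value inequality at \<open>x0\<close>.\<close>

lemma average_harmonic_imp_maximal:
  fixes U :: "real^'n \<Rightarrow> ereal"
  assumes n: "CARD('n) \<ge> 2" and a: "0 \<le> a"
    and U: "F_subharmonic F (annulus a b) U"
    and harm: "F_harmonic F (annulus a b) (\<lambda>x. spherical_average U (norm x))"
    and mono: "mono_on {t. a < t \<and> ereal t < b} (spherical_average U)"
  shows "F_maximal F (annulus a b) U"
  unfolding F_maximal_def
proof (intro conjI allI impI ballI U)
  fix v K and x0 :: "real^'n"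
  let ?X = "annulus a b :: (real^'n) set"
  assume v: "F_subharmonic F ?X v" and K: "compact K" "K \<subseteq> ?X" and vU: "\<forall>x\<in>?X - K. v x \<le> U x" and x0: "x0 \<in> ?X"
  show "v x0 \<le> U x0"
  proof (rule ccontr)
    assume "\<not> v x0 \<le> U x0"
    then have less: "U x0 < v x0" by simp
    then have "x0 \<in> K" using vU x0 by (meson DiffI not_le)
    have cn: "continuous_on K norm" by (intro continuous_intros)
    obtain y1 where y1: "y1 \<in> K" "\<And>y. y \<in> K \<Longrightarrow> norm y1 \<le> norm y"
      using continuous_attains_inf[OF K(1) _ cn] \<open>x0 \<in> K\<close> by blast
    obtain y2 where y2: "y2 \<in> K" "\<And>y. y \<in> K \<Longrightarrow> norm y \<le> norm y2"
      using continuous_attains_sup[OF K(1) _ cn] \<open>x0 \<in> K\<close> by blast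
    have y12: "a < norm y1" "ereal (norm y2) < b"
      using y1(1) y2(1) K(2) by (auto simp: annulus_def)
    obtain t1 where t1: "a < t1" "t1 < norm y1" using dense[OF y12(1)] by blast
    obtain t2 where t2: "ereal (norm y2) < ereal t2" "ereal t2 < b" using ereal_dense2[OF y12(2)] by blast
    have t12: "t1 < t2" using t1 t2 y1(2)[OF \<open>x0 \<in> K\<close>] y2(2)[OF \<open>x0 \<in> K\<close>] by simp
    have t0: "0 < t1" using a t1 by simp
    have x0t: "t1 < norm x0" "norm x0 < t2"
      using t1 t2 y1(2)[OF \<open>x0 \<in> K\<close>] y2(2)[OF \<open>x0 \<in> K\<close>] by auto
    have Xs: "x \<in> ?X" if "t1 \<le> norm x" "norm x \<le> t2" for x :: "real^'n"
    proof -
      have "ereal (norm x) < b"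
        using that(2) t2(2) by (metis ereal_less_eq(3) le_less_trans)
      then show ?thesis using that(1) t1 by (simp add: annulus_def)
    qed
    have bdry: "v x \<le> U x" if "norm x = t1 \<or> norm x = t2" for x
    proof -
      have "x \<notin> K"
        using that t1(2) t2(1) y1(2)[of x] y2(2)[of x] by auto
      moreover have "x \<in> ?X" using that t12 by (intro Xs) auto
      ultimately show ?thesis using vU by blast
    qed
    define w where "w x = max (v x) (U x)" for x
    note op = F_subharmonic_open[OF U]
    have wusc: "usc_on ?X w"
      unfolding w_def by (rule usc_on_max[OF F_subharmonic_usc[OF v] F_subharmonic_usc[OF U]])
    have wfin: "w x < \<infinity>" if "x \<in> ?X" for x
      unfolding w_def max_less_iff_conj
      using F_subharmonic_less_top[OF v that] F_subharmonic_less_top[OF U that] by (rule conjI)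
    obtain c1 where c1: "U x0 < ereal c1" "ereal c1 < v x0" using ereal_dense2[OF less] by blast
    obtain c2 where c2: "ereal c1 < ereal c2" "ereal c2 < v x0" using ereal_dense2[OF c1(2)] by blast
    have c12: "c1 < c2" using c2(1) by simp
    define W where "W = {x\<in>?X. U x < ereal c1} \<inter> norm -` {t1<..<t2}"
    have "open W"
      unfolding W_def
    proof (rule open_Int)
      show "open {x\<in>?X. U x < ereal c1}" by (rule usc_on_open_less[OF F_subharmonic_usc[OF U] op])
      show "open (norm -` {t1<..<t2} :: (real^'n) set)"
        by (intro continuous_open_vimage) (auto intro: continuous_intros)
    qed
    moreover have "x0 \<in> W" using x0 c1(1) x0t by (simp add: W_def)
    ultimately obtain \<rho> where "0 < \<rho>" and \<rho>: "ball x0 \<rho> \<subseteq> W" using open_contains_ball by blast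
    have ballW: "t1 < norm x" "norm x < t2" "x \<in> ?X" "U x < ereal c1" if "x \<in> ball x0 \<rho>" for x
      using subsetD[OF \<rho> that] by (auto simp: W_def)
    note inX = ballW(3)
    define D where "D = {x\<in>ball x0 \<rho>. ereal c2 \<le> w x}"
    have D: "D \<in> sets borel"
    proof -
      have "D = ball x0 \<rho> - {x\<in>?X. w x < ereal c2}"
        using inX by (auto simp: D_def not_less)
      then show ?thesis
        using usc_on_open_less[OF wusc op, of "ereal c2"] by (simp add: borel_open sets.Diff)
    qed

    \<comment> \<open>Almost every sphere about the origin meets \<open>D\<close> in a null set, hence so does almost every sphere about \<open>x0\<close>.\<close>
    have "AE x in lborel. x \<notin> D"
    proof (rule null_if_spheres_null[OF D])
      show "0 \<notin> D"
      proof
        assume "0 \<in> D"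
        then have "0 \<in> ball x0 \<rho>" unfolding D_def by blast
        from ballW(1)[OF this] show False using t0 by simp
      qed
      show "bounded D" by (rule bounded_subset[OF bounded_ball[of x0 \<rho>]]) (auto simp: D_def)
      fix t :: real assume "0 < t"
      show "emeasure sphere_measure {\<sigma>\<in>sphere 0 1. t *\<^sub>R \<sigma> \<in> D} = 0"
      proof (cases "t1 \<le> t \<and> t \<le> t2")
        case True
        have null: "{\<sigma>\<in>sphere 0 1. ereal c2 \<le> w (t *\<^sub>R \<sigma>) \<and> U (t *\<^sub>R \<sigma>) < ereal c1} \<in> null_sets sphere_measure"
          unfolding w_def
          by (rule excess_null_on_spheres[OF n a U v harm mono t1(1) t12 t2(2) bdry _ _ c12]) (use True in auto)
        have "{\<sigma>\<in>sphere 0 1. t *\<^sub>R \<sigma> \<in> D} \<subseteq> {\<sigma>\<in>sphere 0 1. ereal c2 \<le> w (t *\<^sub>R \<sigma>) \<and> U (t *\<^sub>R \<sigma>) < ereal c1}"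
          using ballW(4) by (auto simp: D_def simp del: mem_ball)
        moreover have "{\<sigma>\<in>sphere 0 1. t *\<^sub>R \<sigma> \<in> D} \<in> sets sphere_measure"
          using sphere_slice_sets[OF D, of 0 t] by simp
        ultimately have "{\<sigma>\<in>sphere 0 1. t *\<^sub>R \<sigma> \<in> D} \<in> null_sets sphere_measure"
          by (intro null_sets_subset[OF null])
        then show ?thesis by (rule null_setsD1)
      next
        case False
        have "{\<sigma>\<in>sphere 0 1. t *\<^sub>R \<sigma> \<in> D} = {}"
        proof (rule equals0I)
          fix \<sigma> assume "\<sigma> \<in> {\<sigma>\<in>sphere 0 1. t *\<^sub>R \<sigma> \<in> D}"
          then have "norm (t *\<^sub>R \<sigma>) = t" "t *\<^sub>R \<sigma> \<in> ball x0 \<rho>"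
            using \<open>0 < t\<close> by (auto simp: D_def)
          then show False using ballW(1,2)[of "t *\<^sub>R \<sigma>"] False by simp
        qed
        then show ?thesis by (simp only: emeasure_empty)
      qed
    qed
    from spheres_null_if_null[OF D this, of x0] obtain r where r: "0 < r" "r < \<rho>"
      "0 < r \<longrightarrow> emeasure sphere_measure {\<sigma>\<in>sphere 0 1. x0 + r *\<^sub>R \<sigma> \<in> D} = 0"
      using AE_lborel_obtain[where P = "\<lambda>t. 0 < t \<longrightarrow> emeasure sphere_measure {\<sigma>\<in>sphere 0 1. x0 + t *\<^sub>R \<sigma> \<in> D} = 0",
        OF _ \<open>0 < \<rho>\<close>] by blast
    define T where "T = r *\<^sub>R (mat 1 :: real^'n^'n)"
    have Tz: "T *v z = r *\<^sub>R z" for z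
      by (simp add: T_def scaleR_matrix_vector_assoc[symmetric])
    have Tball: "x0 + T *v z \<in> ball x0 \<rho>" if "z \<in> cball 0 1" for z
    proof -
      have "r * norm z \<le> r * 1" using that r(1) by (intro mult_left_mono) auto
      then have "r * norm z < \<rho>" using r(2) by linarith
      then show ?thesis using r(1) by (simp add: Tz dist_norm)
    qed
    have inv: "invertible T"
      unfolding T_def by (rule invertible_scaleR_matrix) (use r in \<open>auto simp: invertible_def intro: exI[of _ "mat 1"]\<close>)
    obtain N :: nat where N: "- c2 \<le> real N" using real_arch_simple by blast
    have "\<forall>A\<in>F. 0 \<le> (T ** transpose T) \<bullet> A"
    proof
      fix A assume "A \<in> F"
      then have "0 \<le> trace A" by (rule trace_nonneg)
      moreover have "mat 1 \<bullet> A = trace A"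
        by (simp add: inner_matrix_trace transpose_mat)
      ultimately show "0 \<le> (T ** transpose T) \<bullet> A"
        unfolding T_def scaleR_gram by (simp add: transpose_mat)
    qed
    then have "viscosity_sub (T ** transpose T) ?X (truncation w N)"
      using cone_viscosity_sub_truncation_max[OF v U, of N] unfolding cone_viscosity_sub_def w_def[abs_def] by blast
    from viscosity_sub_le_sphere_mean[OF n this real_usc_truncation[OF wusc op wfin] inv inX[OF Tball], of "- real N"]
    have le: "truncation w N x0 \<le> sphere_mean (\<lambda>z. truncation w N (x0 + r *\<^sub>R z))"
      using truncation_ge[of w _ N] wfin unfolding Tz by blast
    have bd: "sphere_bounded (\<lambda>z. truncation w N (x0 + r *\<^sub>R z))"
    proof (rule sphere_bounded_truncation[OF wusc op wfin])
      show "continuous_on (sphere 0 1) (\<lambda>z. x0 + r *\<^sub>R z)" by (intro continuous_intros)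
      show "x0 + r *\<^sub>R z \<in> ?X" if "z \<in> sphere 0 1" for z
        using inX[OF Tball, of z] that by (simp add: Tz)
    qed
    have "sphere_mean (\<lambda>z. truncation w N (x0 + r *\<^sub>R z)) \<le> c2"
    proof (rule sphere_mean_AE_le[OF bd])
      have "{\<sigma>\<in>sphere 0 1. x0 + r *\<^sub>R \<sigma> \<in> D} \<in> sets sphere_measure"
        by (rule sphere_slice_sets[OF D])
      then have "{\<sigma>\<in>sphere 0 1. x0 + r *\<^sub>R \<sigma> \<in> D} \<in> null_sets sphere_measure"
        using r(1,3) by (simp add: null_sets_def)
      then have "AE \<sigma> in sphere_measure. \<sigma> \<notin> {\<sigma>\<in>sphere 0 1. x0 + r *\<^sub>R \<sigma> \<in> D}"
        by (rule AE_not_in)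
      then show "AE \<sigma> in sphere_measure. truncation w N (x0 + r *\<^sub>R \<sigma>) \<le> c2"
      proof (rule AE_mp, intro AE_I2 impI)
        fix \<sigma> assume s: "\<sigma> \<in> space (sphere_measure :: (real^'n) measure)" and "\<sigma> \<notin> {\<sigma>\<in>sphere 0 1. x0 + r *\<^sub>R \<sigma> \<in> D}"
        then have "x0 + r *\<^sub>R \<sigma> \<notin> D" "x0 + r *\<^sub>R \<sigma> \<in> ball x0 \<rho>"
          using Tball[of \<sigma>] by (auto simp: Tz)
        then have "w (x0 + r *\<^sub>R \<sigma>) < ereal c2" "x0 + r *\<^sub>R \<sigma> \<in> ?X"
          using inX by (auto simp: D_def not_le)
        then have "ereal (truncation w N (x0 + r *\<^sub>R \<sigma>)) \<le> ereal c2"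
          using N ereal_truncation[of w "x0 + r *\<^sub>R \<sigma>" N] wfin by simp
        then show "truncation w N (x0 + r *\<^sub>R \<sigma>) \<le> c2" by simp
      qed
    qed
    moreover have "ereal c2 < ereal (truncation w N x0)"
      unfolding ereal_truncation[of w x0 N, OF wfin[OF x0]] using c2(2) by (simp add: w_def less_max_iff_disj)
    ultimately show False using le by simp
  qed
qed

end

lemma ST_invariant_transitive_cone_subequation:
  fixes F :: "(real^'n^'n) set"
  assumes "cone_subequation F" "convex F" "ST_invariant F"
  obtains G where "transitive_cone_subequation G F"
proof -
  obtain G where G: "subgroup G orthogonal_group" "\<And>x y. x \<in> sphere 0 1 \<Longrightarrow> y \<in> sphere 0 1 \<Longrightarrow> \<exists>g\<in>G. g *v x = y"
    "\<And>g A. g \<in> G \<Longrightarrow> A \<in> F \<Longrightarrow> g ** A ** transpose g \<in> F"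
    using assms(3) unfolding ST_invariant_def by blast
  interpret group "orthogonal_group :: (real^'n^'n) monoid" by (rule group_orthogonal_group)
  have orth: "orthogonal_matrix g" if "g \<in> G" for g
    using subgroup.mem_carrier[OF G(1) that] by (simp add: orthogonal_group_def)
  have "transitive_cone_subequation G F"
  proof
    fix g assume g: "g \<in> G"
    show "orthogonal_matrix g" by (rule orth[OF g])
    have "m_inv orthogonal_group g = transpose g"
      using orth[OF g] by (intro inv_equality) (auto simp: orthogonal_group_def orthogonal_matrix_def)
    then show "transpose g \<in> G"
      using subgroup.m_inv_closed[OF G(1) g] by simp
  next
    show "mat 1 \<in> G"
      using subgroup.one_closed[OF G(1)] by (simp add: orthogonal_group_def)
    show "g ** h \<in> G" if "g \<in> G" "h \<in> G" for g h
      using subgroup.m_closed[OF G(1) that] by (simp add: orthogonal_group_def)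
  qed (use G assms in auto)
  then show thesis by (rule that)
qed

theorem theorem1p7:
  fixes F :: "(real^'n^'n) set" and U :: "real^'n \<Rightarrow> ereal" and a :: real and b :: ereal
  assumes "CARD('n) \<ge> 2"
    and "0 \<le> a" and "ereal a < b"
    and "cone_subequation F" and "convex F" and "ST_invariant F"
    and "F_subharmonic F (annulus a b) U"
    and "F_harmonic F (annulus a b) (\<lambda>x. spherical_average U (norm x))"
    and "mono_on {t. a < t \<and> ereal t < b} (spherical_average U)"
  shows "F_maximal F (annulus a b) U"
proof -
  obtain G where "transitive_cone_subequation G F"
    using ST_invariant_transitive_cone_subequation[OF assms(4-6)] by blast
  then show ?thesis
    using assms by (intro transitive_cone_subequation.average_harmonic_imp_maximal)
qed

end
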